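(* Let $(\mathsf X,\mathcal B)$ be a measurable space and let $\mathcal P$ and $\mathcal Q$ be nonempty sets of probability measures on it. The following are equivalent. (i) For some $n\ge1$, there exists a measurable $\varphi:\mathsf X^n\to[0,1]$ such that $\inf_{Q\in\mathcal Q}\mathbb E_{Q^n}\varphi>\sup_{P\in\mathcal P}\mathbb E_{P^n}\varphi$. (ii) For every $\eta>0$, there is an optionally ARL-valid family $(T_\gamma)_{\gamma\ge1}$ for $\mathcal P$ satisfying $$\gamma\le\inf_{P\in\mathcal P}\mathbb E_{P^\infty}T_\gamma\le\sup_{P\in\mathcal P}\mathbb E_{P^\infty}T_\gamma\le(1+\eta)\gamma+1\qquad\text{for all }\gamma\ge1$$ and $\sup_{Q\in\mathcal Q}\mathcal J_Q(T_\gamma)=O_\eta(\log\gamma)$ (as $\gamma\to\infty$, the implied constant depending on $\eta$ but not on $\gamma$). (iii) There is an optionally ARL-valid family $(T_\gamma)_{\gamma\ge1}$ for $\mathcal P$ for which $\sup_{Q\in\mathcal Q}\mathcal J_Q(T_\gamma)/\gamma\to0$ as $\gamma\to\infty$. Condition (i) is moreover equivalent to each of the following: (a) for some $n\ge1$, $d_{\mathrm{TV}}(\mathscr C_n,\mathscr D_n(\mathcal Q))>0$; (b) there are finite constants $A,B$ such that for every $\alpha\in(0,1)$ there is a level-$\alpha$ test $\tau_\alpha$ for $\mathcal P$ with power one against every $Q\in\mathcal Q$ and $\sup_{Q\in\mathcal Q}\mathbb E_{Q^\infty}\tau_\alpha\le A+B\log(1/\alpha)$; (c) for some $\alpha\in(0,1)$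 there is a level-$\alpha$ test $\tau$ for $\mathcal P$ with $\sup_{Q\in\mathcal Q}Q^\infty(\tau>k)\to0$ as $k\to\infty$. In condition (ii), the family may be chosen as the threshold family $T_\gamma=\inf\{t\ge1:\mathcal D_t\ge\gamma\}$, $\gamma\ge1$, of one common e-detector $(\mathcal D_t)_{t\ge 0}$ for $\mathcal P$. In this case, there is one common $\gamma_0$ such that $\mathcal J_Q(T_\gamma)<\inf_{P\in\mathcal P}\mathbb E_{P^\infty}T_\gamma$ for every $Q\in\mathcal Q$ and every $\gamma\ge\gamma_0$.
   Context: **Testing.** For a probability measure $R$ on $(\mathsf X,\mathcal B)$, $R^n$ and $R^\infty$ denote i.i.d. product laws on $\mathsf X^n$ and $\mathsf X^{\mathbb N}$; $(X_i)_{i\ge1}$ is the coordinate process. A (sequential) test is a stopping time $\tau$ with values in $\{1,2,\dots\}\cup\{\infty\}$ for the filtration $(\sigma(X_1,\dots,X_n))_n$. It is level-$\alpha$ for $\mathcal P$ if $\sup_{P\in\mathcal P}P^\infty(\tau<\infty)\le\alpha$, and has power one against $Q$ if $Q^\infty(\tau<\infty)=1$. **Change-detection model.** Procedures may use auxiliary randomization independent of the observations under every law: the sample space is $\mathsf X^{\mathbb N}$, possibly times an auxiliary probability space, and $(\mathcal F_t)_{t\ge0}$ is the filtration generated by $X_1,\dots,X_t$ together with the auxiliary variables revealed through time $t$ (without randomization, the coordinate filtration with $\mathcal F_0$ trivial). All probabilities and expectations (including those under $P^\infty$) include the auxiliary randomization as an independent product factor. For $P\in\mathcal P$, $Q\in\mathcal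 Q$, $\nu\ge1$, $\mathbb P_\nu^{P,Q}$ (expectation $\mathbb E_\nu^{P,Q}$) is the law under which the observations have law $P^{\nu-1}\otimes Q^\infty$, i.e. $X_1,\dots,X_{\nu-1}$ are i.i.d. $P$ and $X_\nu,X_{\nu+1},\dots$ are i.i.d. $Q$, all independent. An alarm time is an $(\mathcal F_t)$-stopping time with values in $\{1,2,\dots\}\cup\{\infty\}$. "There is a family" includes the choice of auxiliary randomization. An alarm time $T$ is optionally ARL-valid at scale $\gamma\ge1$ for $\mathcal P$ if $\mathbb P_{P^\infty}(T\le\sigma)\le\mathbb E_{P^\infty}\sigma/\gamma$ for every $P\in\mathcal P$ and every $(\mathcal F_t)$-stopping time $\sigma$, where $\{T\le\sigma\}$ means $\{T<\infty,\,T\le\sigma\}$. A family $(T_\gamma)_{\gamma\ge1}$ (indexed by real $\gamma\ge1$) is optionally ARL-valid if $T_\gamma$ is optionally ARL-valid at scale $\gamma$ for every $\gamma\ge1$. An e-detector for $\mathcal P$ is an $(\mathcal F_t)$-adapted process $(\mathcal D_t)_{t\ge0}$ with values in $[0,\infty]$, $\mathcal D_0=0$, such that $\mathbb E_{P^\infty}\mathcal D_\tau\le\mathbb E_{P^\infty}\tau$ for every $P\in\mathcal P$ and every stopping time $\tau$, with $\mathcal D_\infty:=\liminf_t\mathcal D_t$ (the inequality being automatic if $\mathbb E_{P^\infty}\tau=\infty$). Robust Lorden delay: $$\mathcal J_Q(T):=\sup_{P\in\mathcal P}\sup_{\nu\ge1}\operatorname{ess\,sup}\,\mathbb E_\nu^{P,Q}\big[(T-\nu+1)^+\mid\mathcal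 F_{\nu-1}\big].$$ **Geometry.** Let $\mathcal L_n$ be the Banach space of bounded $\mathcal B^{\otimes n}$-measurable real functions on $\mathsf X^n$ with the supremum norm, and $\mathrm{ba}_n=\mathcal L_n^*$ its dual (bounded finitely additive signed measures) with the weak-$*$ topology $\sigma(\mathrm{ba}_n,\mathcal L_n)$. $\mathscr C_n$ is the weak-$*$ closure of the convex hull of $\{P^n:P\in\mathcal P\}$ and $\mathscr D_n(\mathcal Q)$ is the weak-$*$ closure of the convex hull of $\{Q^n:Q\in\mathcal Q\}$ in $\mathrm{ba}_n$; their elements are finitely additive probability measures. For such $\mu,\nu$, $d_{\mathrm{TV}}(\mu,\nu)=\sup\{\mathbb E_\mu f-\mathbb E_\nu f: f\in\mathcal L_n,\ 0\le f\le1\}$, and the distance between two sets is the infimum over pairs. *)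

theory Defs
  imports "HOL-Probability.Probability"
begin

section \<open>Product laws\<close>

text \<open>
  A measurable space is a value \<open>X :: 'a measure\<close> of which only \<open>space X\<close> and \<open>sets X\<close> matter;
  applied to it, the two operators below give the spaces \<open>X\<^sup>n\<close> and \<open>X\<^sup>\<nat>\<close>.
  Coordinates are numbered from 0: the observation \<open>X\<^sub>i\<close> (\<open>i \<ge> 1\<close>) is the coordinate \<open>i - 1\<close>, so
  \<open>X\<^sub>1, \<dots>, X\<^sub>t\<close> are the coordinates in \<open>{..<t}\<close>.
\<close>

definition power_law :: "'a measure \<Rightarrow> nat \<Rightarrow> (nat \<Rightarrow> 'a) measure" where
  "power_law R n = (\<Pi>\<^sub>M i\<in>{..<n}. R)"

definition iid_law :: "'a measure \<Rightarrow> (nat \<Rightarrow> 'a) measure" where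
  "iid_law R = (\<Pi>\<^sub>M i\<in>UNIV. R)"

definition change_law :: "'a measure \<Rightarrow> 'a measure \<Rightarrow> nat \<Rightarrow> (nat \<Rightarrow> 'a) measure" where
  "change_law P Q \<nu> = (\<Pi>\<^sub>M i\<in>UNIV. if i < \<nu> - 1 then P else Q)"


section \<open>Filtrations and stopping times\<close>

definition obs_filtration :: "'a measure \<Rightarrow> nat \<Rightarrow> (nat \<Rightarrow> 'a) measure" where
  "obs_filtration X t =
     vimage_algebra (space (iid_law X)) (\<lambda>x. restrict x {..<t}) (power_law X t)"

text \<open>
  Auxiliary randomization is a probability space \<open>U\<close> together with the \<sigma>-algebras \<open>G t\<close> generated
  by the auxiliary variables revealed through time \<open>t\<close>. Every filtration arises in this way (take
  the identity map into \<open>(space U, G t)\<close> as the variable revealed at time \<open>t\<close>). A one-point \<open>U\<close> is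
  the case without randomization.
\<close>

definition aux_randomization :: "'u measure \<Rightarrow> (nat \<Rightarrow> 'u measure) \<Rightarrow> bool" where
  "aux_randomization U G \<longleftrightarrow>
     prob_space U \<and> filtration (space U) G \<and> (\<forall>t. subalgebra U (G t))"

definition full_filtration ::
  "'a measure \<Rightarrow> (nat \<Rightarrow> 'u measure) \<Rightarrow> nat \<Rightarrow> ((nat \<Rightarrow> 'a) \<times> 'u) measure" where
  "full_filtration X G t = obs_filtration X t \<Otimes>\<^sub>M G t"

text \<open>
  The library's \<^const>\<open>stopping_time\<close> takes its values in the index set of the filtration; here the
  filtration is indexed by the naturals and the value \<open>\<infinity>\<close> is allowed.
\<close>

definition ext_stopping_time :: "(nat \<Rightarrow> 'w measure) \<Rightarrow> ('w \<Rightarrow> enat) \<Rightarrow> bool" where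
  "ext_stopping_time F T \<longleftrightarrow> (\<forall>t. Measurable.pred (F t) (\<lambda>\<omega>. T \<omega> \<le> enat t))"

definition alarm_time :: "(nat \<Rightarrow> 'w measure) \<Rightarrow> ('w \<Rightarrow> enat) \<Rightarrow> bool" where
  "alarm_time F T \<longleftrightarrow> ext_stopping_time F T \<and> (\<forall>\<omega>\<in>space (F 0). 1 \<le> T \<omega>)"

definition mean_time :: "'w measure \<Rightarrow> ('w \<Rightarrow> enat) \<Rightarrow> ennreal" where
  "mean_time M T = (\<integral>\<^sup>+ \<omega>. ennreal_of_enat (T \<omega>) \<partial>M)"


section \<open>Sequential tests\<close>

definition level_test :: "'a measure \<Rightarrow> 'a measure set \<Rightarrow> real \<Rightarrow> ((nat \<Rightarrow> 'a) \<Rightarrow> enat) \<Rightarrow> bool" where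
  "level_test X PP \<alpha> \<tau> \<longleftrightarrow> alarm_time (obs_filtration X) \<tau> \<and>
     (SUP P\<in>PP. measure (iid_law P) {\<omega>\<in>space (iid_law P). \<tau> \<omega> < \<infinity>}) \<le> \<alpha>"

definition power_one :: "'a measure \<Rightarrow> ((nat \<Rightarrow> 'a) \<Rightarrow> enat) \<Rightarrow> bool" where
  "power_one Q \<tau> \<longleftrightarrow> measure (iid_law Q) {\<omega>\<in>space (iid_law Q). \<tau> \<omega> < \<infinity>} = 1"


section \<open>Change detection\<close>

definition optionally_ARL_valid ::
  "'a measure \<Rightarrow> 'u measure \<Rightarrow> (nat \<Rightarrow> 'u measure) \<Rightarrow> 'a measure set \<Rightarrow> real
     \<Rightarrow> ((nat \<Rightarrow> 'a) \<times> 'u \<Rightarrow> enat) \<Rightarrow> bool" where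
  "optionally_ARL_valid X U G PP \<gamma> T \<longleftrightarrow> alarm_time (full_filtration X G) T \<and>
     (\<forall>P\<in>PP. \<forall>\<sigma>. ext_stopping_time (full_filtration X G) \<sigma> \<longrightarrow>
        emeasure (iid_law P \<Otimes>\<^sub>M U) {\<omega>\<in>space (iid_law P \<Otimes>\<^sub>M U). T \<omega> < \<infinity> \<and> T \<omega> \<le> \<sigma> \<omega>}
          \<le> mean_time (iid_law P \<Otimes>\<^sub>M U) \<sigma> / ennreal \<gamma>)"

definition optionally_ARL_valid_family ::
  "'a measure \<Rightarrow> 'u measure \<Rightarrow> (nat \<Rightarrow> 'u measure) \<Rightarrow> 'a measure set
     \<Rightarrow> (real \<Rightarrow> (nat \<Rightarrow> 'a) \<times> 'u \<Rightarrow> enat) \<Rightarrow> bool" where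
  "optionally_ARL_valid_family X U G PP T \<longleftrightarrow> (\<forall>\<gamma>\<ge>1. optionally_ARL_valid X U G PP \<gamma> (T \<gamma>))"

definition stopped_value :: "(nat \<Rightarrow> 'w \<Rightarrow> ennreal) \<Rightarrow> ('w \<Rightarrow> enat) \<Rightarrow> 'w \<Rightarrow> ennreal" where
  "stopped_value D \<tau> \<omega> = (case \<tau> \<omega> of enat t \<Rightarrow> D t \<omega> | \<infinity> \<Rightarrow> liminf (\<lambda>t. D t \<omega>))"

definition e_detector ::
  "'a measure \<Rightarrow> 'u measure \<Rightarrow> (nat \<Rightarrow> 'u measure) \<Rightarrow> 'a measure set
     \<Rightarrow> (nat \<Rightarrow> (nat \<Rightarrow> 'a) \<times> 'u \<Rightarrow> ennreal) \<Rightarrow> bool" where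
  "e_detector X U G PP D \<longleftrightarrow>
     (\<forall>t. D t \<in> borel_measurable (full_filtration X G t)) \<and>
     (\<forall>\<omega>\<in>space (full_filtration X G 0). D 0 \<omega> = 0) \<and>
     (\<forall>P\<in>PP. \<forall>\<tau>. ext_stopping_time (full_filtration X G) \<tau> \<longrightarrow>
        (\<integral>\<^sup>+ \<omega>. stopped_value D \<tau> \<omega> \<partial>(iid_law P \<Otimes>\<^sub>M U)) \<le> mean_time (iid_law P \<Otimes>\<^sub>M U) \<tau>)"

definition threshold_time :: "(nat \<Rightarrow> 'w \<Rightarrow> ennreal) \<Rightarrow> real \<Rightarrow> 'w \<Rightarrow> enat" where
  "threshold_time D \<gamma> \<omega> = Inf {enat t |t. 1 \<le> t \<and> ennreal \<gamma> \<le> D t \<omega>}"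

text \<open>
  Subtraction on \<^typ>\<open>enat\<close> is truncated at 0 and \<open>\<infinity> - enat \<nu> = \<infinity>\<close>, so \<open>T \<omega> + 1 - enat \<nu>\<close> is
  the positive part of \<open>T - \<nu> + 1\<close>.
\<close>

definition robust_lorden_delay ::
  "'a measure \<Rightarrow> 'u measure \<Rightarrow> (nat \<Rightarrow> 'u measure) \<Rightarrow> 'a measure set \<Rightarrow> 'a measure
     \<Rightarrow> ((nat \<Rightarrow> 'a) \<times> 'u \<Rightarrow> enat) \<Rightarrow> ennreal" where
  "robust_lorden_delay X U G PP Q T =
     (SUP P\<in>PP. SUP \<nu>\<in>{1..}.
        esssup (change_law P Q \<nu> \<Otimes>\<^sub>M U)
          (nn_cond_exp (change_law P Q \<nu> \<Otimes>\<^sub>M U) (full_filtration X G (\<nu> - 1))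
             (\<lambda>\<omega>. ennreal_of_enat (T \<omega> + 1 - enat \<nu>))))"

text \<open>
  The delay may be infinite, so the bound \<open>O(log \<gamma>)\<close> is written out in \<^typ>\<open>ennreal\<close>; the Landau
  symbols of the library apply to real-valued functions only.
\<close>

definition log_delay_family ::
  "'a measure \<Rightarrow> 'u measure \<Rightarrow> (nat \<Rightarrow> 'u measure) \<Rightarrow> 'a measure set \<Rightarrow> 'a measure set \<Rightarrow> real
     \<Rightarrow> (real \<Rightarrow> (nat \<Rightarrow> 'a) \<times> 'u \<Rightarrow> enat) \<Rightarrow> bool" where
  "log_delay_family X U G PP QQ \<eta> T \<longleftrightarrow>
     optionally_ARL_valid_family X U G PP T \<and>
     (\<forall>\<gamma>\<ge>1.
        ennreal \<gamma> \<le> (INF P\<in>PP. mean_time (iid_law P \<Otimes>\<^sub>M U) (T \<gamma>)) \<and>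
        (INF P\<in>PP. mean_time (iid_law P \<Otimes>\<^sub>M U) (T \<gamma>))
          \<le> (SUP P\<in>PP. mean_time (iid_law P \<Otimes>\<^sub>M U) (T \<gamma>)) \<and>
        (SUP P\<in>PP. mean_time (iid_law P \<Otimes>\<^sub>M U) (T \<gamma>)) \<le> ennreal ((1 + \<eta>) * \<gamma> + 1)) \<and>
     (\<exists>C::real. \<forall>\<^sub>F \<gamma> in at_top.
        (SUP Q\<in>QQ. robust_lorden_delay X U G PP Q (T \<gamma>)) \<le> ennreal (C * ln \<gamma>))"


section \<open>Bounded measurable functions and their dual\<close>

definition bounded_measurable :: "'w measure \<Rightarrow> ('w \<Rightarrow> real) set" where
  "bounded_measurable M =
     {f \<in> borel_measurable M \<inter> extensional (space M). bounded (f ` space M)}"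

definition ba :: "'w measure \<Rightarrow> (('w \<Rightarrow> real) \<Rightarrow> real) set" where
  "ba M = {\<mu> \<in> extensional (bounded_measurable M).
     (\<forall>f\<in>bounded_measurable M. \<forall>g\<in>bounded_measurable M. \<forall>a b.
        \<mu> (\<lambda>x\<in>space M. a * f x + b * g x) = a * \<mu> f + b * \<mu> g) \<and>
     (\<exists>C. \<forall>f\<in>bounded_measurable M. \<bar>\<mu> f\<bar> \<le> C * (SUP x\<in>space M. \<bar>f x\<bar>))}"

definition weak_star_topology :: "'w measure \<Rightarrow> (('w \<Rightarrow> real) \<Rightarrow> real) topology" where
  "weak_star_topology M =
     subtopology (product_topology (\<lambda>_. euclideanreal) (bounded_measurable M)) (ba M)"

definition expectation_functional :: "'w measure \<Rightarrow> 'w measure \<Rightarrow> ('w \<Rightarrow> real) \<Rightarrow> real" where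
  "expectation_functional M R = (\<lambda>f\<in>bounded_measurable M. \<integral>x. f x \<partial>R)"

text \<open>
  The library's \<^const>\<open>convex\<close> is restricted to types in the class of real vector spaces, which
  function types do not belong to; this is the same definition for sets of functionals.
\<close>

definition convex_functionals :: "'w measure \<Rightarrow> (('w \<Rightarrow> real) \<Rightarrow> real) set \<Rightarrow> bool" where
  "convex_functionals M K \<longleftrightarrow>
     (\<forall>\<mu>\<in>K. \<forall>\<nu>\<in>K. \<forall>u\<ge>0. \<forall>v\<ge>0. u + v = 1 \<longrightarrow>
        (\<lambda>f\<in>bounded_measurable M. u * \<mu> f + v * \<nu> f) \<in> K)"

definition closed_hull_powers ::
  "'a measure \<Rightarrow> nat \<Rightarrow> 'a measure set \<Rightarrow> (((nat \<Rightarrow> 'a) \<Rightarrow> real) \<Rightarrow> real) set" where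
  "closed_hull_powers X n RR =
     weak_star_topology (power_law X n) closure_of
       (convex_functionals (power_law X n) hull
          ((\<lambda>R. expectation_functional (power_law X n) (power_law R n)) ` RR))"

definition tv_dist ::
  "'w measure \<Rightarrow> (('w \<Rightarrow> real) \<Rightarrow> real) \<Rightarrow> (('w \<Rightarrow> real) \<Rightarrow> real) \<Rightarrow> real" where
  "tv_dist M \<mu> \<nu> =
     (SUP f\<in>{f\<in>bounded_measurable M. \<forall>x\<in>space M. 0 \<le> f x \<and> f x \<le> 1}. \<mu> f - \<nu> f)"

definition tv_set_dist ::
  "'w measure \<Rightarrow> (('w \<Rightarrow> real) \<Rightarrow> real) set \<Rightarrow> (('w \<Rightarrow> real) \<Rightarrow> real) set \<Rightarrow> real" where
  "tv_set_dist M K L = (INF (\<mu>, \<nu>)\<in>K \<times> L. tv_dist M \<mu> \<nu>)"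


section \<open>The testing conditions\<close>

definition fixed_sample_separation :: "'a measure \<Rightarrow> 'a measure set \<Rightarrow> 'a measure set \<Rightarrow> bool" where
  "fixed_sample_separation X PP QQ \<longleftrightarrow>
     (\<exists>n\<ge>1. \<exists>\<phi>\<in>borel_measurable (power_law X n).
        (\<forall>x\<in>space (power_law X n). 0 \<le> \<phi> x \<and> \<phi> x \<le> (1::real)) \<and>
        (INF Q\<in>QQ. \<integral>x. \<phi> x \<partial>power_law Q n) > (SUP P\<in>PP. \<integral>x. \<phi> x \<partial>power_law P n))"

definition tv_separation :: "'a measure \<Rightarrow> 'a measure set \<Rightarrow> 'a measure set \<Rightarrow> bool" where
  "tv_separation X PP QQ \<longleftrightarrow>
     (\<exists>n\<ge>1. tv_set_dist (power_law X n) (closed_hull_powers X n PP) (closed_hull_powers X n QQ) > 0)"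

definition log_power_one_tests :: "'a measure \<Rightarrow> 'a measure set \<Rightarrow> 'a measure set \<Rightarrow> bool" where
  "log_power_one_tests X PP QQ \<longleftrightarrow>
     (\<exists>A B :: real. \<forall>\<alpha>\<in>{0<..<1}. \<exists>\<tau>. level_test X PP \<alpha> \<tau> \<and> (\<forall>Q\<in>QQ. power_one Q \<tau>) \<and>
        (SUP Q\<in>QQ. mean_time (iid_law Q) \<tau>) \<le> ennreal (A + B * ln (1 / \<alpha>)))"

definition uniformly_stopping_test :: "'a measure \<Rightarrow> 'a measure set \<Rightarrow> 'a measure set \<Rightarrow> bool" where
  "uniformly_stopping_test X PP QQ \<longleftrightarrow>
     (\<exists>\<alpha>\<in>{0<..<1}. \<exists>\<tau>. level_test X PP \<alpha> \<tau> \<and>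
        (\<lambda>k. SUP Q\<in>QQ. measure (iid_law Q) {\<omega>\<in>space (iid_law Q). enat k < \<tau> \<omega>})
          \<longlonglongrightarrow> 0)"

end

theory Submission
  imports Defs
begin

text \<open>
  Hoeffding's inequality on blocks of \<open>n\<close> observations amplifies a separating \<open>\<phi>\<close> to tests on
  \<open>K m\<close> observations with both errors at most \<open>2\<^sup>-\<^sup>m\<close>; stopping at the first rejection with \<open>m > k\<close>
  has level \<open>2\<^sup>-\<^sup>k\<close> and mean \<open>O(k)\<close>. From level \<open>4\<^sup>-\<^sup>(\<^sup>m\<^sup>+\<^sup>1\<^sup>)\<close> tests \<open>\<tau>\<^sub>m\<close> one gets an e-detector by restarting all
  of them at every time \<open>s\<close> and paying \<open>2\<^sup>m\<^sup>+\<^sup>1\<close> for each rejection. The total payment of one restart has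
  mean at most 1 and is independent of the past, so the sum over \<open>s < \<sigma>\<close> has mean at most that of \<open>\<sigma>\<close>,
  whatever the stopping time \<open>\<sigma>\<close>. Mixing with the e-detector \<open>t\<close>, with weight \<open>1 / (1 + \<eta>)\<close>, bounds the
  alarm times and makes randomization superfluous. Conversely, for delays of order \<open>o(\<gamma>)\<close> the event
  \<open>T\<^sub>\<gamma> \<le> \<gamma> / 2\<close> separates, because ARL-validity against a constant \<open>\<sigma>\<close> bounds its probability under \<open>\<P>\<close>.
  Total variation separation yields a separating function by weak-* compactness, which leaves finitely
  many candidates, and a finite minimax argument, which combines them into one.
\<close>

section \<open>Product laws and the observation filtration\<close>

text \<open>The difficulty in Lorden's criterion is the essential supremum over the past: a
  statistic that the pre-change data have driven down would need extra time to recover. Here every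
  restart only adds nonnegative payments, so no past can hold back the restart that coincides with
  the change, and the conditional delay is bounded by the unconditional mean of one test. A single
  test does not serve all thresholds: crossing \<gamma> by one rejection takes a payment of order
  \<gamma>, hence a false rejection probability of order 1/\<gamma>. Running all levels at once
  gives a detector that does not depend on \<gamma>. Payments 2 ^ (m + 1) and levels 4 ^ -(m + 1)
  are matched: their products 2 ^ -(m + 1) sum to exactly 1, while m of order log \<gamma> already
  reaches \<gamma>. As the test at level 4 ^ -(m + 1) has mean of order m, the delay is logarithmic.
  The weight 1 / (1 + \<eta>) on the e-detector t forces an alarm by time (1 + \<eta>) * \<gamma>
  rounded up to an integer; the rounding is the additive 1 in the upper bound on the mean.\<close>

lemma sets_power_law: "sets R = sets X \<Longrightarrow> sets (power_law R n) = sets (power_law X n)"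
  unfolding power_law_def by (intro sets_PiM_cong) auto

lemma sets_iid_law: "sets R = sets X \<Longrightarrow> sets (iid_law R) = sets (iid_law X)"
  unfolding iid_law_def by (intro sets_PiM_cong) auto

lemma sets_change_law:
  "sets P = sets X \<Longrightarrow> sets Q = sets X \<Longrightarrow> sets (change_law P Q \<nu>) = sets (iid_law X)"
  unfolding iid_law_def change_law_def by (intro sets_PiM_cong) auto

lemma space_iid_law: "sets R = sets X \<Longrightarrow> space (iid_law R) = space (iid_law X)"
  by (rule sets_eq_imp_space_eq[OF sets_iid_law])

lemma change_law_same: "change_law P P \<nu> = iid_law P"
  unfolding change_law_def iid_law_def by simp

lemma change_law_1: "change_law P Q (Suc 0) = iid_law Q"
  unfolding change_law_def iid_law_def by simp

lemma prob_space_iid_law: "prob_space R \<Longrightarrow> prob_space (iid_law R)"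
  unfolding iid_law_def by (intro prob_space_PiM)

lemma prob_space_power_law: "prob_space R \<Longrightarrow> prob_space (power_law R n)"
  unfolding power_law_def by (intro prob_space_PiM)

lemma prob_space_change_law: "prob_space P \<Longrightarrow> prob_space Q \<Longrightarrow> prob_space (change_law P Q \<nu>)"
  unfolding change_law_def by (intro prob_space_PiM) auto

section \<open>Marginals and splicing of sequences\<close>

lemma distr_iid_law_restrict:
  assumes "prob_space R"
  shows "distr (iid_law R) (power_law R n) (\<lambda>x. restrict x {..<n}) = power_law R n"
proof -
  interpret prob_space R by fact
  interpret product_prob_space "\<lambda>_. R" UNIV by unfold_locales
  show ?thesis unfolding iid_law_def power_law_def by (rule distr_PiM_restrict_finite) auto
qed

definition seq_shift :: "nat \<Rightarrow> (nat \<Rightarrow> 'a) \<Rightarrow> nat \<Rightarrow> 'a" where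
  "seq_shift s \<omega> = (\<lambda>i. \<omega> (s + i))"

lemma seq_shift_comb_seq [simp]: "seq_shift s (comb_seq s \<omega> \<omega>') = \<omega>'"
  by (auto simp: seq_shift_def comb_seq_def)

lemma restrict_comb_seq: "restrict (comb_seq s \<omega> \<omega>') {..<s} = restrict \<omega> {..<s}"
  by (auto simp: comb_seq_def restrict_def)

lemma measurable_seq_shift [measurable]: "seq_shift s \<in> iid_law X \<rightarrow>\<^sub>M iid_law X"
  unfolding seq_shift_def iid_law_def by (intro measurable_abs_UNIV measurable_component_singleton) auto

text \<open>The two laws agree on cylinders over finite index sets: coordinates below
  \<open>s\<close> constrain only the first sequence, the others only the second, read with the
  index lowered by \<open>s\<close>. The change point is \<open>Suc s\<close> because exactly the
  first \<open>s\<close> observations come from \<open>P\<close>.\<close>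

lemma distr_comb_seq:
  fixes P Q :: "'a measure"
  assumes P: "prob_space P" and Q: "prob_space Q" and sets_eq: "sets P = sets X" "sets Q = sets X"
  shows "distr (iid_law P \<Otimes>\<^sub>M iid_law Q) (iid_law X) (\<lambda>(\<omega>, \<omega>'). comb_seq s \<omega> \<omega>')
    = change_law P Q (Suc s)" (is "?D = _")
proof -
  let ?M = "\<lambda>i. if i < s then P else Q"
  interpret p: prob_space P by fact
  interpret q: prob_space Q by fact
  interpret PP: product_prob_space "\<lambda>_. P" "UNIV :: nat set" by unfold_locales
  interpret QQ: product_prob_space "\<lambda>_. Q" "UNIV :: nat set" by unfold_locales
  interpret m: prob_space "?M i" for i by (cases "i < s") (auto intro: p.prob_space_axioms q.prob_space_axioms)
  interpret product_prob_space ?M "UNIV :: nat set" by unfold_locales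
  interpret IQ: prob_space "iid_law Q" using Q by (rule prob_space_iid_law)
  have space_eq: "space P = space X" "space Q = space X"
    using sets_eq by (auto dest: sets_eq_imp_space_eq)
  have spP: "space (iid_law P) = space (iid_law X)" and spQ: "space (iid_law Q) = space (iid_law X)"
    using sets_eq space_iid_law by blast+
  have sPQ: "sets (iid_law P \<Otimes>\<^sub>M iid_law Q) = sets (iid_law X \<Otimes>\<^sub>M iid_law X)"
    using sets_eq by (intro sets_pair_measure_cong sets_iid_law)
  have mcs: "(\<lambda>(\<omega>, \<omega>'). comb_seq s \<omega> \<omega>') \<in> (iid_law P \<Otimes>\<^sub>M iid_law Q) \<rightarrow>\<^sub>M iid_law X"
    unfolding measurable_cong_sets[OF sPQ refl] unfolding iid_law_def by (rule measurable_comb_seq)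
  have "?D = PiM UNIV ?M"
  proof (rule PiM_eq)
    show "sets ?D = sets (PiM UNIV ?M)"
      using sets_change_law[OF sets_eq, of "Suc s"] by (simp add: change_law_def)
    fix J E assume J: "finite J" "J \<subseteq> (UNIV :: nat set)" "\<And>j. j \<in> J \<Longrightarrow> E j \<in> sets (?M j)"
    have EX: "E j \<in> sets X" if "j \<in> J" for j using J(3)[OF that] sets_eq by (auto split: if_splits)
    let ?X = "prod_emb UNIV ?M J (\<Pi>\<^sub>E j\<in>J. E j)"
    have X_eq: "?X = prod_emb UNIV (\<lambda>_. X) J (\<Pi>\<^sub>E j\<in>J. E j)"
    proof -
      have "(\<lambda>i. space (?M i)) = (\<lambda>_. space X)" by (rule ext) (simp add: space_eq)
      then show ?thesis by (simp add: prod_emb_def)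
    qed
    have "(\<lambda>(\<omega>, \<omega>'). comb_seq s \<omega> \<omega>') -` ?X \<inter> space (iid_law P \<Otimes>\<^sub>M iid_law Q) =
      (prod_emb UNIV (\<lambda>_. P) (J \<inter> {..<s}) (\<Pi>\<^sub>E j\<in>J \<inter> {..<s}. E j)) \<times>
      (prod_emb UNIV (\<lambda>_. Q) (((+) s) -` J) (\<Pi>\<^sub>E j\<in>((+) s) -` J. E (s + j)))" (is "_ = ?E \<times> ?F")
    proof -
      have emb: "prod_emb UNIV (\<lambda>_. M) K (Pi\<^sub>E K F) = {\<omega> \<in> space (iid_law M). \<forall>j\<in>K. \<omega> j \<in> F j}"
        for M :: "'a measure" and K F
        by (auto simp: prod_emb_def iid_law_def space_PiM PiE_iff)
      have inSp: "comb_seq s \<omega> \<omega>' \<in> space (iid_law X)"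
        if "\<omega> \<in> space (iid_law X)" "\<omega>' \<in> space (iid_law X)" for \<omega> \<omega>'
        using that by (auto simp: iid_law_def space_PiM PiE_iff comb_seq_def)
      have eqv: "(\<forall>j\<in>J. comb_seq s \<omega> \<omega>' j \<in> E j) \<longleftrightarrow>
          (\<forall>j\<in>J \<inter> {..<s}. \<omega> j \<in> E j) \<and> (\<forall>j\<in>(+) s -` J. \<omega>' j \<in> E (s + j))" for \<omega> \<omega>'
      proof (intro iffI conjI ballI)
        fix j assume *: "(\<forall>j\<in>J \<inter> {..<s}. \<omega> j \<in> E j) \<and> (\<forall>j\<in>(+) s -` J. \<omega>' j \<in> E (s + j))" "j \<in> J"
        show "comb_seq s \<omega> \<omega>' j \<in> E j"
        proof (cases "j < s")
          case False
          then have "s + (j - s) = j" by simp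
          with * have "\<omega>' (j - s) \<in> E (s + (j - s))" by (metis vimageI)
          with False show ?thesis by (simp add: comb_seq_def)
        qed (use * in \<open>simp add: comb_seq_def\<close>)
      next
        fix j assume *: "\<forall>j\<in>J. comb_seq s \<omega> \<omega>' j \<in> E j" "j \<in> (+) s -` J"
        then have "comb_seq s \<omega> \<omega>' (s + j) \<in> E (s + j)" by blast
        then show "\<omega>' j \<in> E (s + j)" by (simp add: comb_seq_def)
      next
        fix j assume "\<forall>j\<in>J. comb_seq s \<omega> \<omega>' j \<in> E j" "j \<in> J \<inter> {..<s}"
        then have "comb_seq s \<omega> \<omega>' j \<in> E j" "j < s" by auto
        then show "\<omega> j \<in> E j" by (simp add: comb_seq_def)
      qed
      show ?thesis
        unfolding X_eq emb
      proof (rule set_eqI)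
        fix z :: "(nat \<Rightarrow> 'a) \<times> (nat \<Rightarrow> 'a)"
        obtain \<omega> \<omega>' where z: "z = (\<omega>, \<omega>')" by (cases z)
        show "z \<in> (\<lambda>(\<omega>, \<omega>'). comb_seq s \<omega> \<omega>') -` {\<omega> \<in> space (iid_law X). \<forall>j\<in>J. \<omega> j \<in> E j}
              \<inter> space (iid_law P \<Otimes>\<^sub>M iid_law Q) \<longleftrightarrow>
            z \<in> {\<omega> \<in> space (iid_law P). \<forall>j\<in>J \<inter> {..<s}. \<omega> j \<in> E j} \<times>
              {\<omega> \<in> space (iid_law Q). \<forall>j\<in>(+) s -` J. \<omega> j \<in> E (s + j)}"
          using inSp[of \<omega> \<omega>'] eqv[of \<omega> \<omega>'] 
          unfolding z spP spQ space_pair_measure vimage_eq Int_iff mem_Sigma_iff mem_Collect_eq case_prod_conv by blast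
      qed
    qed
    moreover have "?X \<in> sets (iid_law X)"
      unfolding X_eq iid_law_def using J EX by (intro sets_PiM_I) auto
    ultimately have "emeasure ?D ?X = emeasure (iid_law P \<Otimes>\<^sub>M iid_law Q) (?E \<times> ?F)"
      by (subst emeasure_distr[OF mcs]) auto
    also have "\<dots> = emeasure (iid_law P) ?E * emeasure (iid_law Q) ?F"
      using J EX sets_eq
      by (intro IQ.emeasure_pair_measure_Times)
         (auto simp: iid_law_def intro!: sets_PiM_I finite_vimageI simp: inj_on_def)
    also have "emeasure (iid_law Q) ?F = (\<Prod>j\<in>((+) s) -` J. emeasure Q (E (s + j)))"
      unfolding iid_law_def using J EX sets_eq
      by (intro QQ.emeasure_PiM_emb) (simp_all add: finite_vimageI inj_on_def)
    \<comment> \<open>Undo the lowering of the indices: the second factor is a product over the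
      elements of \<open>J\<close> that are at least \<open>s\<close>.\<close>
    also have "\<dots> = (\<Prod>j\<in>J - (J \<inter> {..<s}). emeasure Q (E j))"
    proof (rule prod.reindex_cong [of "\<lambda>x. x - s"])
      show "inj_on (\<lambda>x. x - s) (J - J \<inter> {..<s})" by (auto intro!: inj_onI)
      show "(+) s -` J = (\<lambda>x. x - s) ` (J - J \<inter> {..<s})"
        by (force simp: image_iff)
    qed auto
    also have "\<dots> = (\<Prod>j\<in>J - (J \<inter> {..<s}). emeasure (?M j) (E j))"
      by (intro prod.cong) auto
    also have "emeasure (iid_law P) ?E = (\<Prod>j\<in>J \<inter> {..<s}. emeasure P (E j))"
      unfolding iid_law_def using J EX sets_eq by (intro PP.emeasure_PiM_emb) simp_all
    also have "\<dots> = (\<Prod>j\<in>J \<inter> {..<s}. emeasure (?M j) (E j))"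
      by (intro prod.cong) auto
    also have "(\<Prod>j\<in>J \<inter> {..<s}. emeasure (?M j) (E j)) * (\<Prod>j\<in>J - (J \<inter> {..<s}). emeasure (?M j) (E j))
       = (\<Prod>j\<in>J. emeasure (?M j) (E j))"
      by (subst mult.commute, rule prod.subset_diff[symmetric]) (use J in auto)
    finally show "emeasure ?D ?X = (\<Prod>j\<in>J. emeasure (?M j) (E j))" .
  qed
  then show ?thesis by (simp add: change_law_def)
qed


section \<open>The observation filtration\<close>

lemma space_obs_filtration [simp]: "space (obs_filtration X t) = space (iid_law X)"
  by (simp add: obs_filtration_def)

lemma restrict_in_space_power_law:
  "\<omega> \<in> space (iid_law X) \<Longrightarrow> restrict \<omega> {..<t} \<in> space (power_law X t)"
  by (auto simp: iid_law_def power_law_def space_PiM PiE_iff)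

lemma measurable_restrict_obs: "(\<lambda>x. restrict x {..<t}) \<in> obs_filtration X t \<rightarrow>\<^sub>M power_law X t"
  unfolding obs_filtration_def
  by (rule measurable_vimage_algebra1) (auto intro: restrict_in_space_power_law)

lemma measurable_obsI:
  assumes "f \<in> space N \<rightarrow> space (iid_law X)" and "(\<lambda>x. restrict (f x) {..<t}) \<in> N \<rightarrow>\<^sub>M power_law X t"
  shows "f \<in> N \<rightarrow>\<^sub>M obs_filtration X t"
  unfolding obs_filtration_def using assms by (intro measurable_vimage_algebra2) auto

lemma obs_setE:
  assumes "A \<in> sets (obs_filtration X t)"
  obtains B where "B \<in> sets (power_law X t)" "A = {\<omega>\<in>space (iid_law X). restrict \<omega> {..<t} \<in> B}"
proof -
  have "A \<in> {(\<lambda>x. restrict x {..<t}) -` B \<inter> space (iid_law X) |B. B \<in> sets (power_law X t)}"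
    using assms unfolding obs_filtration_def
    by (subst (asm) sets_vimage_algebra2) (auto intro: restrict_in_space_power_law)
  then show ?thesis using that by blast
qed

text \<open>Events observed by time \<open>t\<close> cannot tell apart sequences with the same first
  \<open>t\<close> coordinates. This is how past events ignore whatever is spliced in after
  them.\<close>

lemma obs_set_cong:
  assumes "A \<in> sets (obs_filtration X t)" "\<omega> \<in> space (iid_law X)" "\<omega>' \<in> space (iid_law X)"
    and "restrict \<omega> {..<t} = restrict \<omega>' {..<t}"
  shows "\<omega> \<in> A \<longleftrightarrow> \<omega>' \<in> A"
  using assms(1) by (rule obs_setE) (use assms in auto)

text \<open>Stating the inclusion of \<sigma>-algebras as measurability of the identity reduces it
  to measurability of a restriction map.\<close>

lemma id_measurable_obs: "id \<in> iid_law X \<rightarrow>\<^sub>M obs_filtration X t"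
proof (rule measurable_obsI)
  show "(\<lambda>x. restrict (id x) {..<t}) \<in> iid_law X \<rightarrow>\<^sub>M power_law X t"
    unfolding iid_law_def power_law_def by simp
qed auto

lemma obs_sets_subset: "sets (obs_filtration X t) \<subseteq> sets (iid_law X)"
proof
  fix A assume A: "A \<in> sets (obs_filtration X t)"
  then have "A \<subseteq> space (iid_law X)" using sets.sets_into_space by force
  then show "A \<in> sets (iid_law X)"
    using measurable_sets[OF id_measurable_obs A] by (simp add: Int_absorb2)
qed

text \<open>A test restarted after \<open>s\<close> observations and run on the next
  \<open>t\<close> of them is decided by time \<open>s + t\<close>; adaptedness of the detector
  rests on this.\<close>

lemma measurable_shift_obs: "seq_shift s \<in> obs_filtration X (s + t) \<rightarrow>\<^sub>M obs_filtration X t"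
proof (rule measurable_obsI)
  show "seq_shift s \<in> space (obs_filtration X (s + t)) \<rightarrow> space (iid_law X)"
    by (auto simp: seq_shift_def iid_law_def space_PiM PiE_iff)
  have "(\<lambda>x. \<lambda>i\<in>{..<t}. x (s + i)) \<in> power_law X (s + t) \<rightarrow>\<^sub>M power_law X t"
    unfolding power_law_def by (intro measurable_restrict measurable_component_singleton) auto
  from measurable_compose[OF measurable_restrict_obs this]
  show "(\<lambda>x. restrict (seq_shift s x) {..<t}) \<in> obs_filtration X (s + t) \<rightarrow>\<^sub>M power_law X t"
    by (rule back_subst[where P="\<lambda>f. f \<in> _"])
       (auto simp: seq_shift_def restrict_def fun_eq_iff)
qed

lemma obs_filtration_mono:
  assumes "s \<le> t" shows "sets (obs_filtration X s) \<subseteq> sets (obs_filtration X t)"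
proof -
  have "id \<in> obs_filtration X t \<rightarrow>\<^sub>M obs_filtration X s"
  proof (rule measurable_obsI)
    have "(\<lambda>x. \<lambda>i\<in>{..<s}. x i) \<in> power_law X t \<rightarrow>\<^sub>M power_law X s"
      unfolding power_law_def using assms by (intro measurable_restrict measurable_component_singleton) auto
    from measurable_compose[OF measurable_restrict_obs this]
    show "(\<lambda>x. restrict (id x) {..<s}) \<in> obs_filtration X t \<rightarrow>\<^sub>M power_law X s"
      by (rule back_subst[where P="\<lambda>f. f \<in> _"]) (use assms in \<open>auto simp: restrict_def fun_eq_iff\<close>)
  qed auto
  note id = this
  show ?thesis
  proof
    fix A assume A: "A \<in> sets (obs_filtration X s)"
    then have "A \<subseteq> space (iid_law X)" using sets.sets_into_space by force
    then show "A \<in> sets (obs_filtration X t)"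
      using measurable_sets[OF id A] by (simp add: Int_absorb2)
  qed
qed

text \<open>In the splicing representation \<open>A\<close> depends on the first factor only and
  \<open>f \<circ> seq_shift s\<close> on the second only, so Tonelli's theorem factors the
  integral. The case \<open>P = Q\<close> serves the e-detector property, the general case the
  delay.\<close>

lemma nn_integral_past_future:
  assumes P: "prob_space P" and Q: "prob_space Q" and sets_eq: "sets P = sets X" "sets Q = sets X"
    and A: "A \<in> sets (obs_filtration X s)" and f: "f \<in> borel_measurable (iid_law X)"
  shows "(\<integral>\<^sup>+\<omega>. indicator A \<omega> * f (seq_shift s \<omega>) \<partial>change_law P Q (Suc s))
    = emeasure (change_law P Q (Suc s)) A * (\<integral>\<^sup>+\<omega>. f \<omega> \<partial>iid_law Q)"
proof -
  interpret IP: prob_space "iid_law P" using P by (rule prob_space_iid_law)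
  interpret IQ: prob_space "iid_law Q" using Q by (rule prob_space_iid_law)
  have sP: "sets (iid_law P) = sets (iid_law X)" and sQ: "sets (iid_law Q) = sets (iid_law X)"
    using sets_iid_law sets_eq by blast+
  have sPQ: "sets (iid_law P \<Otimes>\<^sub>M iid_law Q) = sets (iid_law X \<Otimes>\<^sub>M iid_law X)"
    using sP sQ by (intro sets_pair_measure_cong)
  have spP: "space (iid_law P) = space (iid_law X)" and spQ: "space (iid_law Q) = space (iid_law X)"
    using sP sQ by (auto dest: sets_eq_imp_space_eq)
  have mcs: "(\<lambda>(\<omega>, \<omega>'). comb_seq s \<omega> \<omega>') \<in> (iid_law P \<Otimes>\<^sub>M iid_law Q) \<rightarrow>\<^sub>M iid_law X"
    unfolding measurable_cong_sets[OF sPQ refl] unfolding iid_law_def by (rule measurable_comb_seq)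
  have AX: "A \<in> sets (iid_law X)" using A obs_sets_subset by blast
  have main: "(\<integral>\<^sup>+\<omega>. indicator A \<omega> * g (seq_shift s \<omega>) \<partial>change_law P Q (Suc s))
    = emeasure (iid_law P) A * (\<integral>\<^sup>+\<omega>. g \<omega> \<partial>iid_law Q)"
    if g: "g \<in> borel_measurable (iid_law X)" for g
  proof -
    have gsh: "(\<lambda>x. g (seq_shift s x)) \<in> borel_measurable (iid_law X)"
      by (rule measurable_compose[OF measurable_seq_shift g])
    have gQ: "g \<in> borel_measurable (iid_law Q)" using g by (simp add: measurable_cong_sets[OF sQ refl])
    have "(\<integral>\<^sup>+\<omega>. indicator A \<omega> * g (seq_shift s \<omega>) \<partial>change_law P Q (Suc s))
      = (\<integral>\<^sup>+z. (case z of (\<omega>, \<omega>') \<Rightarrow> indicator A (comb_seq s \<omega> \<omega>') * g \<omega>') \<partial>(iid_law P \<Otimes>\<^sub>M iid_law Q))"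
      unfolding distr_comb_seq[OF P Q sets_eq, symmetric]
      using AX gsh mcs by (subst nn_integral_distr) (auto simp: split_beta' intro!: nn_integral_cong)
    also have "\<dots> = (\<integral>\<^sup>+z. indicator A (fst z) * g (snd z) \<partial>(iid_law P \<Otimes>\<^sub>M iid_law Q))"
    proof (intro nn_integral_cong)
      fix z assume "z \<in> space (iid_law P \<Otimes>\<^sub>M iid_law Q)"
      then obtain \<omega> \<omega>' where z: "z = (\<omega>, \<omega>')" "\<omega> \<in> space (iid_law X)" "\<omega>' \<in> space (iid_law X)"
        by (auto simp: space_pair_measure spP spQ)
      then have "comb_seq s \<omega> \<omega>' \<in> space (iid_law X)"
        by (auto simp: iid_law_def space_PiM PiE_iff comb_seq_def)
      with z have "comb_seq s \<omega> \<omega>' \<in> A \<longleftrightarrow> \<omega> \<in> A"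
        by (intro obs_set_cong[OF A]) (auto simp: restrict_comb_seq)
      with z show "(case z of (\<omega>, \<omega>') \<Rightarrow> indicator A (comb_seq s \<omega> \<omega>') * g \<omega>')
          = indicator A (fst z) * g (snd z)"
        by (auto simp: indicator_def)
    qed
    also have "\<dots> = (\<integral>\<^sup>+\<omega>. \<integral>\<^sup>+\<omega>'. indicator A \<omega> * g \<omega>' \<partial>iid_law Q \<partial>iid_law P)"
      using AX gQ sP by (subst IQ.nn_integral_fst[symmetric]) (auto intro!: borel_measurable_times_ennreal measurable_compose[OF measurable_fst] measurable_compose[OF measurable_snd])
    also have "\<dots> = (\<integral>\<^sup>+\<omega>. indicator A \<omega> * (\<integral>\<^sup>+\<omega>'. g \<omega>' \<partial>iid_law Q) \<partial>iid_law P)"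
      using gQ by (simp add: nn_integral_cmult)
    also have "\<dots> = emeasure (iid_law P) A * (\<integral>\<^sup>+\<omega>. g \<omega> \<partial>iid_law Q)"
      using AX sP by (subst nn_integral_multc) auto
    finally show ?thesis .
  qed
  \<comment> \<open>The constant function 1 shows that \<open>A\<close> has the same probability
    under \<open>iid_law P\<close> and under the change law.\<close>
  have "A \<in> sets (change_law P Q (Suc s))" using AX sets_change_law[OF sets_eq] by simp
  with main[of "\<lambda>_. 1"] have "emeasure (change_law P Q (Suc s)) A = emeasure (iid_law P) A"
    by (simp add: IQ.emeasure_space_1)
  with main[OF f] show ?thesis by simp
qed

section \<open>Stopping times, threshold times and conditional expectations\<close>

lemma sets_pair_mono:
  assumes "space A = space A'" "space B = space B'" "sets A \<subseteq> sets A'" "sets B \<subseteq> sets B'"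
  shows "sets (A \<Otimes>\<^sub>M B) \<subseteq> sets (A' \<Otimes>\<^sub>M B')"
  unfolding sets_pair_measure assms(1,2) using assms(3,4) by (intro sigma_sets_mono') blast

lemma aux_randomizationD:
  assumes "aux_randomization U G"
  shows "prob_space U" "space (G t) = space U" "sets (G t) \<subseteq> sets U" "s \<le> t \<Longrightarrow> sets (G s) \<subseteq> sets (G t)"
  using assms unfolding aux_randomization_def subalgebra_def filtration_def by auto

lemma space_full_filtration:
  "aux_randomization U G \<Longrightarrow> space (full_filtration X G t) = space (iid_law X) \<times> space U"
  by (simp add: full_filtration_def space_pair_measure aux_randomizationD)

lemma full_filtration_mono:
  "aux_randomization U G \<Longrightarrow> s \<le> t \<Longrightarrow> sets (full_filtration X G s) \<subseteq> sets (full_filtration X G t)"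
  unfolding full_filtration_def
  by (intro sets_pair_mono obs_filtration_mono aux_randomizationD(4)) (auto simp: aux_randomizationD(2))

lemma subalgebra_full_filtration:
  assumes "aux_randomization U G" and "sets M = sets (iid_law X)"
  shows "subalgebra (M \<Otimes>\<^sub>M U) (full_filtration X G t)"
proof -
  have sM: "space M = space (iid_law X)" using assms(2) by (rule sets_eq_imp_space_eq)
  show ?thesis
    unfolding subalgebra_def full_filtration_def
  proof
    show "sets (obs_filtration X t \<Otimes>\<^sub>M G t) \<subseteq> sets (M \<Otimes>\<^sub>M U)"
      using assms sM by (intro sets_pair_mono) (auto simp: aux_randomizationD obs_sets_subset)
  qed (use assms sM in \<open>auto simp: space_pair_measure aux_randomizationD\<close>)
qed

section \<open>Extended stopping times\<close>

lemma ext_stopping_timeD: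
  assumes "aux_randomization U G" and "ext_stopping_time (full_filtration X G) T" and "s \<le> t"
  shows "{\<omega> \<in> space (iid_law X) \<times> space U. T \<omega> \<le> enat s} \<in> sets (full_filtration X G t)"
proof -
  have "{\<omega> \<in> space (full_filtration X G s). T \<omega> \<le> enat s} \<in> sets (full_filtration X G s)"
    using assms(2) unfolding ext_stopping_time_def by (auto simp: pred_def)
  then show ?thesis
    using full_filtration_mono[OF assms(1) assms(3), of X] by (auto simp: space_full_filtration[OF assms(1)])
qed

text \<open>The type \<open>enat\<close> is countable, so level sets suffice; that of \<infinity> is
  the complement of all the finite ones.\<close>

lemma measurable_enatI:
  fixes T :: "'w \<Rightarrow> enat"
  assumes "\<And>t::nat. {\<omega> \<in> space M. T \<omega> \<le> enat t} \<in> sets M"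
  shows "T \<in> M \<rightarrow>\<^sub>M count_space UNIV"
proof -
  have eq: "{\<omega> \<in> space M. T \<omega> = enat t} \<in> sets M" for t
  proof (cases t)
    case 0
    then have "{\<omega> \<in> space M. T \<omega> = enat t} = {\<omega> \<in> space M. T \<omega> \<le> enat 0}"
      by (auto simp: enat_0)
    then show ?thesis using assms by simp
  next
    case (Suc n)
    have "T \<omega> = enat t \<longleftrightarrow> T \<omega> \<le> enat t \<and> \<not> T \<omega> \<le> enat n" for \<omega>
      using Suc by (cases "T \<omega>") auto
    then have "{\<omega> \<in> space M. T \<omega> = enat t} = {\<omega> \<in> space M. T \<omega> \<le> enat t} - {\<omega> \<in> space M. T \<omega> \<le> enat n}"
      by auto
    then show ?thesis using assms by auto
  qed
  show "T \<in> M \<rightarrow>\<^sub>M count_space UNIV"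
  proof (subst measurable_count_space_eq2_countable, safe)
    fix a :: enat
    show "T -` {a} \<inter> space M \<in> sets M"
    proof (cases a)
      case (enat t)
      then have "T -` {a} \<inter> space M = {\<omega> \<in> space M. T \<omega> = enat t}" by auto
      then show ?thesis using eq by simp
    next
      case infinity
      then have "T -` {a} \<inter> space M = space M - (\<Union>t. {\<omega> \<in> space M. T \<omega> = enat t})"
        by (auto simp: not_infinity_eq)
      then show ?thesis using eq by auto
    qed
  qed auto
qed

lemma measurable_ext_stopping_time:
  assumes "aux_randomization U G" and "ext_stopping_time (full_filtration X G) T"
    and "sets M = sets (iid_law X)"
  shows "T \<in> (M \<Otimes>\<^sub>M U) \<rightarrow>\<^sub>M count_space UNIV"
proof (rule measurable_enatI)
  fix t :: nat
  have "space (M \<Otimes>\<^sub>M U) = space (iid_law X) \<times> space U"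
    using sets_eq_imp_space_eq[OF assms(3)] by (simp add: space_pair_measure)
  then show "{\<omega> \<in> space (M \<Otimes>\<^sub>M U). T \<omega> \<le> enat t} \<in> sets (M \<Otimes>\<^sub>M U)"
    using ext_stopping_timeD[OF assms(1,2) order_refl, of t] subalgebra_full_filtration[OF assms(1,3), of t]
    by (auto simp: subalgebra_def)
qed

lemma ext_stopping_time_min:
  assumes "ext_stopping_time F S" "ext_stopping_time F T"
  shows "ext_stopping_time F (\<lambda>\<omega>. min (S \<omega>) (T \<omega>))"
  using assms unfolding ext_stopping_time_def
  by (auto simp: min_le_iff_disj intro!: pred_intros_logic)

section \<open>First passage times and their validity\<close>

lemma Inf_enat_le_iff:
  fixes A :: "enat set"
  shows "Inf A \<le> enat t \<longleftrightarrow> (\<exists>a\<in>A. a \<le> enat t)"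
proof
  assume le: "Inf A \<le> enat t"
  then have "A \<noteq> {}" by (auto simp: Inf_enat_def)
  \<comment> \<open>By well-ordering a nonempty infimum is attained, so first passage by time t is a
    finite union of events.\<close>
  then have "Inf A \<in> A" unfolding Inf_enat_def by (auto intro: LeastI)
  with le show "\<exists>a\<in>A. a \<le> enat t" by blast
qed (auto intro: Inf_lower2)

lemma threshold_time_le_iff:
  "threshold_time D \<gamma> \<omega> \<le> enat t \<longleftrightarrow> (\<exists>k. 1 \<le> k \<and> k \<le> t \<and> ennreal \<gamma> \<le> D k \<omega>)"
  unfolding threshold_time_def Inf_enat_le_iff by auto

lemma threshold_time_attained:
  assumes "threshold_time D \<gamma> \<omega> = enat t"
  shows "ennreal \<gamma> \<le> D t \<omega>"
proof -
  obtain k where k: "1 \<le> k" "k \<le> t" "ennreal \<gamma> \<le> D k \<omega>"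
    using assms threshold_time_le_iff[of D \<gamma> \<omega> t] by auto
  then have "threshold_time D \<gamma> \<omega> \<le> enat k"
    using threshold_time_le_iff[of D \<gamma> \<omega> k] by auto
  with assms k show ?thesis by simp
qed

lemma alarm_time_threshold:
  assumes aux: "aux_randomization U G" and D: "\<And>t. D t \<in> borel_measurable (full_filtration X G t)"
  shows "alarm_time (full_filtration X G) (threshold_time D \<gamma>)"
  unfolding alarm_time_def ext_stopping_time_def
proof (intro conjI allI ballI)
  fix t
  have "{\<omega> \<in> space (full_filtration X G t). threshold_time D \<gamma> \<omega> \<le> enat t}
      = (\<Union>k\<in>{1..t}. {\<omega> \<in> space (full_filtration X G t). ennreal \<gamma> \<le> D k \<omega>})"
    by (auto simp: threshold_time_le_iff)
  also have "\<dots> \<in> sets (full_filtration X G t)"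
  proof (intro sets.finite_UN)
    fix k assume k: "k \<in> {1..t}"
    have "{\<omega> \<in> space (full_filtration X G k). ennreal \<gamma> \<le> D k \<omega>} \<in> sets (full_filtration X G k)"
      using D[of k] by measurable
    then show "{\<omega> \<in> space (full_filtration X G t). ennreal \<gamma> \<le> D k \<omega>} \<in> sets (full_filtration X G t)"
      using full_filtration_mono[OF aux, of k t X] k by (auto simp: space_full_filtration[OF aux])
  qed auto
  finally show "Measurable.pred (full_filtration X G t) (\<lambda>\<omega>. threshold_time D \<gamma> \<omega> \<le> enat t)"
    by (simp add: pred_def)
next
  fix \<omega>
  show "1 \<le> threshold_time D \<gamma> \<omega>"
    unfolding threshold_time_def by (auto intro!: Inf_greatest simp: one_enat_def)
qed

text \<open>Markov's inequality at the minimum of the alarm time and \<sigma>: where the alarm comes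
  first, the detector has reached \<gamma> at this minimum, and its mean there is at most the mean
  of the minimum, hence of \<sigma>.\<close>

lemma e_detector_threshold_ARL_valid:
  assumes aux: "aux_randomization U G" and D: "e_detector X U G PP D" and \<gamma>: "1 \<le> \<gamma>"
    and PP: "\<And>P. P \<in> PP \<Longrightarrow> sets P = sets X"
  shows "optionally_ARL_valid X U G PP \<gamma> (threshold_time D \<gamma>)"
  unfolding optionally_ARL_valid_def
proof (intro conjI ballI allI impI)
  let ?T = "threshold_time D \<gamma>"
  have "D t \<in> borel_measurable (full_filtration X G t)" for t
    using D by (simp add: e_detector_def)
  then show alarm: "alarm_time (full_filtration X G) ?T"
    by (rule alarm_time_threshold[OF aux])
  fix P \<sigma> assume P: "P \<in> PP" and \<sigma>: "ext_stopping_time (full_filtration X G) \<sigma>"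
  let ?M = "iid_law P \<Otimes>\<^sub>M U"
  let ?A = "{\<omega> \<in> space ?M. ?T \<omega> < \<infinity> \<and> ?T \<omega> \<le> \<sigma> \<omega>}"
  have T: "ext_stopping_time (full_filtration X G) ?T"
    using alarm by (simp add: alarm_time_def)
  have sP: "sets (iid_law P) = sets (iid_law X)" using PP[OF P] by (rule sets_iid_law)
  note mT [measurable] = measurable_ext_stopping_time[OF aux T sP]
  note m\<sigma> [measurable] = measurable_ext_stopping_time[OF aux \<sigma> sP]
  have "?A = (\<Union>t. (?T -` {enat t} \<inter> space ?M) \<inter> (\<sigma> -` {enat t..} \<inter> space ?M))"
    by auto
  also have "\<dots> \<in> sets ?M"
    by (intro sets.countable_UN sets.Int measurable_sets[OF mT] measurable_sets[OF m\<sigma>] image_subsetI) auto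
  finally have A: "?A \<in> sets ?M" .
  let ?S = "\<lambda>\<omega>. min (?T \<omega>) (\<sigma> \<omega>)"
  have S: "ext_stopping_time (full_filtration X G) ?S"
    by (rule ext_stopping_time_min[OF T \<sigma>])
  have "ennreal \<gamma> * emeasure ?M ?A = (\<integral>\<^sup>+\<omega>. ennreal \<gamma> * indicator ?A \<omega> \<partial>?M)"
    using A by (simp add: nn_integral_cmult_indicator)
  also have "\<dots> \<le> (\<integral>\<^sup>+\<omega>. stopped_value D ?S \<omega> \<partial>?M)"
  proof (rule nn_integral_mono)
    fix \<omega>
    show "ennreal \<gamma> * indicator ?A \<omega> \<le> stopped_value D ?S \<omega>"
    proof (cases "\<omega> \<in> ?A")
      case True
      then obtain t where t: "?T \<omega> = enat t" by auto
      with True have "?S \<omega> = enat t" by (auto simp: min_def)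
      with t threshold_time_attained[OF t] show ?thesis by (simp add: stopped_value_def indicator_def)
    qed auto
  qed
  also have "\<dots> \<le> mean_time ?M ?S"
    using D P S by (simp add: e_detector_def)
  also have "\<dots> \<le> mean_time ?M \<sigma>"
    unfolding mean_time_def by (intro nn_integral_mono) simp
  finally have *: "ennreal \<gamma> * emeasure ?M ?A \<le> mean_time ?M \<sigma>" .
  have "emeasure ?M ?A = ennreal \<gamma> * emeasure ?M ?A / ennreal \<gamma>"
    using \<gamma> by (subst mult.commute) (simp add: ennreal_mult_divide_eq)
  also have "\<dots> \<le> mean_time ?M \<sigma> / ennreal \<gamma>"
    using * by (rule divide_right_mono_ennreal)
  finally show "emeasure ?M ?A \<le> mean_time ?M \<sigma> / ennreal \<gamma>" .
qed

text \<open>For a frozen auxiliary value the section of \<open>A\<close> is an event of the observed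
  past; Tonelli's theorem integrates \<open>nn_integral_past_future\<close> over that value.\<close>

lemma nn_integral_past_future_aux:
  assumes aux: "aux_randomization U G"
    and P: "prob_space P" and Q: "prob_space Q" and sets_eq: "sets P = sets X" "sets Q = sets X"
    and A: "A \<in> sets (full_filtration X G s)" and f: "f \<in> borel_measurable (iid_law X)"
  shows "(\<integral>\<^sup>+\<omega>. indicator A \<omega> * f (seq_shift s (fst \<omega>)) \<partial>(change_law P Q (Suc s) \<Otimes>\<^sub>M U))
    = emeasure (change_law P Q (Suc s) \<Otimes>\<^sub>M U) A * (\<integral>\<^sup>+\<omega>. f \<omega> \<partial>iid_law Q)"
proof -
  let ?C = "change_law P Q (Suc s)"
  interpret C: prob_space ?C using P Q by (rule prob_space_change_law)
  interpret U: prob_space U using aux by (rule aux_randomizationD)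
  interpret CU: pair_sigma_finite ?C U ..
  have sC: "sets ?C = sets (iid_law X)" using sets_eq by (rule sets_change_law)
  have AC: "A \<in> sets (?C \<Otimes>\<^sub>M U)"
    using A subalgebra_full_filtration[OF aux sC] by (auto simp: subalgebra_def)
  have fC: "(\<lambda>x. f (seq_shift s x)) \<in> borel_measurable ?C"
    unfolding measurable_cong_sets[OF sC refl] by (rule measurable_compose[OF measurable_seq_shift f])
  have sec: "(\<lambda>x. (x, u)) -` A \<in> sets (obs_filtration X s)" for u
    using A unfolding full_filtration_def by (rule sets_Pair2)
  have "(\<integral>\<^sup>+\<omega>. indicator A \<omega> * f (seq_shift s (fst \<omega>)) \<partial>(?C \<Otimes>\<^sub>M U))
      = (\<integral>\<^sup>+u. \<integral>\<^sup>+x. indicator A (x, u) * f (seq_shift s x) \<partial>?C \<partial>U)"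
    using AC fC by (subst CU.nn_integral_snd[symmetric])
       (auto intro!: borel_measurable_times_ennreal measurable_compose[OF measurable_fst])
  also have "\<dots> = (\<integral>\<^sup>+u. emeasure ?C ((\<lambda>x. (x, u)) -` A) * (\<integral>\<^sup>+\<omega>. f \<omega> \<partial>iid_law Q) \<partial>U)"
  proof (rule nn_integral_cong)
    fix u
    have "(\<integral>\<^sup>+x. indicator A (x, u) * f (seq_shift s x) \<partial>?C)
        = (\<integral>\<^sup>+x. indicator ((\<lambda>x. (x, u)) -` A) x * f (seq_shift s x) \<partial>?C)"
      by (intro nn_integral_cong) (auto simp: indicator_def)
    then show "(\<integral>\<^sup>+x. indicator A (x, u) * f (seq_shift s x) \<partial>?C)
        = emeasure ?C ((\<lambda>x. (x, u)) -` A) * (\<integral>\<^sup>+\<omega>. f \<omega> \<partial>iid_law Q)"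
      using nn_integral_past_future[OF P Q sets_eq sec f] by simp
  qed
  also have "\<dots> = (\<integral>\<^sup>+u. emeasure ?C ((\<lambda>x. (x, u)) -` A) \<partial>U) * (\<integral>\<^sup>+\<omega>. f \<omega> \<partial>iid_law Q)"
    using AC by (intro nn_integral_multc CU.measurable_emeasure_Pair2)
  also have "(\<integral>\<^sup>+u. emeasure ?C ((\<lambda>x. (x, u)) -` A) \<partial>U) = emeasure (?C \<Otimes>\<^sub>M U) A"
    using AC by (rule CU.emeasure_pair_measure_alt2[symmetric])
  finally show ?thesis .
qed

text \<open>The event where the conditional expectation exceeds \<open>c\<close> lies in
  \<open>F\<close>, so the hypothesis applies to it and forces the integral of the excess to
  vanish.\<close>

lemma esssup_nn_cond_exp_le:
  assumes "prob_space M" and sub: "subalgebra M F" and f: "f \<in> borel_measurable M" and "c < \<infinity>"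
    and le: "\<And>A. A \<in> sets F \<Longrightarrow> (\<integral>\<^sup>+x. indicator A x * f x \<partial>M) \<le> c * emeasure M A"
  shows "esssup M (nn_cond_exp M F f) \<le> c"
proof (rule esssup_I)
  interpret prob_space M by fact
  interpret finite_measure_subalgebra M F by unfold_locales (rule sub)
  let ?g = "nn_cond_exp M F f"
  let ?A = "{x \<in> space F. c < ?g x}"
  show "?g \<in> borel_measurable M" by simp
  have spF: "space F = space M" using sub by (simp add: subalgebra_def)
  have AF: "?A \<in> sets F" by measurable
  then have AM [measurable]: "?A \<in> sets M" using sub by (auto simp: subalgebra_def)
  \<comment> \<open>The truncated difference is exact on \<open>?A\<close>. Finiteness of
    \<open>c\<close> then allows \<open>c * emeasure M ?A\<close> to be cancelled on both
    sides.\<close>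
  have "(\<integral>\<^sup>+x. indicator ?A x * (?g x - c) \<partial>M) + c * emeasure M ?A
      = (\<integral>\<^sup>+x. indicator ?A x * (?g x - c) + c * indicator ?A x \<partial>M)"
    by (subst nn_integral_add) (auto simp: nn_integral_cmult_indicator)
  also have "\<dots> = (\<integral>\<^sup>+x. indicator ?A x * ?g x \<partial>M)"
    by (intro nn_integral_cong) (auto simp: indicator_def intro!: diff_add_cancel_ennreal)
  also have "\<dots> = (\<integral>\<^sup>+x. indicator ?A x * f x \<partial>M)"
    using AF f by (intro nn_cond_exp_intg) auto
  also have "\<dots> \<le> 0 + c * emeasure M ?A" using le[OF AF] by simp
  finally have "c * emeasure M ?A + (\<integral>\<^sup>+x. indicator ?A x * (?g x - c) \<partial>M) \<le> c * emeasure M ?A + 0"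
    by (simp add: add.commute)
  moreover have "c * emeasure M ?A \<noteq> \<infinity>"
    using \<open>c < \<infinity>\<close> emeasure_finite[of ?A] by (auto simp: ennreal_mult_eq_top_iff)
  ultimately have "(\<integral>\<^sup>+x. indicator ?A x * (?g x - c) \<partial>M) = 0"
    unfolding ennreal_add_left_cancel_le by simp
  then have "AE x in M. indicator ?A x * (?g x - c) = 0"
    by (subst (asm) nn_integral_0_iff_AE) auto
  with AE_space show "AE x in M. ?g x \<le> c"
  proof eventually_elim
    case (elim x)
    then show ?case by (cases "c < ?g x") (auto simp: spF dest: ennreal_minus_eq_0)
  qed
qed

section \<open>The restarted detector\<close>

lemma level_testD:
  assumes "level_test X PP \<alpha> \<tau>" and "P \<in> PP" and "\<And>P. P \<in> PP \<Longrightarrow> prob_space P"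
  shows "measure (iid_law P) {\<omega>\<in>space (iid_law P). \<tau> \<omega> < \<infinity>} \<le> \<alpha>"
proof -
  have "bdd_above ((\<lambda>P. measure (iid_law P) {\<omega>\<in>space (iid_law P). \<tau> \<omega> < \<infinity>}) ` PP)"
    using assms(3) by (intro bdd_aboveI2[where M=1] prob_space.prob_le_1 prob_space_iid_law)
  from cSUP_upper[OF assms(2) this] show ?thesis
    using assms(1) unfolding level_test_def by linarith
qed

lemma measurable_obs_stopping_time:
  assumes "ext_stopping_time (obs_filtration X) \<tau>" and "sets M = sets (iid_law X)"
  shows "\<tau> \<in> M \<rightarrow>\<^sub>M count_space UNIV"
proof (rule measurable_enatI)
  fix t
  have "{\<omega> \<in> space (obs_filtration X t). \<tau> \<omega> \<le> enat t} \<in> sets (obs_filtration X t)"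
    using assms(1) unfolding ext_stopping_time_def by (auto simp: pred_def)
  then show "{\<omega> \<in> space M. \<tau> \<omega> \<le> enat t} \<in> sets M"
    using obs_sets_subset assms(2) sets_eq_imp_space_eq[OF assms(2)] by auto
qed

text \<open>
  Only rejections are paid, hence the clause \<open>\<tau> m \<omega> < \<infinity>\<close>: with \<open>k = \<infinity>\<close> this is the total payment of one
  restart, and the reward is nondecreasing in \<open>k\<close>, so that stopping early cannot gain anything.
\<close>

definition restarted_reward :: "(nat \<Rightarrow> (nat \<Rightarrow> 'a) \<Rightarrow> enat) \<Rightarrow> enat \<Rightarrow> (nat \<Rightarrow> 'a) \<Rightarrow> ennreal" where
  "restarted_reward \<tau> k \<omega> = (\<Sum>m. 2 ^ Suc m * (if \<tau> m \<omega> < \<infinity> \<and> \<tau> m \<omega> \<le> k then 1 else 0))"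

text \<open>At time \<open>t\<close> the test restarted after \<open>s\<close> observations has seen
  \<open>t - s\<close> of them. Only restarts with \<open>s < t\<close> count, so the value at time
  0 is 0 and every restart that counts has seen an observation.\<close>

definition restarted_detector ::
  "real \<Rightarrow> (nat \<Rightarrow> (nat \<Rightarrow> 'a) \<Rightarrow> enat) \<Rightarrow> nat \<Rightarrow> (nat \<Rightarrow> 'a) \<times> 'u \<Rightarrow> ennreal" where
  "restarted_detector \<eta> \<tau> t z =
     (\<Sum>s<t. ennreal (1 / (1 + \<eta>)) + ennreal (\<eta> / (1 + \<eta>)) * restarted_reward \<tau> (enat (t - s)) (seq_shift s (fst z)))"

lemma restarted_reward_mono: "k \<le> l \<Longrightarrow> restarted_reward \<tau> k \<omega> \<le> restarted_reward \<tau> l \<omega>"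
  unfolding restarted_reward_def by (intro suminf_le summableI mult_left_mono) auto

lemma restarted_reward_ge:
  assumes "\<tau> m \<omega> < \<infinity>" "\<tau> m \<omega> \<le> k"
  shows "2 ^ Suc m \<le> restarted_reward \<tau> k \<omega>"
proof -
  let ?f = "\<lambda>m. 2 ^ Suc m * (if \<tau> m \<omega> < \<infinity> \<and> \<tau> m \<omega> \<le> k then 1 else 0) :: ennreal"
  have "sum ?f {m} \<le> suminf ?f" by (intro sum_le_suminf summableI) auto
  then show ?thesis using assms by (simp add: restarted_reward_def)
qed

section \<open>Payment of a single restart\<close>

lemma measurable_restarted_reward_obs:
  assumes "\<And>m. ext_stopping_time (obs_filtration X) (\<tau> m)"
  shows "restarted_reward \<tau> (enat k) \<in> borel_measurable (obs_filtration X k)"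
proof -
  have "Measurable.pred (obs_filtration X k) (\<lambda>\<omega>. \<tau> m \<omega> \<le> enat k)" for m
    using assms[of m] unfolding ext_stopping_time_def by blast
  moreover have "(\<tau> m \<omega> < \<infinity> \<and> \<tau> m \<omega> \<le> enat k) = (\<tau> m \<omega> \<le> enat k)" for m \<omega>
    by (cases "\<tau> m \<omega>") auto
  ultimately show ?thesis
    unfolding restarted_reward_def [abs_def] by simp
qed

lemma measurable_restarted_reward:
  assumes "\<And>m. ext_stopping_time (obs_filtration X) (\<tau> m)"
  shows "restarted_reward \<tau> \<infinity> \<in> borel_measurable (iid_law X)"
proof -
  have [measurable]: "\<tau> m \<in> iid_law X \<rightarrow>\<^sub>M count_space UNIV" for m
    using assms by (intro measurable_obs_stopping_time) auto
  show ?thesis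
    unfolding restarted_reward_def [abs_def] by simp
qed

text \<open>Test \<open>m\<close> pays 2 ^ (m + 1) with probability at most 4 ^ -(m + 1), a mean of
  at most 2 ^ -(m + 1); these bounds sum to 1.\<close>

lemma nn_integral_restarted_reward_le:
  assumes st: "\<And>m. ext_stopping_time (obs_filtration X) (\<tau> m)"
    and R: "prob_space R" "sets R = sets X"
    and lev: "\<And>m. measure (iid_law R) {\<omega>\<in>space (iid_law R). \<tau> m \<omega> < \<infinity>} \<le> (1/4) ^ Suc m"
  shows "(\<integral>\<^sup>+\<omega>. restarted_reward \<tau> \<infinity> \<omega> \<partial>iid_law R) \<le> 1"
proof -
  interpret prob_space "iid_law R" using R(1) by (rule prob_space_iid_law)
  have \<tau> [measurable]: "\<tau> m \<in> iid_law R \<rightarrow>\<^sub>M count_space UNIV" for m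
    using st R by (intro measurable_obs_stopping_time sets_iid_law) auto
  have "(\<integral>\<^sup>+\<omega>. restarted_reward \<tau> \<infinity> \<omega> \<partial>iid_law R)
      = (\<Sum>m. \<integral>\<^sup>+\<omega>. 2 ^ Suc m * (if \<tau> m \<omega> < \<infinity> \<and> \<tau> m \<omega> \<le> \<infinity> then 1 else 0) \<partial>iid_law R)"
    unfolding restarted_reward_def by (intro nn_integral_suminf) simp
  also have "\<dots> \<le> (\<Sum>m. ennreal ((1/2) ^ Suc m))"
  proof (intro suminf_le summableI)
    fix m
    let ?A = "{\<omega>\<in>space (iid_law R). \<tau> m \<omega> < \<infinity>}"
    have A: "?A \<in> events" by measurable
    have "(\<integral>\<^sup>+\<omega>. 2 ^ Suc m * (if \<tau> m \<omega> < \<infinity> \<and> \<tau> m \<omega> \<le> \<infinity> then 1 else 0) \<partial>iid_law R)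
        = (\<integral>\<^sup>+\<omega>. 2 ^ Suc m * indicator ?A \<omega> \<partial>iid_law R)"
      by (intro nn_integral_cong) (auto simp: indicator_def)
    also have "\<dots> = 2 ^ Suc m * emeasure (iid_law R) ?A"
      using A by (rule nn_integral_cmult_indicator)
    also have "\<dots> \<le> ennreal (2 ^ Suc m) * ennreal ((1/4) ^ Suc m)"
      unfolding emeasure_eq_measure ennreal_power[symmetric, OF zero_le_numeral]
      by (intro mult_mono ennreal_leI lev) auto
    also have "\<dots> = ennreal ((1/2) ^ Suc m)"
      by (subst ennreal_mult[symmetric]) (auto simp: power_mult_distrib[symmetric] simp del: power_Suc)
    finally show "(\<integral>\<^sup>+\<omega>. 2 ^ Suc m * (if \<tau> m \<omega> < \<infinity> \<and> \<tau> m \<omega> \<le> \<infinity> then 1 else 0) \<partial>iid_law R)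
        \<le> ennreal ((1/2) ^ Suc m)" .
  qed
  also have "\<dots> = ennreal 1"
    by (rule suminf_ennreal_eq[OF _ power_half_series]) auto
  finally show ?thesis by simp
qed

lemma ennreal_convex_weights:
  assumes "0 < \<eta>" shows "ennreal (1 / (1 + \<eta>)) + ennreal (\<eta> / (1 + \<eta>)) = 1"
proof -
  have "1 / (1 + \<eta>) + \<eta> / (1 + \<eta>) = 1" using assms by (simp add: field_simps)
  then show ?thesis using assms by (subst ennreal_plus[symmetric]) auto
qed

context
  fixes X :: "'a measure" and U :: "'u measure" and G and PP :: "'a measure set" and \<eta> :: real
    and \<tau> :: "nat \<Rightarrow> (nat \<Rightarrow> 'a) \<Rightarrow> enat"
  assumes aux: "aux_randomization U G" and \<eta>: "0 < \<eta>"
    and PP: "\<And>P. P \<in> PP \<Longrightarrow> prob_space P \<and> sets P = sets X"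
    and lev: "\<And>m. level_test X PP ((1/4) ^ Suc m) (\<tau> m)"
begin

private lemma st: "ext_stopping_time (obs_filtration X) (\<tau> m)"
  using lev[of m] by (simp add: level_test_def alarm_time_def)

lemma measurable_restarted_detector:
  "restarted_detector \<eta> \<tau> t \<in> borel_measurable (full_filtration X G t)"
  unfolding restarted_detector_def [abs_def]
proof (intro borel_measurable_sum borel_measurable_add borel_measurable_times_ennreal borel_measurable_const)
  fix s assume "s \<in> {..<t}"
  then have "s + (t - s) = t" by simp
  then have "(\<lambda>x. restarted_reward \<tau> (enat (t - s)) (seq_shift s x)) \<in> borel_measurable (obs_filtration X t)"
    using measurable_compose[OF measurable_shift_obs[of s X "t - s"] measurable_restarted_reward_obs[OF st]]
    by simp
  then show "(\<lambda>x. restarted_reward \<tau> (enat (t - s)) (seq_shift s (fst x))) \<in> borel_measurable (full_filtration X G t)"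
    unfolding full_filtration_def by (rule measurable_compose[OF measurable_fst])
qed

text \<open>Replacing each running payment by its value in the long run bounds the stopped detector
  by a sum over the restarts \<open>s < \<sigma>\<close>. Whether \<open>s < \<sigma>\<close> holds
  is known at time \<open>s\<close>, before that restart sees any data, so as in Wald's identity the
  mean is at most the sum of the probabilities of \<open>s < \<sigma>\<close>, which is the mean of
  \<sigma>.\<close>

lemma e_detector_restarted: "e_detector X U G PP (restarted_detector \<eta> \<tau>)"
  unfolding e_detector_def
proof (intro conjI allI ballI impI)
  show "restarted_detector \<eta> \<tau> t \<in> borel_measurable (full_filtration X G t)" for t
    by (rule measurable_restarted_detector)
  show "restarted_detector \<eta> \<tau> 0 \<omega> = 0" for \<omega> :: "(nat \<Rightarrow> 'a) \<times> 'u"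
    by (simp add: restarted_detector_def)
  fix P \<sigma> assume P: "P \<in> PP" and \<sigma>: "ext_stopping_time (full_filtration X G) \<sigma>"
  have Pp: "prob_space P" and Ps: "sets P = sets X" using PP[OF P] by auto
  interpret IP: prob_space "iid_law P" using Pp by (rule prob_space_iid_law)
  let ?M = "iid_law P \<Otimes>\<^sub>M U"
  have sP: "sets (iid_law P) = sets (iid_law X)" using Ps by (rule sets_iid_law)
  have spP: "space (iid_law P) = space (iid_law X)" using sP by (rule sets_eq_imp_space_eq)
  \<comment> \<open>Long-run contribution of one restart, deterministic share included; its mean is
    at most the sum of the two weights, which is 1.\<close>
  define V where "V \<omega> = ennreal (1 / (1 + \<eta>)) + ennreal (\<eta> / (1 + \<eta>)) * restarted_reward \<tau> \<infinity> \<omega>" for \<omega>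
  have V: "V \<in> borel_measurable (iid_law X)"
    unfolding V_def using measurable_restarted_reward[OF st] by simp
  have intV: "(\<integral>\<^sup>+\<omega>. V \<omega> \<partial>iid_law P) \<le> 1"
  proof -
    have R: "restarted_reward \<tau> \<infinity> \<in> borel_measurable (iid_law P)"
      using measurable_restarted_reward[OF st] by (simp add: measurable_cong_sets[OF sP refl])
    have "(\<integral>\<^sup>+\<omega>. V \<omega> \<partial>iid_law P)
        = ennreal (1 / (1 + \<eta>)) + ennreal (\<eta> / (1 + \<eta>)) * (\<integral>\<^sup>+\<omega>. restarted_reward \<tau> \<infinity> \<omega> \<partial>iid_law P)"
      unfolding V_def using R by (simp add: nn_integral_add nn_integral_cmult IP.emeasure_space_1)
    also have "\<dots> \<le> ennreal (1 / (1 + \<eta>)) + ennreal (\<eta> / (1 + \<eta>)) * 1"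
      using PP level_testD[OF lev P]
      by (intro add_left_mono mult_left_mono nn_integral_restarted_reward_le[OF st Pp Ps]) auto
    finally show ?thesis using ennreal_convex_weights[OF \<eta>] by simp
  qed
  let ?A = "\<lambda>s. {\<omega> \<in> space (iid_law X) \<times> space U. enat s < \<sigma> \<omega>}"
  have A: "?A s \<in> sets (full_filtration X G s)" for s
  proof -
    have "?A s = space (full_filtration X G s) - {\<omega> \<in> space (iid_law X) \<times> space U. \<sigma> \<omega> \<le> enat s}"
      by (auto simp: space_full_filtration[OF aux])
    then show ?thesis using ext_stopping_timeD[OF aux \<sigma> order_refl, of s] by auto
  qed
  have sub: "subalgebra ?M (full_filtration X G s)" for s
    by (rule subalgebra_full_filtration[OF aux sP])
  have AM: "?A s \<in> sets ?M" for s
    using A[of s] sub[of s] by (auto simp: subalgebra_def)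
  have "(\<integral>\<^sup>+\<omega>. stopped_value (restarted_detector \<eta> \<tau>) \<sigma> \<omega> \<partial>?M)
      \<le> (\<integral>\<^sup>+\<omega>. (\<Sum>s. indicator (?A s) \<omega> * V (seq_shift s (fst \<omega>))) \<partial>?M)"
  proof (rule nn_integral_mono)
    fix \<omega> assume "\<omega> \<in> space ?M"
    then have \<omega>: "\<omega> \<in> space (iid_law X) \<times> space U" by (simp add: space_pair_measure spP)
    let ?S = "\<Sum>s. indicator (?A s) \<omega> * V (seq_shift s (fst \<omega>))"
    have D: "restarted_detector \<eta> \<tau> t \<omega> \<le> ?S" if "enat t \<le> \<sigma> \<omega>" for t
    proof -
      have "restarted_detector \<eta> \<tau> t \<omega> \<le> (\<Sum>s<t. indicator (?A s) \<omega> * V (seq_shift s (fst \<omega>)))"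
        unfolding restarted_detector_def
      proof (rule sum_mono)
        fix s assume s: "s \<in> {..<t}"
        then have "enat s < enat t" by simp
        also note that
        finally have "\<omega> \<in> ?A s" using \<omega> by auto
        then show "ennreal (1 / (1 + \<eta>)) + ennreal (\<eta> / (1 + \<eta>)) * restarted_reward \<tau> (enat (t - s)) (seq_shift s (fst \<omega>))
            \<le> indicator (?A s) \<omega> * V (seq_shift s (fst \<omega>))"
          unfolding V_def by (simp add: add_left_mono mult_left_mono restarted_reward_mono)
      qed
      also have "\<dots> \<le> ?S" by (intro sum_le_suminf summableI) auto
      finally show ?thesis .
    qed
    show "stopped_value (restarted_detector \<eta> \<tau>) \<sigma> \<omega> \<le> ?S"
    proof (cases "\<sigma> \<omega>")
      case (enat t)
      then show ?thesis using D by (simp add: stopped_value_def)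
    next
      case infinity
      \<comment> \<open>At an infinite stopping time every finite time satisfies the premise of
        \<open>D\<close>, so the bound passes to the limit.\<close>
      have "liminf (\<lambda>t. restarted_detector \<eta> \<tau> t \<omega>) \<le> limsup (\<lambda>t. restarted_detector \<eta> \<tau> t \<omega>)"
        by (rule Liminf_le_Limsup) simp
      also have "\<dots> \<le> ?S" using D infinity by (intro Limsup_bounded always_eventually) simp
      finally show ?thesis using infinity by (simp add: stopped_value_def)
    qed
  qed
  also have "\<dots> = (\<Sum>s. \<integral>\<^sup>+\<omega>. indicator (?A s) \<omega> * V (seq_shift s (fst \<omega>)) \<partial>?M)"
  proof (rule nn_integral_suminf)
    fix s
    have "(\<lambda>x. V (seq_shift s x)) \<in> borel_measurable (iid_law P)"
      unfolding measurable_cong_sets[OF sP refl] by (rule measurable_compose[OF measurable_seq_shift V])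
    then show "(\<lambda>\<omega>. indicator (?A s) \<omega> * V (seq_shift s (fst \<omega>))) \<in> borel_measurable ?M"
      using AM[of s] by (intro borel_measurable_times_ennreal borel_measurable_indicator)
        (auto intro: measurable_compose[OF measurable_fst])
  qed
  also have "\<dots> \<le> (\<Sum>s. emeasure ?M {\<omega> \<in> space ?M. enat s < \<sigma> \<omega>})"
  proof (intro suminf_le summableI)
    fix s
    have "(\<integral>\<^sup>+\<omega>. indicator (?A s) \<omega> * V (seq_shift s (fst \<omega>)) \<partial>?M)
        = emeasure ?M (?A s) * (\<integral>\<^sup>+\<omega>. V \<omega> \<partial>iid_law P)"
      using nn_integral_past_future_aux[OF aux Pp Pp Ps Ps A[of s] V] by (simp add: change_law_same)
    also have "\<dots> \<le> emeasure ?M (?A s) * 1" using intV by (rule mult_left_mono) simp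
    finally show "(\<integral>\<^sup>+\<omega>. indicator (?A s) \<omega> * V (seq_shift s (fst \<omega>)) \<partial>?M) \<le> emeasure ?M {\<omega> \<in> space ?M. enat s < \<sigma> \<omega>}"
      by (simp add: space_pair_measure spP)
  qed
  also have "\<dots> = mean_time ?M \<sigma>"
    unfolding mean_time_def
    by (rule nn_integral_enat_function[symmetric]) (rule measurable_ext_stopping_time[OF aux \<sigma> sP])
  finally show "(\<integral>\<^sup>+\<omega>. stopped_value (restarted_detector \<eta> \<tau>) \<sigma> \<omega> \<partial>?M) \<le> mean_time ?M \<sigma>" .
qed

text \<open>The deterministic part alone grows by 1 / (1 + \<eta>) per step, so it reaches \<gamma>
  whatever the data.\<close>

lemma restarted_threshold_le:
  assumes "1 \<le> \<gamma>"
  shows "threshold_time (restarted_detector \<eta> \<tau>) \<gamma> z \<le> enat (nat \<lceil>(1 + \<eta>) * \<gamma>\<rceil>)"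
  unfolding threshold_time_le_iff
proof (intro exI conjI)
  let ?N = "nat \<lceil>(1 + \<eta>) * \<gamma>\<rceil>"
  have "1 * 1 \<le> (1 + \<eta>) * \<gamma>" using \<eta> assms by (intro mult_mono) auto
  then show "1 \<le> ?N" by linarith
  have "(1 + \<eta>) * \<gamma> \<le> real ?N" using \<open>1 * 1 \<le> (1 + \<eta>) * \<gamma>\<close> by linarith
  then have "\<gamma> \<le> real ?N * (1 / (1 + \<eta>))" using \<eta> by (simp add: field_simps)
  then have "ennreal \<gamma> \<le> ennreal (real ?N * (1 / (1 + \<eta>)))" by (rule ennreal_leI)
  also have "\<dots> = (\<Sum>s<?N. ennreal (1 / (1 + \<eta>)))"
    using \<eta> by (simp add: ennreal_mult[symmetric] ennreal_of_nat_eq_real_of_nat)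
  also have "\<dots> \<le> restarted_detector \<eta> \<tau> ?N z"
    unfolding restarted_detector_def by (intro sum_mono) simp
  finally show "ennreal \<gamma> \<le> restarted_detector \<eta> \<tau> ?N z" .
qed simp

text \<open>One rejection, \<open>k\<close> observations after restart \<open>s\<close>, pays enough
  to cross \<gamma> by itself; all other restarts only add to it.\<close>

lemma restarted_threshold_delay:
  assumes "1 \<le> k" and "\<tau> m (seq_shift s (fst z)) = enat k" and "ennreal \<gamma> \<le> ennreal (\<eta> / (1 + \<eta>)) * 2 ^ Suc m"
  shows "threshold_time (restarted_detector \<eta> \<tau>) \<gamma> z \<le> enat (s + k)"
  unfolding threshold_time_le_iff
proof (intro exI conjI)
  show "1 \<le> s + k" using assms by simp
  let ?f = "\<lambda>s'. ennreal (1 / (1 + \<eta>)) + ennreal (\<eta> / (1 + \<eta>)) * restarted_reward \<tau> (enat (s + k - s')) (seq_shift s' (fst z))"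
  note assms(3)
  also have "ennreal (\<eta> / (1 + \<eta>)) * 2 ^ Suc m \<le> ennreal (\<eta> / (1 + \<eta>)) * restarted_reward \<tau> (enat k) (seq_shift s (fst z))"
    using assms(2) by (intro mult_left_mono restarted_reward_ge) auto
  also have "\<dots> \<le> ?f s" by simp
  also have "\<dots> = sum ?f {s}" by simp
  also have "\<dots> \<le> sum ?f {..<s + k}" using assms(1) by (intro sum_mono2) auto
  finally show "ennreal \<gamma> \<le> restarted_detector \<eta> \<tau> (s + k) z" by (simp add: restarted_detector_def)
qed simp

text \<open>One of the restarts falls on the change: for \<open>s = \<nu> - 1\<close> its test sees
  only post-change data, which are independent of the past, so conditioning on the past leaves its
  mean unchanged.\<close>

lemma restarted_lorden_delay_le:
  assumes Q: "prob_space Q" "sets Q = sets X" and fin: "mean_time (iid_law Q) (\<tau> m) < \<infinity>"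
    and \<gamma>: "ennreal \<gamma> \<le> ennreal (\<eta> / (1 + \<eta>)) * 2 ^ Suc m"
  shows "robust_lorden_delay X U G PP Q (threshold_time (restarted_detector \<eta> \<tau>) \<gamma>) \<le> mean_time (iid_law Q) (\<tau> m)"
  unfolding robust_lorden_delay_def
proof (intro SUP_least)
  fix P and \<nu> :: nat assume P: "P \<in> PP" and "\<nu> \<in> {1..}"
  then obtain s where \<nu>: "\<nu> = Suc s" by (cases \<nu>) auto
  have Pp: "prob_space P" and Ps: "sets P = sets X" using PP[OF P] by auto
  let ?C = "change_law P Q \<nu>" let ?M = "?C \<Otimes>\<^sub>M U"
  let ?T = "threshold_time (restarted_detector \<eta> \<tau>) \<gamma> :: (nat \<Rightarrow> 'a) \<times> 'u \<Rightarrow> enat"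
  let ?f = "\<lambda>\<omega>. ennreal_of_enat (?T \<omega> + 1 - enat \<nu>)"
  interpret C: prob_space ?C using Pp Q(1) by (rule prob_space_change_law)
  interpret U: prob_space U using aux by (rule aux_randomizationD)
  interpret CU: pair_prob_space ?C U ..
  have sC: "sets ?C = sets (iid_law X)" using Ps Q(2) by (rule sets_change_law)
  have spC: "space ?C = space (iid_law X)" using sC by (rule sets_eq_imp_space_eq)
  have T: "ext_stopping_time (full_filtration X G) ?T"
    using alarm_time_threshold[OF aux measurable_restarted_detector] by (simp add: alarm_time_def)
  have fm: "?f \<in> borel_measurable ?M"
    by (rule measurable_compose[OF measurable_ext_stopping_time[OF aux T sC]]) simp
  have \<tau>m: "(\<lambda>\<omega>. ennreal_of_enat (\<tau> m \<omega>)) \<in> borel_measurable (iid_law X)"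
    by (rule measurable_compose[OF measurable_obs_stopping_time[OF st refl]]) simp
  show "esssup ?M (nn_cond_exp ?M (full_filtration X G (\<nu> - 1)) ?f) \<le> mean_time (iid_law Q) (\<tau> m)"
  proof (rule esssup_nn_cond_exp_le[OF _ _ fm fin])
    show "prob_space ?M" by unfold_locales
    show "subalgebra ?M (full_filtration X G (\<nu> - 1))" by (rule subalgebra_full_filtration[OF aux sC])
    fix A assume A: "A \<in> sets (full_filtration X G (\<nu> - 1))"
    have "(\<integral>\<^sup>+\<omega>. indicator A \<omega> * ?f \<omega> \<partial>?M)
        \<le> (\<integral>\<^sup>+\<omega>. indicator A \<omega> * ennreal_of_enat (\<tau> m (seq_shift s (fst \<omega>))) \<partial>?M)"
    proof (intro nn_integral_mono mult_left_mono)
      fix \<omega> assume "\<omega> \<in> space ?M"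
      then have "seq_shift s (fst \<omega>) \<in> space (iid_law X)"
        using measurable_space[OF measurable_seq_shift] by (auto simp: space_pair_measure spC)
      then have ge1: "1 \<le> \<tau> m (seq_shift s (fst \<omega>))"
        using lev[of m] by (simp add: level_test_def alarm_time_def)
      show "?f \<omega> \<le> ennreal_of_enat (\<tau> m (seq_shift s (fst \<omega>)))"
      proof (cases "\<tau> m (seq_shift s (fst \<omega>))")
        case (enat k)
        then have "?T \<omega> \<le> enat (s + k)"
          using ge1 by (intro restarted_threshold_delay[OF _ _ \<gamma>]) (auto simp: one_enat_def)
        \<comment> \<open>With \<open>\<nu> = Suc s\<close>, an alarm by time \<open>s + k\<close>
          is a delay of at most \<open>k\<close>: the observation at the change counts as the
          first.\<close>
        then obtain t where "?T \<omega> = enat t" "t \<le> s + k" by (cases "?T \<omega>") auto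
        then show ?thesis using enat \<nu> by (simp add: one_enat_def)
      qed simp
    qed simp
    also have "\<dots> = emeasure ?M A * mean_time (iid_law Q) (\<tau> m)"
      unfolding mean_time_def
      using nn_integral_past_future_aux[OF aux Pp Q(1) Ps Q(2) _ \<tau>m, of A s] A \<nu> by simp
    finally show "(\<integral>\<^sup>+\<omega>. indicator A \<omega> * ?f \<omega> \<partial>?M) \<le> mean_time (iid_law Q) (\<tau> m) * emeasure ?M A"
      by (simp add: mult.commute)
  qed
qed

end

lemma log_delay_family_restarted:
  fixes X :: "'a measure" and U :: "'u measure"
  assumes aux: "aux_randomization U G" and \<eta>: "0 < \<eta>"
    and PP: "\<And>P. P \<in> PP \<Longrightarrow> prob_space P \<and> sets P = sets X"
    and QQ: "\<And>Q. Q \<in> QQ \<Longrightarrow> prob_space Q \<and> sets Q = sets X" and "PP \<noteq> {}"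
    and lev: "\<And>m. level_test X PP ((1/4) ^ Suc m) (\<tau> m)"
    and mean: "\<And>m Q. Q \<in> QQ \<Longrightarrow> mean_time (iid_law Q) (\<tau> m) \<le> ennreal (A + B * ln (4 ^ Suc m))"
  shows "log_delay_family X U G PP QQ \<eta> (threshold_time (restarted_detector \<eta> \<tau>))"
proof -
  let ?T = "threshold_time (restarted_detector \<eta> \<tau>) :: real \<Rightarrow> (nat \<Rightarrow> 'a) \<times> 'u \<Rightarrow> enat"
  have det: "e_detector X U G PP (restarted_detector \<eta> \<tau>)"
    by (rule e_detector_restarted[OF aux \<eta> PP lev])
  have valid: "optionally_ARL_valid X U G PP \<gamma> (?T \<gamma>)" if "1 \<le> \<gamma>" for \<gamma>
    using PP by (intro e_detector_threshold_ARL_valid[OF aux det that]) auto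
  have upper: "?T \<gamma> z \<le> enat (nat \<lceil>(1 + \<eta>) * \<gamma>\<rceil>)" if "1 \<le> \<gamma>" for \<gamma> z
    by (rule restarted_threshold_le[OF aux \<eta> PP lev that])
  have mean_bounds: "ennreal \<gamma> \<le> mean_time (iid_law P \<Otimes>\<^sub>M U) (?T \<gamma>)"
      "mean_time (iid_law P \<Otimes>\<^sub>M U) (?T \<gamma>) \<le> ennreal ((1 + \<eta>) * \<gamma> + 1)" if \<gamma>: "1 \<le> \<gamma>" and P: "P \<in> PP" for \<gamma> P
  proof -
    interpret IP: prob_space "iid_law P" using PP[OF P] by (auto intro: prob_space_iid_law)
    interpret U: prob_space U using aux by (rule aux_randomizationD)
    interpret pair_prob_space "iid_law P" U ..
    let ?M = "iid_law P \<Otimes>\<^sub>M U"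
    have st: "ext_stopping_time (full_filtration X G) (?T \<gamma>)"
      using valid[OF \<gamma>] by (simp add: optionally_ARL_valid_def alarm_time_def)
    have "?T \<gamma> z < \<infinity>" for z using upper[OF \<gamma>, of z] by (rule le_less_trans) simp
    \<comment> \<open>Optional validity is applied with the alarm time itself as \<sigma>. The alarm
      time is finite, so the event is certain and the lower bound on the mean follows.\<close>
    then have "{\<omega> \<in> space ?M. ?T \<gamma> \<omega> < \<infinity> \<and> ?T \<gamma> \<omega> \<le> ?T \<gamma> \<omega>} = space ?M" by auto
    then have "emeasure ?M (space ?M) \<le> mean_time ?M (?T \<gamma>) / ennreal \<gamma>"
      using valid[OF \<gamma>, unfolded optionally_ARL_valid_def, THEN conjunct2, THEN bspec, OF P, THEN spec, THEN mp, OF st]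
      by simp
    then have "1 * ennreal \<gamma> \<le> mean_time ?M (?T \<gamma>) / ennreal \<gamma> * ennreal \<gamma>"
      by (intro mult_right_mono) (auto simp: emeasure_space_1)
    also have "\<dots> = mean_time ?M (?T \<gamma>)"
      using \<gamma> by (subst mult.commute, subst ennreal_times_divide, subst mult.commute,
          subst ennreal_mult_divide_eq) auto
    finally show "ennreal \<gamma> \<le> mean_time ?M (?T \<gamma>)" by simp
    have "mean_time ?M (?T \<gamma>) \<le> (\<integral>\<^sup>+\<omega>. of_nat (nat \<lceil>(1 + \<eta>) * \<gamma>\<rceil>) \<partial>?M)"
      unfolding mean_time_def ennreal_of_enat_enat[symmetric] by (intro nn_integral_mono) (simp add: upper[OF \<gamma>] del: ennreal_of_enat_enat)
    also have "\<dots> = ennreal (real (nat \<lceil>(1 + \<eta>) * \<gamma>\<rceil>))"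
      by (simp add: emeasure_space_1 ennreal_of_nat_eq_real_of_nat)
    also have "\<dots> \<le> ennreal ((1 + \<eta>) * \<gamma> + 1)"
    proof (rule ennreal_leI)
      have "0 \<le> (1 + \<eta>) * \<gamma>" using \<eta> \<gamma> by (intro mult_nonneg_nonneg) auto
      then show "real (nat \<lceil>(1 + \<eta>) * \<gamma>\<rceil>) \<le> (1 + \<eta>) * \<gamma> + 1" by linarith
    qed
    finally show "mean_time ?M (?T \<gamma>) \<le> ennreal ((1 + \<eta>) * \<gamma> + 1)" .
  qed
  define b where "b = \<eta> / (1 + \<eta>)"
  have b: "0 < b" "b \<le> 1" using \<eta> by (auto simp: b_def)
  \<comment> \<open>\<open>K\<close> and \<open>L\<close> collect the constant term and the
    coefficient of ln \<gamma> that result from \<open>real (Suc m)\<close> being at most log 2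
    (\<gamma> / b) + 2.\<close>
  define K where "K = \<bar>A\<bar> + \<bar>B\<bar> * ln 4 * (log 2 (1 / b) + 2)"
  define L where "L = \<bar>B\<bar> * ln 4 / ln 2"
  have "0 \<le> log 2 (1 / b)"
    using b by simp
  then have K: "0 \<le> K" unfolding K_def by (intro add_nonneg_nonneg mult_nonneg_nonneg) auto
  have delay: "robust_lorden_delay X U G PP Q (?T \<gamma>) \<le> ennreal ((K + L) * ln \<gamma>)"
    if \<gamma>: "exp 1 \<le> \<gamma>" and Q: "Q \<in> QQ" for \<gamma> Q
  proof -
    have \<gamma>1: "1 \<le> \<gamma>" using \<gamma> exp_ge_add_one_self[of 1] by linarith
    \<comment> \<open>Only the analysis picks a level for \<gamma>; the detector runs them all. Here
      2 ^ m is at least \<gamma> / b, so the payment weighted by \<open>b\<close> reaches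
      \<gamma>.\<close>
    define m where "m = nat \<lceil>log 2 (\<gamma> / b)\<rceil>"
    have gb: "1 \<le> \<gamma> / b" using b \<gamma>1 by (simp add: le_divide_eq)
    then have l0: "0 \<le> log 2 (\<gamma> / b)" by simp
    have "\<gamma> / b = 2 powr log 2 (\<gamma> / b)" using gb by simp
    also have "\<dots> \<le> 2 powr real m" unfolding m_def using l0 by (intro powr_mono) linarith+
    also have "\<dots> \<le> 2 ^ Suc m" by (simp add: powr_realpow)
    finally have "\<gamma> \<le> b * 2 ^ Suc m" using b(1) by (simp add: pos_divide_le_eq mult.commute)
    then have "ennreal \<gamma> \<le> ennreal (b * 2 ^ Suc m)" by (rule ennreal_leI)
    also have "\<dots> = ennreal b * 2 ^ Suc m"
      using b by (simp add: ennreal_mult ennreal_power[symmetric] del: power_Suc)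
    finally have \<gamma>m: "ennreal \<gamma> \<le> ennreal b * 2 ^ Suc m" .
    have fin: "mean_time (iid_law Q) (\<tau> m) < \<infinity>"
      using mean[OF Q, of m] by (auto intro: le_less_trans)
    have "robust_lorden_delay X U G PP Q (?T \<gamma>) \<le> mean_time (iid_law Q) (\<tau> m)"
      using QQ[OF Q] by (intro restarted_lorden_delay_le[OF aux \<eta> PP lev _ _ fin \<gamma>m[unfolded b_def]]) auto
    also have "\<dots> \<le> ennreal (A + B * ln (4 ^ Suc m))" by (rule mean[OF Q])
    also have "\<dots> \<le> ennreal ((K + L) * ln \<gamma>)"
    proof (rule ennreal_leI)
      have "real m \<le> log 2 (\<gamma> / b) + 1" unfolding m_def using l0 by linarith
      also have "log 2 (\<gamma> / b) = ln \<gamma> / ln 2 + log 2 (1 / b)"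
        using \<gamma>1 b by (simp add: log_def ln_div diff_divide_distrib)
      finally have m: "real (Suc m) \<le> ln \<gamma> / ln 2 + (log 2 (1 / b) + 2)" by simp
      have "A + B * ln (4 ^ Suc m) \<le> \<bar>A\<bar> + \<bar>B\<bar> * (real (Suc m) * ln 4)"
        by (subst ln_realpow) (auto intro!: add_mono mult_right_mono)
      also have "\<dots> \<le> \<bar>A\<bar> + \<bar>B\<bar> * ((ln \<gamma> / ln 2 + (log 2 (1 / b) + 2)) * ln 4)"
        using m by (intro add_left_mono mult_left_mono mult_right_mono) auto
      also have "\<dots> = K * 1 + L * ln \<gamma>" unfolding K_def L_def by (simp add: algebra_simps)
      also have "\<dots> \<le> K * ln \<gamma> + L * ln \<gamma>"
      proof -
        \<comment> \<open>The range from exp 1 on was chosen for this: the constant \<open>K\<close>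
          is absorbed into a multiple of ln \<gamma>.\<close>
        have "1 \<le> ln \<gamma>" using \<gamma> \<gamma>1 by (simp add: ln_ge_iff)
        then show ?thesis using K by (intro add_right_mono mult_left_mono)
      qed
      finally show "A + B * ln (4 ^ Suc m) \<le> (K + L) * ln \<gamma>" by (simp add: distrib_right)
    qed
    finally show ?thesis .
  qed
  show ?thesis
    unfolding log_delay_family_def optionally_ARL_valid_family_def
  proof (intro conjI allI impI)
    fix \<gamma> :: real assume \<gamma>: "1 \<le> \<gamma>"
    show "optionally_ARL_valid X U G PP \<gamma> (?T \<gamma>)" by (rule valid[OF \<gamma>])
    show "ennreal \<gamma> \<le> (INF P\<in>PP. mean_time (iid_law P \<Otimes>\<^sub>M U) (?T \<gamma>))"
      by (intro INF_greatest mean_bounds(1)[OF \<gamma>])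
    show "(SUP P\<in>PP. mean_time (iid_law P \<Otimes>\<^sub>M U) (?T \<gamma>)) \<le> ennreal ((1 + \<eta>) * \<gamma> + 1)"
      by (intro SUP_least mean_bounds(2)[OF \<gamma>])
    show "(INF P\<in>PP. mean_time (iid_law P \<Otimes>\<^sub>M U) (?T \<gamma>)) \<le> (SUP P\<in>PP. mean_time (iid_law P \<Otimes>\<^sub>M U) (?T \<gamma>))"
      by (rule INF_le_SUP[OF \<open>PP \<noteq> {}\<close>])
  next
    show "\<exists>C. \<forall>\<^sub>F \<gamma> in at_top. (SUP Q\<in>QQ. robust_lorden_delay X U G PP Q (?T \<gamma>)) \<le> ennreal (C * ln \<gamma>)"
      by (intro exI[of _ "K + L"] eventually_mono[OF eventually_ge_at_top[of "exp 1"]] SUP_least delay)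
  qed
qed

section \<open>Fixed-sample tests from stopping rules\<close>

text \<open>A function of the first \<open>k\<close> coordinates of a sequence becomes a function on
  the finite power by padding with a fixed point, without changing its expectations.\<close>

lemma fixed_sample_separationI:
  assumes "PP \<noteq> {}" "QQ \<noteq> {}" and R: "\<And>R. R \<in> PP \<union> QQ \<Longrightarrow> prob_space R \<and> sets R = sets X"
    and "1 \<le> k" and \<psi>: "\<psi> \<in> borel_measurable (obs_filtration X k)"
    and \<psi>01: "\<And>\<omega>. \<omega> \<in> space (iid_law X) \<Longrightarrow> 0 \<le> \<psi> \<omega> \<and> \<psi> \<omega> \<le> (1::real)"
    and P: "\<And>P. P \<in> PP \<Longrightarrow> (\<integral>\<omega>. \<psi> \<omega> \<partial>iid_law P) \<le> a"
    and Q: "\<And>Q. Q \<in> QQ \<Longrightarrow> b \<le> (\<integral>\<omega>. \<psi> \<omega> \<partial>iid_law Q)" and "a < b"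
  shows "fixed_sample_separation X PP QQ"
proof -
  obtain R0 where "R0 \<in> PP" using \<open>PP \<noteq> {}\<close> by auto
  then have R0: "prob_space R0" "space R0 = space X" using R[of R0] by (auto dest: sets_eq_imp_space_eq)
  then obtain x0 where x0: "x0 \<in> space X" using prob_space.not_empty by force
  define ext where "ext x = (\<lambda>i. if i < k then x i else x0)" for x :: "nat \<Rightarrow> 'a"
  have ext_space: "ext x \<in> space (iid_law X)" if "x \<in> space (power_law X k)" for x
    using that x0 by (auto simp: ext_def power_law_def iid_law_def space_PiM PiE_iff)
  have ext_restrict: "restrict (ext x) {..<k} = x" if "x \<in> space (power_law X k)" for x
    using that by (auto simp: ext_def power_law_def space_PiM PiE_iff extensional_def fun_eq_iff restrict_def)
  have ext: "ext \<in> power_law X k \<rightarrow>\<^sub>M obs_filtration X k"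
  proof (rule measurable_obsI)
    show "(\<lambda>x. restrict (ext x) {..<k}) \<in> power_law X k \<rightarrow>\<^sub>M power_law X k"
      by (subst measurable_cong[of _ _ "\<lambda>x. x"]) (simp_all add: ext_restrict)
  qed (use ext_space in auto)
  define \<phi> where "\<phi> = (\<lambda>x. \<psi> (ext x))"
  have \<phi>: "\<phi> \<in> borel_measurable (power_law X k)"
    unfolding \<phi>_def by (rule measurable_compose[OF ext \<psi>])
  have \<phi>_restrict: "\<phi> (restrict \<omega> {..<k}) = \<psi> \<omega>" if \<omega>: "\<omega> \<in> space (iid_law X)" for \<omega>
  proof -
    \<comment> \<open>The event that \<psi> takes the value it has at \<omega> is observed by time
      \<open>k\<close>, so replacing the later coordinates does not leave it.\<close>
    have "{x \<in> space (obs_filtration X k). \<psi> x = \<psi> \<omega>} \<in> sets (obs_filtration X k)"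
      using \<psi> by measurable
    moreover have "restrict \<omega> {..<k} \<in> space (power_law X k)" using \<omega> by (rule restrict_in_space_power_law)
    ultimately show ?thesis
      using obs_set_cong[of "{x \<in> space (obs_filtration X k). \<psi> x = \<psi> \<omega>}" X k \<omega> "ext (restrict \<omega> {..<k})"] \<omega>
      by (simp add: \<phi>_def ext_space ext_restrict)
  qed
  have int: "(\<integral>x. \<phi> x \<partial>power_law R k) = (\<integral>\<omega>. \<psi> \<omega> \<partial>iid_law R)" if "R \<in> PP \<union> QQ" for R
  proof -
    have pR: "prob_space R" and sR: "sets R = sets X" using R[OF that] by auto
    have mr: "(\<lambda>x. restrict x {..<k}) \<in> iid_law R \<rightarrow>\<^sub>M power_law R k"
      unfolding iid_law_def power_law_def by simp
    have "\<phi> \<in> borel_measurable (power_law R k)"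
      using \<phi> unfolding measurable_cong_sets[OF sets_power_law[OF sR] refl] .
    then have "(\<integral>x. \<phi> x \<partial>power_law R k) = (\<integral>\<omega>. \<phi> (restrict \<omega> {..<k}) \<partial>iid_law R)"
      by (subst distr_iid_law_restrict[OF pR, symmetric]) (rule integral_distr[OF mr])
    also have "\<dots> = (\<integral>\<omega>. \<psi> \<omega> \<partial>iid_law R)"
      by (rule Bochner_Integration.integral_cong) (simp_all add: \<phi>_restrict space_iid_law[OF sR])
    finally show ?thesis .
  qed
  have "(SUP P\<in>PP. \<integral>x. \<phi> x \<partial>power_law P k) \<le> a"
    using P int by (intro cSUP_least \<open>PP \<noteq> {}\<close>) auto
  also note \<open>a < b\<close>
  also have "b \<le> (INF Q\<in>QQ. \<integral>x. \<phi> x \<partial>power_law Q k)"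
    using Q int by (intro cINF_greatest \<open>QQ \<noteq> {}\<close>) auto
  finally show ?thesis
    unfolding fixed_sample_separation_def
    using \<open>1 \<le> k\<close> \<phi> \<psi>01 ext_space by (intro exI[of _ k] conjI bexI[of _ \<phi>]) (auto simp: \<phi>_def)
qed

text \<open>Markov's inequality; an integer-valued time exceeds \<open>k\<close> only if it is at
  least \<open>k + 1\<close>, which gives the denominator.\<close>

lemma measure_mean_time_Markov:
  assumes "prob_space M" and T: "T \<in> M \<rightarrow>\<^sub>M count_space UNIV"
    and mean: "mean_time M T \<le> ennreal c" and "0 \<le> c"
  shows "measure M {\<omega>\<in>space M. enat k < T \<omega>} \<le> c / (real k + 1)"
proof -
  interpret prob_space M by fact
  let ?A = "{\<omega>\<in>space M. enat k < T \<omega>}"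
  have A: "?A \<in> sets M" using T by measurable
  have "ennreal ((real k + 1) * measure M ?A) = (\<integral>\<^sup>+\<omega>. of_nat (Suc k) * indicator ?A \<omega> \<partial>M)"
    using A by (simp add: nn_integral_cmult_indicator emeasure_eq_measure ennreal_mult ennreal_of_nat_eq_real_of_nat add.commute)
  also have "\<dots> \<le> mean_time M T"
    unfolding mean_time_def
  proof (intro nn_integral_mono)
    fix \<omega>
    show "of_nat (Suc k) * indicator ?A \<omega> \<le> ennreal_of_enat (T \<omega>)"
    proof (cases "\<omega> \<in> ?A")
      case True
      then have "enat (Suc k) \<le> T \<omega>" by (cases "T \<omega>") auto
      then have "ennreal_of_enat (enat (Suc k)) \<le> ennreal_of_enat (T \<omega>)"
        unfolding ennreal_of_enat_le_iff .
      with True show ?thesis by (simp del: of_nat_Suc)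
    qed simp
  qed
  also note mean
  finally have "(real k + 1) * measure M ?A \<le> c" using \<open>0 \<le> c\<close> by simp
  then show ?thesis by (simp add: pos_le_divide_eq mult.commute)
qed

text \<open>One level is enough: at 1/2 the uniform bound on the means makes the tails of order 1 /
  k, uniformly over \<open>QQ\<close>.\<close>

lemma log_power_one_tests_imp_uniformly_stopping_test:
  assumes "QQ \<noteq> {}" and QQ: "\<And>Q. Q \<in> QQ \<Longrightarrow> prob_space Q \<and> sets Q = sets X"
    and "log_power_one_tests X PP QQ"
  shows "uniformly_stopping_test X PP QQ"
proof -
  obtain A B :: real where AB: "\<And>\<alpha>. \<alpha> \<in> {0<..<1} \<Longrightarrow> \<exists>\<tau>. level_test X PP \<alpha> \<tau> \<and> (\<forall>Q\<in>QQ. power_one Q \<tau>) \<and>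
        (SUP Q\<in>QQ. mean_time (iid_law Q) \<tau>) \<le> ennreal (A + B * ln (1 / \<alpha>))"
    using assms(3) unfolding log_power_one_tests_def by blast
  obtain \<tau> where lev: "level_test X PP (1/2) \<tau>"
    and mean: "(SUP Q\<in>QQ. mean_time (iid_law Q) \<tau>) \<le> ennreal (A + B * ln (1 / (1/2)))"
    using AB[of "1/2"] by auto
  define c where "c = max 0 (A + B * ln (1 / (1/2)))"
  have st: "ext_stopping_time (obs_filtration X) \<tau>" using lev by (simp add: level_test_def alarm_time_def)
  have bound: "measure (iid_law Q) {\<omega>\<in>space (iid_law Q). enat k < \<tau> \<omega>} \<le> c / (real k + 1)" if Q: "Q \<in> QQ" for Q k
  proof (rule measure_mean_time_Markov)
    show "prob_space (iid_law Q)" "\<tau> \<in> iid_law Q \<rightarrow>\<^sub>M count_space UNIV"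
      using QQ[OF Q] by (auto intro!: prob_space_iid_law measurable_obs_stopping_time[OF st] sets_iid_law)
    have "mean_time (iid_law Q) \<tau> \<le> (SUP Q\<in>QQ. mean_time (iid_law Q) \<tau>)" using Q by (rule SUP_upper)
    also note mean
    also have "ennreal (A + B * ln (1 / (1/2))) \<le> ennreal c" unfolding c_def by (rule ennreal_leI) simp
    finally show "mean_time (iid_law Q) \<tau> \<le> ennreal c" .
    show "0 \<le> c" by (simp add: c_def)
  qed
  have "(\<lambda>k. SUP Q\<in>QQ. measure (iid_law Q) {\<omega>\<in>space (iid_law Q). enat k < \<tau> \<omega>}) \<longlonglongrightarrow> 0"
  proof (rule tendsto_sandwich[where f="\<lambda>_. 0" and h="\<lambda>k. c / (real k + 1)"])
    show "(\<lambda>k. c / (real k + 1)) \<longlonglongrightarrow> 0"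
      using tendsto_mult[OF tendsto_const LIMSEQ_inverse_real_of_nat, of c] by (simp add: divide_inverse add.commute)
    show "\<forall>\<^sub>F k in sequentially. (SUP Q\<in>QQ. measure (iid_law Q) {\<omega>\<in>space (iid_law Q). enat k < \<tau> \<omega>}) \<le> c / (real k + 1)"
      by (intro always_eventually allI cSUP_least \<open>QQ \<noteq> {}\<close> bound)
    show "\<forall>\<^sub>F k in sequentially. 0 \<le> (SUP Q\<in>QQ. measure (iid_law Q) {\<omega>\<in>space (iid_law Q). enat k < \<tau> \<omega>})"
    proof (intro always_eventually allI)
      fix k
      obtain Q where Q: "Q \<in> QQ" using \<open>QQ \<noteq> {}\<close> by auto
      show "0 \<le> (SUP Q\<in>QQ. measure (iid_law Q) {\<omega>\<in>space (iid_law Q). enat k < \<tau> \<omega>})"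
        by (rule cSUP_upper2[OF _ Q]) (auto intro: bdd_aboveI2[where M="c / (real k + 1)"] bound)
    qed
  qed simp
  with lev show ?thesis
    unfolding uniformly_stopping_test_def by (intro bexI[of _ "1/2"] exI[of _ \<tau>]) auto
qed

text \<open>Rejection by a fixed time \<open>k\<close> is a test with sample size \<open>k\<close>.
  Its probability is at most \<alpha> under \<open>PP\<close> for every \<open>k\<close>, and for
  large \<open>k\<close> it is above \<alpha> uniformly over \<open>QQ\<close>.\<close>

lemma uniformly_stopping_test_imp_fixed_sample_separation:
  assumes "PP \<noteq> {}" "QQ \<noteq> {}" and R: "\<And>R. R \<in> PP \<union> QQ \<Longrightarrow> prob_space R \<and> sets R = sets X"
    and "uniformly_stopping_test X PP QQ"
  shows "fixed_sample_separation X PP QQ"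
proof -
  obtain \<alpha> \<tau> where \<alpha>: "0 < \<alpha>" "\<alpha> < 1" and lev: "level_test X PP \<alpha> \<tau>"
    and lim: "(\<lambda>k. SUP Q\<in>QQ. measure (iid_law Q) {\<omega>\<in>space (iid_law Q). enat k < \<tau> \<omega>}) \<longlonglongrightarrow> 0"
    using assms(4) unfolding uniformly_stopping_test_def by auto
  have st: "ext_stopping_time (obs_filtration X) \<tau>" using lev by (simp add: level_test_def alarm_time_def)
  have "\<forall>\<^sub>F k in sequentially. (SUP Q\<in>QQ. measure (iid_law Q) {\<omega>\<in>space (iid_law Q). enat k < \<tau> \<omega>}) < 1 - \<alpha>"
    using lim \<alpha> by (intro order_tendstoD) auto
  with eventually_ge_at_top[of 1] obtain k :: nat where "1 \<le> k"
    and k: "(SUP Q\<in>QQ. measure (iid_law Q) {\<omega>\<in>space (iid_law Q). enat k < \<tau> \<omega>}) < 1 - \<alpha>"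
    using eventually_happens[OF eventually_conj] by (metis (no_types, lifting) trivial_limit_sequentially)
  let ?s = "SUP Q\<in>QQ. measure (iid_law Q) {\<omega>\<in>space (iid_law Q). enat k < \<tau> \<omega>}"
  let ?A = "{\<omega> \<in> space (iid_law X). \<tau> \<omega> \<le> enat k}"
  have A: "?A \<in> sets (obs_filtration X k)"
    using st unfolding ext_stopping_time_def by (auto simp: pred_def)
  have int: "(\<integral>\<omega>. indicator ?A \<omega> \<partial>iid_law R) = measure (iid_law R) ?A"
    if "R \<in> PP \<union> QQ" for R :: "'a measure"
  proof -
    have "?A \<inter> space (iid_law R) = ?A" using space_iid_law[of R X] R[OF that] by auto
    then show ?thesis by simp
  qed
  show ?thesis
  proof (rule fixed_sample_separationI[OF assms(1,2) R \<open>1 \<le> k\<close>, where \<psi>="indicator ?A" and a=\<alpha> and b="1 - ?s"])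
    show "indicator ?A \<in> borel_measurable (obs_filtration X k)" using A by simp
    show "0 \<le> (indicator ?A \<omega> :: real) \<and> (indicator ?A \<omega> :: real) \<le> 1" for \<omega> by (simp add: indicator_def)
    show "\<alpha> < 1 - ?s" using k by simp
  next
    fix P assume P: "P \<in> PP"
    then have Pp: "prob_space P" and Ps: "sets P = sets X" using R by auto
    interpret IP: prob_space "iid_law P" using Pp by (rule prob_space_iid_law)
    have \<tau>: "\<tau> \<in> iid_law P \<rightarrow>\<^sub>M count_space UNIV"
      by (rule measurable_obs_stopping_time[OF st sets_iid_law[OF Ps]])
    have "measure (iid_law P) ?A \<le> measure (iid_law P) {\<omega>\<in>space (iid_law P). \<tau> \<omega> < \<infinity>}"
    proof (rule IP.finite_measure_mono)
      show "?A \<subseteq> {\<omega>\<in>space (iid_law P). \<tau> \<omega> < \<infinity>}" using space_iid_law[OF Ps] by (auto dest: enat_ile)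
      show "{\<omega>\<in>space (iid_law P). \<tau> \<omega> < \<infinity>} \<in> IP.events" using \<tau> by measurable
    qed
    also have "\<dots> \<le> \<alpha>" using R by (intro level_testD[OF lev P]) auto
    finally show "(\<integral>\<omega>. indicator ?A \<omega> \<partial>iid_law P) \<le> \<alpha>" using int P by simp
  next
    fix Q assume Q: "Q \<in> QQ"
    then have Qp: "prob_space Q" and Qs: "sets Q = sets X" using R by auto
    interpret IQ: prob_space "iid_law Q" using Qp by (rule prob_space_iid_law)
    have sQ: "space (iid_law Q) = space (iid_law X)" by (rule space_iid_law[OF Qs])
    have AQ: "?A \<in> IQ.events" using A obs_sets_subset[of X k] sets_iid_law[OF Qs] by auto
    have "measure (iid_law Q) {\<omega>\<in>space (iid_law Q). enat k < \<tau> \<omega>} \<le> ?s"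
    proof (rule cSUP_upper[OF Q])
      show "bdd_above ((\<lambda>Q. measure (iid_law Q) {\<omega>\<in>space (iid_law Q). enat k < \<tau> \<omega>}) ` QQ)"
        using R by (intro bdd_aboveI2[where M=1] prob_space.prob_le_1 prob_space_iid_law) auto
    qed
    moreover have "{\<omega>\<in>space (iid_law Q). enat k < \<tau> \<omega>} = space (iid_law Q) - ?A" by (auto simp: sQ)
    ultimately show "1 - ?s \<le> (\<integral>\<omega>. indicator ?A \<omega> \<partial>iid_law Q)"
      using IQ.prob_compl[OF AQ] int[of Q] Q by simp
  qed
qed

section \<open>Separation from sublinear delay\<close>

lemma nn_integral_le_esssup_nn_cond_exp:
  assumes "prob_space M" and sub: "subalgebra M F" and f: "f \<in> borel_measurable M"
  shows "(\<integral>\<^sup>+x. f x \<partial>M) \<le> esssup M (nn_cond_exp M F f)"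
proof -
  interpret prob_space M by fact
  interpret finite_measure_subalgebra M F by unfold_locales (rule sub)
  have "(\<integral>\<^sup>+x. f x \<partial>M) = (\<integral>\<^sup>+x. nn_cond_exp M F f x \<partial>M)"
    using nn_cond_exp_intg[of "\<lambda>_. 1" f] f by simp
  also have "\<dots> \<le> (\<integral>\<^sup>+x. esssup M (nn_cond_exp M F f) \<partial>M)"
    by (rule nn_integral_mono_AE[OF esssup_AE])
  finally show ?thesis by (simp add: emeasure_space_1)
qed

text \<open>The alarm by time \<open>k\<close>, averaged over the auxiliary variable, is a test
  function of the observations. For \<open>k\<close> near \<gamma> / 2, validity at the constant
  time \<open>k\<close> caps its mean at 1/2 under \<open>PP\<close>, and Markov's inequality at
  change point 1 lifts it to 7/8 under \<open>QQ\<close>.\<close>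

lemma sublinear_delay_imp_fixed_sample_separation:
  fixes U :: "'u measure"
  assumes "PP \<noteq> {}" "QQ \<noteq> {}" and R: "\<And>R. R \<in> PP \<union> QQ \<Longrightarrow> prob_space R \<and> sets R = sets X"
    and aux: "aux_randomization U G" and valid: "optionally_ARL_valid_family X U G PP T"
    and lim: "((\<lambda>\<gamma>. (SUP Q\<in>QQ. robust_lorden_delay X U G PP Q (T \<gamma>)) / ennreal \<gamma>) \<longlongrightarrow> 0) at_top"
  shows "fixed_sample_separation X PP QQ"
proof -
  interpret U: prob_space U using aux by (rule aux_randomizationD)
  \<comment> \<open>The resulting bound \<gamma> / 16 on the mean, divided by \<open>k + 1\<close>,
    which is at least \<gamma> / 2, leaves a miss probability of at most 1/8.\<close>
  have "\<forall>\<^sub>F \<gamma> in at_top. (SUP Q\<in>QQ. robust_lorden_delay X U G PP Q (T \<gamma>)) / ennreal \<gamma> < ennreal (1/16)"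
    using lim by (intro order_tendstoD) (auto simp: ennreal_less_zero_iff)
  then have "\<forall>\<^sub>F \<gamma> in at_top. 4 \<le> \<gamma> \<and> (SUP Q\<in>QQ. robust_lorden_delay X U G PP Q (T \<gamma>)) / ennreal \<gamma> < ennreal (1/16)"
    using eventually_ge_at_top[of 4] by eventually_elim auto
  from eventually_happens[OF this] obtain \<gamma> where \<gamma>: "4 \<le> \<gamma>"
    and small: "(SUP Q\<in>QQ. robust_lorden_delay X U G PP Q (T \<gamma>)) / ennreal \<gamma> < ennreal (1/16)" by auto
  have delay: "(SUP Q\<in>QQ. robust_lorden_delay X U G PP Q (T \<gamma>)) \<le> ennreal (\<gamma> / 16)" (is "?S \<le> _")
  proof -
    have "?S = ?S / ennreal \<gamma> * ennreal \<gamma>"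
      using \<gamma> by (subst mult.commute, subst ennreal_times_divide, subst mult.commute,
          subst ennreal_mult_divide_eq) auto
    also have "\<dots> \<le> ennreal (1/16) * ennreal \<gamma>"
      using small by (intro mult_right_mono) auto
    also have "\<dots> = ennreal (\<gamma> / 16)" using \<gamma> by (subst ennreal_mult[symmetric]) auto
    finally show ?thesis .
  qed
  define k where "k = nat \<lfloor>\<gamma> / 2\<rfloor>"
  have k: "1 \<le> k" "real k \<le> \<gamma> / 2" "\<gamma> / 2 \<le> real k + 1" unfolding k_def using \<gamma> by linarith+
  have ok: "optionally_ARL_valid X U G PP \<gamma> (T \<gamma>)"
    using valid \<gamma> by (simp add: optionally_ARL_valid_family_def)
  then have st: "ext_stopping_time (full_filtration X G) (T \<gamma>)"
    by (simp add: optionally_ARL_valid_def alarm_time_def)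
  let ?A = "{z \<in> space (iid_law X) \<times> space U. T \<gamma> z \<le> enat k}"
  have A: "?A \<in> sets (full_filtration X G k)" by (rule ext_stopping_timeD[OF aux st order_refl])
  \<comment> \<open>The test function integrates over all of \<open>U\<close>, so the auxiliary
    factor \<open>G k\<close> is enlarged to \<open>U\<close>, while the observations stay cut at
    time \<open>k\<close>.\<close>
  have AU: "?A \<in> sets (obs_filtration X k \<Otimes>\<^sub>M U)"
  proof -
    have "sets (full_filtration X G k) \<subseteq> sets (obs_filtration X k \<Otimes>\<^sub>M U)"
      unfolding full_filtration_def by (intro sets_pair_mono) (auto simp: aux_randomizationD[OF aux])
    with A show ?thesis by blast
  qed
  have AR: "?A \<in> sets (iid_law R \<Otimes>\<^sub>M U)" if "R \<in> PP \<union> QQ" for R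
    using A subalgebra_full_filtration[OF aux sets_iid_law, of R X k] R[OF that] by (auto simp: subalgebra_def)
  have spR: "space (iid_law R \<Otimes>\<^sub>M U) = space (iid_law X) \<times> space U" if "R \<in> PP \<union> QQ" for R
    using space_iid_law[of R X] R[OF that] by (simp add: space_pair_measure)
  define \<psi> where "\<psi> \<omega> = measure U (Pair \<omega> -` ?A)" for \<omega>
  have int: "(\<integral>\<omega>. \<psi> \<omega> \<partial>iid_law R) = measure (iid_law R \<Otimes>\<^sub>M U) ?A" if "R \<in> PP \<union> QQ" for R
  proof -
    have mR: "(\<lambda>\<omega>. emeasure U (Pair \<omega> -` ?A)) \<in> borel_measurable (iid_law R)"
      using AR[OF that] by (rule U.measurable_emeasure_Pair)
    have "(\<integral>\<omega>. \<psi> \<omega> \<partial>iid_law R) = enn2real (\<integral>\<^sup>+\<omega>. ennreal (\<psi> \<omega>) \<partial>iid_law R)"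
      using mR by (intro integral_eq_nn_integral) (auto simp: \<psi>_def measure_def)
    also have "(\<integral>\<^sup>+\<omega>. ennreal (\<psi> \<omega>) \<partial>iid_law R) = emeasure (iid_law R \<Otimes>\<^sub>M U) ?A"
      using AR[OF that] by (subst U.emeasure_pair_measure_alt) (auto simp: \<psi>_def U.emeasure_eq_measure)
    finally show ?thesis by (simp add: measure_def)
  qed
  show ?thesis
  proof (rule fixed_sample_separationI[OF assms(1,2) R k(1), where \<psi>=\<psi> and a="1/2" and b="7/8"])
    show "\<psi> \<in> borel_measurable (obs_filtration X k)"
      using U.measurable_emeasure_Pair[OF AU] unfolding \<psi>_def measure_def by simp
    show "0 \<le> \<psi> \<omega> \<and> \<psi> \<omega> \<le> 1" for \<omega> by (simp add: \<psi>_def)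
    show "1/2 < (7/8 :: real)" by simp
  next
    fix P assume P: "P \<in> PP"
    interpret IP: prob_space "iid_law P" using R P by (auto intro: prob_space_iid_law)
    interpret pair_prob_space "iid_law P" U ..
    let ?M = "iid_law P \<Otimes>\<^sub>M U"
    have "ext_stopping_time (full_filtration X G) (\<lambda>_. enat k)"
      by (simp add: ext_stopping_time_def)
    then have "emeasure ?M {z \<in> space ?M. T \<gamma> z < \<infinity> \<and> T \<gamma> z \<le> enat k} \<le> mean_time ?M (\<lambda>_. enat k) / ennreal \<gamma>"
      using ok P unfolding optionally_ARL_valid_def by blast
    also have "{z \<in> space ?M. T \<gamma> z < \<infinity> \<and> T \<gamma> z \<le> enat k} = ?A"
    proof -
      have "T \<gamma> z < \<infinity> \<and> T \<gamma> z \<le> enat k \<longleftrightarrow> T \<gamma> z \<le> enat k" for z by (cases "T \<gamma> z") auto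
      then show ?thesis using spR P by simp
    qed
    also have "mean_time ?M (\<lambda>_. enat k) / ennreal \<gamma> = ennreal (real k / \<gamma>)"
      using \<gamma> by (simp add: mean_time_def emeasure_space_1 ennreal_of_nat_eq_real_of_nat divide_ennreal)
    finally have "measure ?M ?A \<le> real k / \<gamma>"
      using \<gamma> by (simp add: emeasure_eq_measure)
    also have "\<dots> \<le> 1/2" using k \<gamma> by (simp add: field_simps)
    finally show "(\<integral>\<omega>. \<psi> \<omega> \<partial>iid_law P) \<le> 1/2" using int P by simp
  next
    fix Q assume Q: "Q \<in> QQ"
    then have Qp: "prob_space Q" and Qs: "sets Q = sets X" using R by auto
    interpret IQ: prob_space "iid_law Q" using Qp by (rule prob_space_iid_law)
    interpret pair_prob_space "iid_law Q" U ..
    let ?M = "iid_law Q \<Otimes>\<^sub>M U"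
    have T: "T \<gamma> \<in> ?M \<rightarrow>\<^sub>M count_space UNIV"
      by (rule measurable_ext_stopping_time[OF aux st sets_iid_law[OF Qs]])
    \<comment> \<open>At change point 1 the law is \<open>iid_law Q\<close> whichever
      \<open>P\<close> is taken, so the delay dominates the mean of \<open>T \<gamma>\<close> under
      \<open>Q\<close>.\<close>
    obtain P where P: "P \<in> PP" using assms(1) by auto
    let ?f = "\<lambda>\<omega>. ennreal_of_enat (T \<gamma> \<omega> + 1 - enat 1)"
    have f_eq: "?f \<omega> = ennreal_of_enat (T \<gamma> \<omega>)" for \<omega>
      by (cases "T \<gamma> \<omega>") (auto simp: one_enat_def)
    have "mean_time ?M (T \<gamma>) = (\<integral>\<^sup>+\<omega>. ?f \<omega> \<partial>?M)" by (simp only: f_eq mean_time_def)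
    also have "\<dots> \<le> esssup ?M (nn_cond_exp ?M (full_filtration X G (1 - 1)) ?f)"
    proof (rule nn_integral_le_esssup_nn_cond_exp)
      show "prob_space ?M" by unfold_locales
      show "subalgebra ?M (full_filtration X G (1 - 1))"
        by (rule subalgebra_full_filtration[OF aux sets_iid_law[OF Qs]])
      show "?f \<in> borel_measurable ?M" unfolding f_eq by (rule measurable_compose[OF T]) simp
    qed
    also have "\<dots> = esssup (change_law P Q 1 \<Otimes>\<^sub>M U) (nn_cond_exp (change_law P Q 1 \<Otimes>\<^sub>M U) (full_filtration X G (1 - 1)) ?f)"
      using change_law_1[of P Q] by simp
    also have "\<dots> \<le> robust_lorden_delay X U G PP Q (T \<gamma>)"
      unfolding robust_lorden_delay_def by (rule SUP_upper2[OF P], rule SUP_upper) simp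
    also have "\<dots> \<le> (SUP Q\<in>QQ. robust_lorden_delay X U G PP Q (T \<gamma>))" using Q by (rule SUP_upper)
    also note delay
    finally have mean: "mean_time ?M (T \<gamma>) \<le> ennreal (\<gamma> / 16)" .
    have "measure ?M {z \<in> space ?M. enat k < T \<gamma> z} \<le> (\<gamma> / 16) / (real k + 1)"
      using \<gamma> by (intro measure_mean_time_Markov[OF _ T mean]) (auto intro: prob_space_axioms)
    also have "\<dots> \<le> 1/8" using k \<gamma> by (simp add: field_simps)
    also have "{z \<in> space ?M. enat k < T \<gamma> z} = space ?M - ?A" using spR Q by auto
    finally show "7/8 \<le> (\<integral>\<omega>. \<psi> \<omega> \<partial>iid_law Q)"
      using prob_compl[OF AR[of Q]] int[of Q] Q by simp
  qed
qed

section \<open>Exponential tests\<close>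

lemma indep_vars_iid_law_coordinates:
  assumes "prob_space R"
  shows "prob_space.indep_vars (iid_law R) (\<lambda>_. R) (\<lambda>i \<omega>. \<omega> i) UNIV"
proof -
  interpret r: prob_space R by fact
  interpret product_prob_space "\<lambda>_. R" "UNIV :: nat set" by unfold_locales
  interpret I: prob_space "iid_law R" using assms by (rule prob_space_iid_law)
  show ?thesis
  proof (subst I.indep_vars_iff_distr_eq_PiM')
    show "distr (iid_law R) (PiM UNIV (\<lambda>_. R)) (\<lambda>x. \<lambda>i\<in>UNIV. x i)
        = PiM UNIV (\<lambda>i. distr (iid_law R) R (\<lambda>\<omega>. \<omega> i))"
      unfolding iid_law_def by (simp add: PiM_component distr_id2 restrict_UNIV)
  qed (auto simp: iid_law_def)
qed

definition block_value :: "nat \<Rightarrow> ((nat \<Rightarrow> 'a) \<Rightarrow> real) \<Rightarrow> nat \<Rightarrow> (nat \<Rightarrow> 'a) \<Rightarrow> real" where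
  "block_value n \<phi> j \<omega> = \<phi> (\<lambda>i\<in>{..<n}. \<omega> (j * n + i))"

lemma block_value_range:
  assumes "\<And>x. x \<in> space (power_law X n) \<Longrightarrow> 0 \<le> \<phi> x \<and> \<phi> x \<le> (1::real)" and "\<omega> \<in> space (iid_law X)"
  shows "0 \<le> block_value n \<phi> j \<omega>" "block_value n \<phi> j \<omega> \<le> 1"
proof -
  have "(\<lambda>i\<in>{..<n}. \<omega> (j * n + i)) \<in> space (power_law X n)"
    using assms(2) by (auto simp: iid_law_def power_law_def space_PiM PiE_iff)
  from assms(1)[OF this] show "0 \<le> block_value n \<phi> j \<omega>" "block_value n \<phi> j \<omega> \<le> 1"
    by (auto simp: block_value_def)
qed

lemma measurable_block_value:
  assumes \<phi>: "\<phi> \<in> borel_measurable (power_law X n)" and j: "j < N"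
  shows "block_value n \<phi> j \<in> borel_measurable (obs_filtration X (n * N))"
proof -
  have idx: "j * n + i < n * N" if "i < n" for i
  proof -
    have "j * n + i < Suc j * n" using that by simp
    also have "\<dots> \<le> N * n" using j by (intro mult_le_mono1) simp
    finally show ?thesis by (simp add: mult.commute)
  qed
  have "(\<lambda>x. \<lambda>i\<in>{..<n}. x (j * n + i)) \<in> power_law X (n * N) \<rightarrow>\<^sub>M power_law X n"
    unfolding power_law_def using idx by (intro measurable_restrict measurable_component_singleton) auto
  from measurable_compose[OF measurable_compose[OF measurable_restrict_obs this] \<phi>]
  show ?thesis
    by (rule back_subst[where P="\<lambda>f. f \<in> _"])
      (auto simp: block_value_def fun_eq_iff idx restrict_def intro!: arg_cong[where f=\<phi>])
qed

lemma expectation_block_value: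
  assumes R: "prob_space R" and \<phi>: "\<phi> \<in> borel_measurable (power_law R n)"
  shows "(\<integral>\<omega>. block_value n \<phi> j \<omega> \<partial>iid_law R) = (\<integral>x. \<phi> x \<partial>power_law R n)"
proof -
  have "distr (iid_law R) (power_law R n) (\<lambda>\<omega>. \<lambda>i\<in>{..<n}. \<omega> (j * n + i)) = power_law R n"
    unfolding iid_law_def power_law_def
    using R by (intro distr_PiM_reindex[where M="\<lambda>_. R" and K=UNIV and f="\<lambda>i. j * n + i"]) (auto simp: inj_on_def)
  moreover have "(\<lambda>\<omega>. \<lambda>i\<in>{..<n}. \<omega> (j * n + i)) \<in> iid_law R \<rightarrow>\<^sub>M power_law R n"
    unfolding iid_law_def power_law_def by (intro measurable_restrict measurable_component_singleton) auto
  ultimately show ?thesis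
    using integral_distr[of "\<lambda>\<omega>. \<lambda>i\<in>{..<n}. \<omega> (j * n + i)" "iid_law R" "power_law R n" \<phi>] \<phi>
    by (simp add: block_value_def)
qed

text \<open>Distinct blocks read disjoint sets of independent coordinates.\<close>

lemma indep_vars_block_value:
  assumes R: "prob_space R" and \<phi>: "\<phi> \<in> borel_measurable (power_law R n)"
  shows "prob_space.indep_vars (iid_law R) (\<lambda>_. borel) (block_value n \<phi>) UNIV"
proof -
  interpret I: prob_space "iid_law R" using R by (rule prob_space_iid_law)
  let ?K = "\<lambda>j. {j * n..<Suc j * n}"
  have "disjoint_family_on ?K UNIV"
    unfolding disjoint_family_on_def
  proof (intro ballI impI)
    fix i j :: nat assume "i \<noteq> j"
    then have "Suc i * n \<le> j * n \<or> Suc j * n \<le> i * n" by (metis Suc_leI linorder_neqE_nat mult_le_mono1)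
    then show "?K i \<inter> ?K j = {}" by auto
  qed
  then have "I.indep_vars (\<lambda>j. PiM (?K j) (\<lambda>_. R)) (\<lambda>j \<omega>. restrict (\<lambda>i. \<omega> i) (?K j)) UNIV"
    by (intro I.indep_vars_restrict[OF indep_vars_iid_law_coordinates[OF R]]) auto
  then have "I.indep_vars (\<lambda>_. borel) (\<lambda>j \<omega>. \<phi> (\<lambda>i\<in>{..<n}. restrict (\<lambda>i. \<omega> i) (?K j) (j * n + i))) UNIV"
  proof (rule I.indep_vars_compose2[where Y="\<lambda>j x. \<phi> (\<lambda>i\<in>{..<n}. x (j * n + i))"])
    fix j
    have "(\<lambda>x. \<lambda>i\<in>{..<n}. x (j * n + i)) \<in> PiM (?K j) (\<lambda>_. R) \<rightarrow>\<^sub>M power_law R n"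
      unfolding power_law_def by (intro measurable_restrict measurable_component_singleton) auto
    then show "(\<lambda>x. \<phi> (\<lambda>i\<in>{..<n}. x (j * n + i))) \<in> borel_measurable (PiM (?K j) (\<lambda>_. R))"
      by (rule measurable_compose[OF _ \<phi>])
  qed
  also have "(\<lambda>j \<omega>. \<phi> (\<lambda>i\<in>{..<n}. restrict (\<lambda>i. \<omega> i) (?K j) (j * n + i))) = block_value n \<phi>"
    by (auto simp: block_value_def fun_eq_iff restrict_def intro!: arg_cong[where f=\<phi>])
  finally show ?thesis .
qed

text \<open>The squared ranges of the \<open>N\<close> block values sum to \<open>N\<close>, so the
  exponent 2 (N \<epsilon>)^2 / N of Hoeffding's inequality becomes 2 N \<epsilon>^2. The case
  \<open>N = 0\<close>, where this quotient degenerates, holds because the bound is then 1.\<close>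

lemma block_value_concentration:
  assumes R: "prob_space R" "sets R = sets X" and \<phi>: "\<phi> \<in> borel_measurable (power_law X n)"
    and \<phi>01: "\<And>x. x \<in> space (power_law X n) \<Longrightarrow> 0 \<le> \<phi> x \<and> \<phi> x \<le> (1::real)"
    and "0 \<le> \<epsilon>"
  shows "(\<integral>x. \<phi> x \<partial>power_law R n) + \<epsilon> \<le> c \<Longrightarrow>
      measure (iid_law R) {\<omega>\<in>space (iid_law R). real N * c \<le> (\<Sum>j<N. block_value n \<phi> j \<omega>)} \<le> exp (- 2 * real N * \<epsilon>\<^sup>2)"
    and "c \<le> (\<integral>x. \<phi> x \<partial>power_law R n) - \<epsilon> \<Longrightarrow>
      measure (iid_law R) {\<omega>\<in>space (iid_law R). (\<Sum>j<N. block_value n \<phi> j \<omega>) < real N * c} \<le> exp (- 2 * real N * \<epsilon>\<^sup>2)"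
proof -
  interpret I: prob_space "iid_law R" using R(1) by (rule prob_space_iid_law)
  let ?e = "\<integral>x. \<phi> x \<partial>power_law R n"
  have \<phi>R: "\<phi> \<in> borel_measurable (power_law R n)"
    using \<phi> unfolding measurable_cong_sets[OF sets_power_law[OF R(2)] refl] .
  interpret Hoeffding_ineq "iid_law R" "{..<N}" "block_value n \<phi>" "\<lambda>_. 0" "\<lambda>_. 1"
    "\<Sum>i<N. I.expectation (block_value n \<phi> i)"
  proof unfold_locales
    show "I.indep_vars (\<lambda>_. borel) (block_value n \<phi>) {..<N}"
      by (rule I.indep_vars_subset[OF indep_vars_block_value[OF R(1) \<phi>R]]) simp
    show "AE \<omega> in iid_law R. block_value n \<phi> i \<omega> \<in> {0..1}" for i
      using block_value_range[OF \<phi>01] by (intro AE_I2) (auto simp: space_iid_law[OF R(2)])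
  qed simp_all
  have mean: "(\<Sum>i<N. I.expectation (block_value n \<phi> i)) = real N * ?e"
    by (simp add: expectation_block_value[OF R(1) \<phi>R])
  have [measurable]: "block_value n \<phi> j \<in> borel_measurable (iid_law R)" for j
    using I.indep_vars_def[THEN iffD1, OF indep_vars_block_value[OF R(1) \<phi>R]] by blast
  have exponent: "- 2 * (real N * \<epsilon>)\<^sup>2 / (\<Sum>i<N. (1 - 0)\<^sup>2) = - 2 * real N * \<epsilon>\<^sup>2" if "0 < N"
    using that by (simp add: power2_eq_square)
  show "I.prob {\<omega>\<in>space (iid_law R). real N * c \<le> (\<Sum>j<N. block_value n \<phi> j \<omega>)} \<le> exp (- 2 * real N * \<epsilon>\<^sup>2)"
    if c: "?e + \<epsilon> \<le> c"
  proof (cases "N = 0")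
    case False
    have "real N * (?e + \<epsilon>) \<le> real N * c" using c by (rule mult_left_mono) simp
    then have "I.prob {\<omega>\<in>space (iid_law R). real N * c \<le> (\<Sum>j<N. block_value n \<phi> j \<omega>)}
        \<le> I.prob {\<omega>\<in>space (iid_law R). (\<Sum>j<N. block_value n \<phi> j \<omega>) \<ge> real N * ?e + real N * \<epsilon>}"
      by (intro I.finite_measure_mono) (auto simp: distrib_left)
    also have "\<dots> \<le> exp (- 2 * (real N * \<epsilon>)\<^sup>2 / (\<Sum>i<N. (1 - 0)\<^sup>2))"
      using Hoeffding_ineq_ge[of "real N * \<epsilon>"] False \<open>0 \<le> \<epsilon>\<close> unfolding mean by simp
    finally show ?thesis using exponent False by simp
  qed simp
  show "I.prob {\<omega>\<in>space (iid_law R). (\<Sum>j<N. block_value n \<phi> j \<omega>) < real N * c} \<le> exp (- 2 * real N * \<epsilon>\<^sup>2)"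
    if c: "c \<le> ?e - \<epsilon>"
  proof (cases "N = 0")
    case False
    have "real N * c \<le> real N * (?e - \<epsilon>)" using c by (rule mult_left_mono) simp
    then have "I.prob {\<omega>\<in>space (iid_law R). (\<Sum>j<N. block_value n \<phi> j \<omega>) < real N * c}
        \<le> I.prob {\<omega>\<in>space (iid_law R). (\<Sum>j<N. block_value n \<phi> j \<omega>) \<le> real N * ?e - real N * \<epsilon>}"
      by (intro I.finite_measure_mono) (auto simp: right_diff_distrib)
    also have "\<dots> \<le> exp (- 2 * (real N * \<epsilon>)\<^sup>2 / (\<Sum>i<N. (1 - 0)\<^sup>2))"
      using Hoeffding_ineq_le[of "real N * \<epsilon>"] False \<open>0 \<le> \<epsilon>\<close> unfolding mean by simp
    finally show ?thesis using exponent False by simp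
  qed simp
qed

lemma fixed_sample_separation_imp_exponential_tests:
  assumes R: "\<And>R. R \<in> PP \<union> QQ \<Longrightarrow> prob_space R \<and> sets R = sets X"
    and sep: "fixed_sample_separation X PP QQ"
  obtains K :: nat and A :: "nat \<Rightarrow> (nat \<Rightarrow> 'a) set" where "1 \<le> K"
    and "\<And>m. A m \<in> sets (obs_filtration X (K * m))"
    and "\<And>m P. P \<in> PP \<Longrightarrow> measure (iid_law P) (A m) \<le> (1/2) ^ m"
    and "\<And>m Q. Q \<in> QQ \<Longrightarrow> measure (iid_law Q) (space (iid_law X) - A m) \<le> (1/2) ^ m"
proof -
  obtain n \<phi> where n: "1 \<le> n" and \<phi>: "\<phi> \<in> borel_measurable (power_law X n)"
    and \<phi>01: "\<And>x. x \<in> space (power_law X n) \<Longrightarrow> 0 \<le> \<phi> x \<and> \<phi> x \<le> (1::real)"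
    and gap: "(SUP P\<in>PP. \<integral>x. \<phi> x \<partial>power_law P n) < (INF Q\<in>QQ. \<integral>x. \<phi> x \<partial>power_law Q n)"
    using sep unfolding fixed_sample_separation_def by auto
  let ?a = "SUP P\<in>PP. \<integral>x. \<phi> x \<partial>power_law P n" and ?b = "INF Q\<in>QQ. \<integral>x. \<phi> x \<partial>power_law Q n"
  have E01: "0 \<le> (\<integral>x. \<phi> x \<partial>power_law S n) \<and> (\<integral>x. \<phi> x \<partial>power_law S n) \<le> 1" if "S \<in> PP \<union> QQ" for S
  proof -
    have S: "prob_space S" "sets S = sets X" using R[OF that] by auto
    interpret prob_space "power_law S n" using S(1) by (rule prob_space_power_law)
    have sp: "space (power_law S n) = space (power_law X n)"
      by (rule sets_eq_imp_space_eq[OF sets_power_law[OF S(2)]])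
    have m: "\<phi> \<in> borel_measurable (power_law S n)"
      using \<phi> unfolding measurable_cong_sets[OF sets_power_law[OF S(2)] refl] .
    have "\<bar>\<phi> x\<bar> \<le> 1" if "x \<in> space (power_law X n)" for x using \<phi>01[OF that] by simp
    then have "integrable (power_law S n) \<phi>"
      using m by (intro integrable_const_bound[where B=1]) (auto simp: sp intro!: AE_I2)
    then show ?thesis
      using \<phi>01 by (intro conjI Bochner_Integration.integral_nonneg integral_le_const) (auto simp: sp)
  qed
  \<comment> \<open>Half the gap; with \<open>c\<close> the midpoint, means under \<open>PP\<close>
    are at least \<epsilon> below \<open>c\<close> and means under \<open>QQ\<close> at least
    \<epsilon> above it.\<close>
  define \<epsilon> where "\<epsilon> = (?b - ?a) / 2"
  define c where "c = (?a + ?b) / 2"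
  have \<epsilon>: "0 < \<epsilon>" using gap by (simp add: \<epsilon>_def)
  \<comment> \<open>With \<open>L\<close> blocks per unit of \<open>m\<close>, 2 L \<epsilon>^2 is
    at least 1, so both errors are at most exp (-m), hence at most 2 ^ -m.\<close>
  define L where "L = nat \<lceil>1 / (2 * \<epsilon>\<^sup>2)\<rceil>"
  have "0 < 1 / (2 * \<epsilon>\<^sup>2)" using \<epsilon> by simp
  then have L: "1 \<le> L" "1 / (2 * \<epsilon>\<^sup>2) \<le> real L" unfolding L_def by linarith+
  have L2: "1 \<le> 2 * real L * \<epsilon>\<^sup>2" using L(2) \<epsilon> by (simp add: field_simps)
  have rate: "exp (- 2 * real (L * m) * \<epsilon>\<^sup>2) \<le> (1/2) ^ m" for m
  proof -
    have "real m * 1 \<le> real m * (2 * real L * \<epsilon>\<^sup>2)" using L2 by (rule mult_left_mono) simp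
    then have "- 2 * real (L * m) * \<epsilon>\<^sup>2 \<le> real m * (- 1)" by (simp add: algebra_simps)
    then have "exp (- 2 * real (L * m) * \<epsilon>\<^sup>2) \<le> exp (real m * (- 1))" by simp
    also have "\<dots> = exp (- 1) ^ m" by (rule exp_of_nat_mult)
    also have "\<dots> \<le> (1/2) ^ m"
    proof (rule power_mono)
      have "2 \<le> exp (1::real)" using exp_ge_add_one_self[of "1::real"] by simp
      then show "exp (- 1) \<le> (1/2 :: real)" by (simp add: exp_minus field_simps)
    qed simp
    finally show ?thesis .
  qed
  let ?A = "\<lambda>m. {\<omega>\<in>space (iid_law X). real (L * m) * c \<le> (\<Sum>j<L * m. block_value n \<phi> j \<omega>)}"
  show ?thesis
  proof (rule that[of "n * L" ?A])
    show "1 \<le> n * L" using n L by simp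
    fix m
    have "block_value n \<phi> j \<in> borel_measurable (obs_filtration X (n * (L * m)))" if "j < L * m" for j
      by (rule measurable_block_value[OF \<phi> that])
    then have "(\<lambda>\<omega>. \<Sum>j<L * m. block_value n \<phi> j \<omega>) \<in> borel_measurable (obs_filtration X (n * L * m))"
      by (intro borel_measurable_sum) (simp add: mult.assoc)
    then have "{\<omega>\<in>space (obs_filtration X (n * L * m)). real (L * m) * c \<le> (\<Sum>j<L * m. block_value n \<phi> j \<omega>)} \<in> sets (obs_filtration X (n * L * m))"
      by measurable
    then show "?A m \<in> sets (obs_filtration X (n * L * m))" by simp
  next
    fix m P assume P: "P \<in> PP"
    then have PR: "prob_space P" "sets P = sets X" using R by auto
    have "(\<integral>x. \<phi> x \<partial>power_law P n) \<le> ?a"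
      using E01 P by (intro cSUP_upper bdd_aboveI2[where M=1]) auto
    then have "(\<integral>x. \<phi> x \<partial>power_law P n) + \<epsilon> \<le> c" by (simp add: \<epsilon>_def c_def field_simps)
    from block_value_concentration(1)[OF PR \<phi> \<phi>01 less_imp_le[OF \<epsilon>] this, of "L * m"]
    show "measure (iid_law P) (?A m) \<le> (1/2) ^ m"
      using rate[of m] space_iid_law[OF PR(2)] by (simp del: of_nat_mult)
  next
    fix m Q assume Q: "Q \<in> QQ"
    then have QR: "prob_space Q" "sets Q = sets X" using R by auto
    have "?b \<le> (\<integral>x. \<phi> x \<partial>power_law Q n)"
      using E01 Q by (intro cINF_lower bdd_belowI2[where m=0]) auto
    then have "c \<le> (\<integral>x. \<phi> x \<partial>power_law Q n) - \<epsilon>" by (simp add: \<epsilon>_def c_def field_simps)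
    from block_value_concentration(2)[OF QR \<phi> \<phi>01 less_imp_le[OF \<epsilon>] this, of "L * m"]
    have "measure (iid_law Q) {\<omega>\<in>space (iid_law X). (\<Sum>j<L * m. block_value n \<phi> j \<omega>) < real (L * m) * c} \<le> (1/2) ^ m"
      using rate[of m] space_iid_law[OF QR(2)] by (simp del: of_nat_mult)
    also have "{\<omega>\<in>space (iid_law X). (\<Sum>j<L * m. block_value n \<phi> j \<omega>) < real (L * m) * c} = space (iid_law X) - ?A m"
      by auto
    finally show "measure (iid_law Q) (space (iid_law X) - ?A m) \<le> (1/2) ^ m" .
  qed
qed

section \<open>Stopping at the first rejection\<close>

lemma half_power_tail_sums: "(\<lambda>i. (1/2 :: real) ^ (Suc k + i)) sums (1/2) ^ k"
  using sums_mult[OF power_half_series, of "(1/2) ^ k"] by (simp add: power_add mult.commute)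

text \<open>Level: false rejections at the stages after \<open>k\<close> have probabilities that sum
  to at most 2 ^ -k. Mean: stage \<open>k + 1\<close> ends after \<open>K * (k + 1)\<close>
  observations and every failed stage costs \<open>K\<close> more, which adds at most K / 2 ^ k on
  average.\<close>

lemma first_passage_test:
  fixes K k :: nat and A :: "nat \<Rightarrow> (nat \<Rightarrow> 'a) set"
  assumes K: "1 \<le> K" and A: "\<And>m. A m \<in> sets (obs_filtration X (K * m))"
    and \<tau>_def: "\<And>\<omega>. \<tau> \<omega> = Inf {enat (K * (Suc k + i)) |i. \<omega> \<in> A (Suc k + i)}"
  shows "alarm_time (obs_filtration X) \<tau>"
    and "\<lbrakk>prob_space P; sets P = sets X; \<And>m. measure (iid_law P) (A m) \<le> (1/2) ^ m\<rbrakk>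
      \<Longrightarrow> measure (iid_law P) {\<omega>\<in>space (iid_law P). \<tau> \<omega> < \<infinity>} \<le> (1/2) ^ k"
    and "\<lbrakk>prob_space Q; sets Q = sets X; \<And>m. measure (iid_law Q) (space (iid_law X) - A m) \<le> (1/2) ^ m\<rbrakk>
      \<Longrightarrow> mean_time (iid_law Q) \<tau> \<le> ennreal (real K * (real k + 2))"
proof -
  have AX: "A m \<in> sets (iid_law X)" for m using A[of m] obs_sets_subset by blast
  have AS: "A m \<subseteq> space (iid_law X)" for m using AX[of m] by (rule sets.sets_into_space)
  have le_iff: "\<tau> \<omega> \<le> enat t \<longleftrightarrow> (\<exists>i. \<omega> \<in> A (Suc k + i) \<and> K * (Suc k + i) \<le> t)" for \<omega> t
    unfolding \<tau>_def Inf_enat_le_iff by auto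
  have fin_iff: "\<tau> \<omega> < \<infinity> \<longleftrightarrow> (\<exists>i. \<omega> \<in> A (Suc k + i))" for \<omega>
  proof
    assume "\<tau> \<omega> < \<infinity>"
    then obtain t where "\<tau> \<omega> \<le> enat t" by (cases "\<tau> \<omega>") auto
    then show "\<exists>i. \<omega> \<in> A (Suc k + i)" using le_iff by blast
  next
    assume "\<exists>i. \<omega> \<in> A (Suc k + i)"
    then obtain t where "\<tau> \<omega> \<le> enat t" using le_iff by blast
    then show "\<tau> \<omega> < \<infinity>" by (rule le_less_trans) simp
  qed
  have st: "{\<omega>\<in>space (iid_law X). \<tau> \<omega> \<le> enat t} \<in> sets (obs_filtration X t)" for t
  proof -
    have "{\<omega>\<in>space (iid_law X). \<tau> \<omega> \<le> enat t} = (\<Union>i\<in>{i. K * (Suc k + i) \<le> t}. A (Suc k + i))"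
      using AS by (auto simp: le_iff)
    also have "\<dots> \<in> sets (obs_filtration X t)"
      using A obs_filtration_mono by (intro sets.countable_UN') blast+
    finally show ?thesis .
  qed
  show alarm: "alarm_time (obs_filtration X) \<tau>"
    unfolding alarm_time_def ext_stopping_time_def
  proof (intro conjI allI ballI)
    show "Measurable.pred (obs_filtration X t) (\<lambda>\<omega>. \<tau> \<omega> \<le> enat t)" for t
      using st by (simp add: pred_def)
    show "1 \<le> \<tau> \<omega>" for \<omega>
    proof -
      have "1 \<le> enat (K * (Suc k + i))" for i
        using K by (simp add: one_enat_def)
      then show ?thesis unfolding \<tau>_def by (intro Inf_greatest) blast
    qed
  qed
  {
    assume P: "prob_space P" "sets P = sets X" and lev: "\<And>m. measure (iid_law P) (A m) \<le> (1/2) ^ m"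
    interpret prob_space "iid_law P" using P(1) by (rule prob_space_iid_law)
    have AP: "A m \<in> events" for m using AX sets_iid_law[OF P(2)] by simp
    have "{\<omega>\<in>space (iid_law P). \<tau> \<omega> < \<infinity>} = (\<Union>i. A (Suc k + i))"
      unfolding fin_iff using AS space_iid_law[OF P(2)] by blast
    then have "emeasure (iid_law P) {\<omega>\<in>space (iid_law P). \<tau> \<omega> < \<infinity>} \<le> (\<Sum>i. emeasure (iid_law P) (A (Suc k + i)))"
      using AP by (simp only:) (intro emeasure_subadditive_countably, blast)
    also have "\<dots> \<le> (\<Sum>i. ennreal ((1/2) ^ (Suc k + i)))"
      unfolding emeasure_eq_measure by (intro suminf_le summableI ennreal_leI lev)
    also have "\<dots> = ennreal ((1/2) ^ k)"
      by (rule suminf_ennreal_eq[OF _ half_power_tail_sums]) simp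
    finally show "prob {\<omega>\<in>space (iid_law P). \<tau> \<omega> < \<infinity>} \<le> (1/2) ^ k"
      by (simp add: emeasure_eq_measure)
  }
  {
    assume Q: "prob_space Q" "sets Q = sets X"
      and pow: "\<And>m. measure (iid_law Q) (space (iid_law X) - A m) \<le> (1/2) ^ m"
    interpret prob_space "iid_law Q" using Q(1) by (rule prob_space_iid_law)
    have spQ: "space (iid_law Q) = space (iid_law X)" by (rule space_iid_law[OF Q(2)])
    let ?B = "\<lambda>i. space (iid_law X) - A (Suc k + i)"
    have B: "?B i \<in> events" for i using AX sets_iid_law[OF Q(2)] by auto
    \<comment> \<open>The series counts all failed stages after \<open>k\<close>, not only those
      before the first rejection, so its expectation can be taken term by term.\<close>
    have "mean_time (iid_law Q) \<tau> \<le> (\<integral>\<^sup>+\<omega>. of_nat (K * Suc k) + (\<Sum>i. of_nat K * indicator (?B i) \<omega>) \<partial>iid_law Q)"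
      unfolding mean_time_def
    proof (rule nn_integral_mono)
      fix \<omega> assume "\<omega> \<in> space (iid_law Q)"
      then have \<omega>: "\<omega> \<in> space (iid_law X)" by (simp add: spQ)
      let ?S = "\<Sum>i. of_nat K * indicator (?B i) \<omega> :: ennreal"
      have partial: "of_nat (K * j) \<le> ?S" if "\<And>i. i < j \<Longrightarrow> \<omega> \<notin> A (Suc k + i)" for j
      proof -
        have "of_nat (K * j) = (\<Sum>i<j. of_nat K * indicator (?B i) \<omega> :: ennreal)"
          using that \<omega> by (simp add: mult.commute)
        also have "\<dots> \<le> ?S" by (intro sum_le_suminf summableI) auto
        finally show ?thesis .
      qed
      show "ennreal_of_enat (\<tau> \<omega>) \<le> of_nat (K * Suc k) + ?S"
      proof (cases "\<exists>i. \<omega> \<in> A (Suc k + i)")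
        case True
        define j where "j = (LEAST i. \<omega> \<in> A (Suc k + i))"
        have j: "\<omega> \<in> A (Suc k + j)" unfolding j_def using True by (rule LeastI_ex)
        have "\<omega> \<notin> A (Suc k + i)" if "i < j" for i using that not_less_Least unfolding j_def by blast
        then have "of_nat (K * j) \<le> ?S" by (rule partial)
        have "\<tau> \<omega> \<le> enat (K * (Suc k + j))" using j le_iff by blast
        then have "ennreal_of_enat (\<tau> \<omega>) \<le> ennreal_of_enat (enat (K * (Suc k + j)))"
          unfolding ennreal_of_enat_le_iff .
        also have "\<dots> = of_nat (K * Suc k) + of_nat (K * j)"
          by (simp only: ennreal_of_enat_enat distrib_left of_nat_add)
        also have "\<dots> \<le> of_nat (K * Suc k) + ?S" using \<open>of_nat (K * j) \<le> ?S\<close> by (rule add_left_mono)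
        finally show ?thesis .
      next
        case False
        \<comment> \<open>If no stage rejects, all of them fail and the bound is infinite
          too.\<close>
        have "?S = \<infinity>"
        proof (rule ccontr)
          assume "?S \<noteq> \<infinity>"
          then obtain j where "?S < of_nat j" using ennreal_Ex_less_of_nat by (auto simp: less_top)
          also have "of_nat j \<le> (of_nat (K * j) :: ennreal)" using K by (intro of_nat_mono) simp
          also have "\<dots> \<le> ?S" using False by (intro partial) blast
          finally show False by simp
        qed
        then show ?thesis by simp
      qed
    qed
    also have "\<dots> = of_nat (K * Suc k) + (\<Sum>i. of_nat K * emeasure (iid_law Q) (?B i))"
    proof -
      have m: "(\<lambda>\<omega>. of_nat K * indicator (?B i) \<omega> :: ennreal) \<in> borel_measurable (iid_law Q)" for i
        using B by (intro borel_measurable_times_ennreal borel_measurable_indicator borel_measurable_const)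
      have "(\<integral>\<^sup>+\<omega>. (\<Sum>i. of_nat K * indicator (?B i) \<omega>) \<partial>iid_law Q) = (\<Sum>i. of_nat K * emeasure (iid_law Q) (?B i))"
        unfolding nn_integral_suminf[OF m] using B by (simp only: nn_integral_cmult_indicator)
      moreover have "(\<lambda>\<omega>. \<Sum>i. of_nat K * indicator (?B i) \<omega> :: ennreal) \<in> borel_measurable (iid_law Q)"
        using m by (rule borel_measurable_suminf_order)
      ultimately show ?thesis
        by (subst nn_integral_add) (simp_all add: emeasure_space_1 del: of_nat_mult of_nat_Suc)
    qed
    also have "\<dots> \<le> of_nat (K * Suc k) + (\<Sum>i. ennreal (real K * (1/2) ^ (Suc k + i)))"
    proof (intro add_left_mono suminf_le summableI)
      fix i
      have "of_nat K * emeasure (iid_law Q) (?B i) = ennreal (real K * measure (iid_law Q) (?B i))"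
        by (simp add: emeasure_eq_measure ennreal_of_nat_eq_real_of_nat ennreal_mult)
      also have "\<dots> \<le> ennreal (real K * (1/2) ^ (Suc k + i))"
        by (intro ennreal_leI mult_left_mono pow) simp
      finally show "of_nat K * emeasure (iid_law Q) (?B i) \<le> ennreal (real K * (1/2) ^ (Suc k + i))" .
    qed
    also have "(\<Sum>i. ennreal (real K * (1/2) ^ (Suc k + i))) = ennreal (real K * (1/2) ^ k)"
      by (rule suminf_ennreal_eq[OF _ sums_mult[OF half_power_tail_sums]]) simp
    also have "of_nat (K * Suc k) + ennreal (real K * (1/2) ^ k) = ennreal (real (K * Suc k) + real K * (1/2) ^ k)"
      by (simp add: ennreal_of_nat_eq_real_of_nat ennreal_plus del: of_nat_mult of_nat_Suc)
    also have "\<dots> \<le> ennreal (real K * (real k + 2))"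
    proof (rule ennreal_leI)
      have "real K * (1/2) ^ k \<le> real K * 1" by (intro mult_left_mono power_le_one) auto
      then show "real (K * Suc k) + real K * (1/2) ^ k \<le> real K * (real k + 2)" by (simp add: algebra_simps)
    qed
    finally show "mean_time (iid_law Q) \<tau> \<le> ennreal (real K * (real k + 2))" .
  }
qed

lemma fixed_sample_separation_imp_log_power_one_tests:
  assumes "PP \<noteq> {}" and R: "\<And>R. R \<in> PP \<union> QQ \<Longrightarrow> prob_space R \<and> sets R = sets X"
    and sep: "fixed_sample_separation X PP QQ"
  shows "log_power_one_tests X PP QQ"
proof -
  obtain K A where K: "1 \<le> K" and A: "\<And>m. A m \<in> sets (obs_filtration X (K * m))"
    and AP: "\<And>m P. P \<in> PP \<Longrightarrow> measure (iid_law P) (A m) \<le> (1/2) ^ m"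
    and AQ: "\<And>m Q. Q \<in> QQ \<Longrightarrow> measure (iid_law Q) (space (iid_law X) - A m) \<le> (1/2) ^ m"
    by (rule fixed_sample_separation_imp_exponential_tests[OF R sep]) blast+
  show ?thesis
    unfolding log_power_one_tests_def
  proof (rule exI[of _ "3 * real K"], rule exI[of _ "real K / ln 2"], rule ballI)
    fix \<alpha> :: real assume "\<alpha> \<in> {0<..<1}"
    then have \<alpha>: "0 < \<alpha>" "\<alpha> < 1" by auto
    \<comment> \<open>The least \<open>k\<close> with 2 ^ -k at most \<alpha>. As \<open>k\<close>
      is at most log 2 (1 / \<alpha>) + 1, the mean bound \<open>K * (k + 2)\<close> yields the two
      constants chosen above.\<close>
    define k where "k = nat \<lceil>log 2 (1 / \<alpha>)\<rceil>"
    have l0: "0 \<le> log 2 (1 / \<alpha>)" using \<alpha> by simp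
    have k: "log 2 (1 / \<alpha>) \<le> real k" "real k \<le> log 2 (1 / \<alpha>) + 1" unfolding k_def using l0 by linarith+
    have "1 / \<alpha> = 2 powr log 2 (1 / \<alpha>)" using \<alpha> by simp
    also have "\<dots> \<le> 2 powr real k" using k(1) by (intro powr_mono) auto
    also have "\<dots> = 2 ^ k" by (simp add: powr_realpow)
    finally have level: "(1/2) ^ k \<le> \<alpha>" using \<alpha> by (simp add: field_simps power_divide)
    define \<tau> where "\<tau> = (\<lambda>\<omega>. Inf {enat (K * (Suc k + i)) |i. \<omega> \<in> A (Suc k + i)})"
    note test = first_passage_test[OF K A fun_cong[OF \<tau>_def]]
    have st: "ext_stopping_time (obs_filtration X) \<tau>" using test(1) by (simp add: alarm_time_def)
    have mean: "mean_time (iid_law Q) \<tau> \<le> ennreal (real K * (real k + 2))" if Q: "Q \<in> QQ" for Q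
      using R Q AQ[OF Q] by (intro test(3)) auto
    show "\<exists>\<tau>. level_test X PP \<alpha> \<tau> \<and> (\<forall>Q\<in>QQ. power_one Q \<tau>) \<and>
        (SUP Q\<in>QQ. mean_time (iid_law Q) \<tau>) \<le> ennreal (3 * real K + real K / ln 2 * ln (1 / \<alpha>))"
    proof (intro exI[of _ \<tau>] conjI ballI)
      show "level_test X PP \<alpha> \<tau>"
        unfolding level_test_def
      proof (intro conjI test(1) cSUP_least \<open>PP \<noteq> {}\<close>)
        fix P assume P: "P \<in> PP"
        have "measure (iid_law P) {\<omega>\<in>space (iid_law P). \<tau> \<omega> < \<infinity>} \<le> (1/2) ^ k"
          using R P AP[OF P] by (intro test(2)) auto
        with level show "measure (iid_law P) {\<omega>\<in>space (iid_law P). \<tau> \<omega> < \<infinity>} \<le> \<alpha>" by simp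
      qed
    next
      fix Q assume Q: "Q \<in> QQ"
      then have QR: "prob_space Q" "sets Q = sets X" using R by auto
      interpret prob_space "iid_law Q" using QR(1) by (rule prob_space_iid_law)
      have \<tau>: "\<tau> \<in> iid_law Q \<rightarrow>\<^sub>M count_space UNIV"
        by (rule measurable_obs_stopping_time[OF st sets_iid_law[OF QR(2)]])
      \<comment> \<open>Power one is read off the finite mean.\<close>
      have "AE \<omega> in iid_law Q. ennreal_of_enat (\<tau> \<omega>) \<noteq> \<infinity>"
      proof (rule nn_integral_PInf_AE)
        show "(\<lambda>\<omega>. ennreal_of_enat (\<tau> \<omega>)) \<in> borel_measurable (iid_law Q)"
          by (rule measurable_compose[OF \<tau>]) simp
        show "(\<integral>\<^sup>+\<omega>. ennreal_of_enat (\<tau> \<omega>) \<partial>iid_law Q) \<noteq> \<infinity>"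
          using mean[OF Q] unfolding mean_time_def by (auto simp: top_unique)
      qed
      moreover have "ennreal_of_enat (\<tau> \<omega>) \<noteq> \<infinity> \<longleftrightarrow> \<tau> \<omega> < \<infinity>" for \<omega> by (cases "\<tau> \<omega>") auto
      ultimately have "AE \<omega> in iid_law Q. \<tau> \<omega> < \<infinity>" by simp
      moreover have "{\<omega>\<in>space (iid_law Q). \<tau> \<omega> < \<infinity>} \<in> events" using \<tau> by measurable
      ultimately show "power_one Q \<tau>" unfolding power_one_def by (simp add: prob_Collect_eq_1)
    next
      show "(SUP Q\<in>QQ. mean_time (iid_law Q) \<tau>) \<le> ennreal (3 * real K + real K / ln 2 * ln (1 / \<alpha>))"
      proof (rule SUP_least)
        fix Q assume "Q \<in> QQ"
        note mean[OF this]
        also have "ennreal (real K * (real k + 2)) \<le> ennreal (3 * real K + real K / ln 2 * ln (1 / \<alpha>))"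
        proof (rule ennreal_leI)
          have "real K * (real k + 2) \<le> real K * ((log 2 (1 / \<alpha>) + 1) + 2)"
            using k(2) by (intro mult_left_mono add_right_mono) auto
          also have "\<dots> = 3 * real K + real K / ln 2 * ln (1 / \<alpha>)" by (simp add: log_def algebra_simps)
          finally show "real K * (real k + 2) \<le> 3 * real K + real K / ln 2 * ln (1 / \<alpha>)" .
        qed
        finally show "mean_time (iid_law Q) \<tau> \<le> ennreal (3 * real K + real K / ln 2 * ln (1 / \<alpha>))" .
      qed
    qed
  qed
qed

section \<open>Total variation separation\<close>

text \<open>
  By induction, \<open>l i\<close> is combined with a convex combination \<open>g\<close> of the others that works where \<open>l i < c\<close>:
  in the plane, the convex set of the points \<open>(l i x, g x)\<close> avoids the open quadrant below \<open>(c, c)\<close>.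
\<close>

lemma finite_minimax:
  fixes l :: "'i \<Rightarrow> 'k \<Rightarrow> real"
  assumes "finite I" "I \<noteq> {}"
    and "\<And>x y u. \<lbrakk>x \<in> K; y \<in> K; 0 \<le> u; u \<le> 1\<rbrakk> \<Longrightarrow> \<exists>z\<in>K. \<forall>i\<in>I. l i z = u * l i x + (1 - u) * l i y"
    and "\<And>x. x \<in> K \<Longrightarrow> \<exists>i\<in>I. c \<le> l i x"
  shows "\<exists>w. (\<forall>i\<in>I. 0 \<le> w i) \<and> sum w I = 1 \<and> (\<forall>x\<in>K. c \<le> (\<Sum>i\<in>I. w i * l i x))"
  using assms
proof (induction I arbitrary: K rule: finite_ne_induct)
  case (singleton i)
  then show ?case by (intro exI[of _ "\<lambda>_. 1"]) auto
next
  case (insert i J)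
  \<comment> \<open>Where \<open>l i\<close> falls short of \<open>c\<close>, one of the remaining
    functions must reach it, so the induction hypothesis applies there.\<close>
  let ?K' = "{x\<in>K. l i x < c}"
  have "\<exists>w. (\<forall>j\<in>J. 0 \<le> w j) \<and> sum w J = 1 \<and> (\<forall>x\<in>?K'. c \<le> (\<Sum>j\<in>J. w j * l j x))"
  proof (rule insert.IH)
    fix x y and u :: real assume xy: "x \<in> ?K'" "y \<in> ?K'" and u: "0 \<le> u" "u \<le> 1"
    then obtain z where z: "z \<in> K" "\<forall>j\<in>insert i J. l j z = u * l j x + (1 - u) * l j y"
      using insert.prems(1)[of x y u] by auto
    have "u * l i x + (1 - u) * l i y < c"
      using xy u by (intro convex_bound_lt) auto
    with z show "\<exists>z\<in>?K'. \<forall>j\<in>J. l j z = u * l j x + (1 - u) * l j y" by auto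
  next
    fix x assume "x \<in> ?K'"
    then show "\<exists>j\<in>J. c \<le> l j x" using insert.prems(2)[of x] by auto
  qed
  then obtain w where w: "\<forall>j\<in>J. 0 \<le> w j" "sum w J = 1" and wc: "\<And>x. x \<in> ?K' \<Longrightarrow> c \<le> (\<Sum>j\<in>J. w j * l j x)"
    by auto
  let ?g = "\<lambda>x. \<Sum>j\<in>J. w j * l j x"
  let ?V = "(\<lambda>x. (l i x, ?g x)) ` K"
  let ?S = "{..<c} \<times> {..<c}"
  show ?case
  proof (cases "K = {}")
    case True
    have "(\<Sum>j\<in>insert i J. if j = i then 1 else 0 :: real) = 1" using insert.hyps by simp
    with True show ?thesis by (intro exI[of _ "\<lambda>j. if j = i then 1 else 0"]) auto
  next
    case False
    \<comment> \<open>\<open>K\<close> is only an abstract set with mixtures; in the plane its image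
      is convex in the usual sense, and a separating line is available.\<close>
    have "convex ?V"
    proof (rule convexI)
      fix p q and u v :: real assume "p \<in> ?V" "q \<in> ?V" and uv: "0 \<le> u" "0 \<le> v" "u + v = 1"
      then obtain x y where xy: "x \<in> K" "y \<in> K" "p = (l i x, ?g x)" "q = (l i y, ?g y)" by auto
      have v: "v = 1 - u" using uv by simp
      obtain z where z: "z \<in> K" "\<forall>j\<in>insert i J. l j z = u * l j x + (1 - u) * l j y"
        using insert.prems(1)[OF xy(1,2), of u] uv by auto
      have "?g z = (\<Sum>j\<in>J. u * (w j * l j x) + v * (w j * l j y))"
        by (intro sum.cong refl) (simp add: z(2) v algebra_simps)
      also have "\<dots> = u * ?g x + v * ?g y" by (simp add: sum.distrib sum_distrib_left)
      finally have "u *\<^sub>R p + v *\<^sub>R q = (l i z, ?g z)" using z(2) xy by (simp add: v)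
      with z(1) show "u *\<^sub>R p + v *\<^sub>R q \<in> ?V" by auto
    qed
    moreover have "convex ?S" by (intro convex_Times) auto
    moreover have "(l i x, ?g x) \<notin> ?S" if "x \<in> K" for x
      using wc[of x] that by auto
    then have "?S \<inter> ?V = {}" by blast
    moreover have "(c - 1, c - 1) \<in> ?S" by simp
    then have "?S \<noteq> {}" by blast
    ultimately obtain a b where ab: "a \<noteq> 0" "\<forall>q\<in>?S. inner a q \<le> b" "\<forall>v\<in>?V. b \<le> inner a v"
      using separating_hyperplane_sets[of ?S ?V] False by auto
    obtain a1 a2 where a: "a = (a1, a2)" by (cases a)
    have S: "a1 * q1 + a2 * q2 \<le> b" if "q1 < c" "q2 < c" for q1 q2
      using ab(2) that by (auto simp: a)
    \<comment> \<open>The quadrant is unbounded below in each coordinate, so a negative coefficient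
      would make the separating functional unbounded above on it.\<close>
    have far: "\<exists>t>0. b < r - \<alpha> * t" if "\<alpha> < 0" for \<alpha> r :: real
    proof (intro exI conjI)
      let ?t = "\<bar>b - r\<bar> / (- \<alpha>) + 1"
      show "0 < ?t" using that by (intro add_nonneg_pos divide_nonneg_pos) auto
      have "\<alpha> * ?t = - \<bar>b - r\<bar> + \<alpha>" using that by (simp add: field_simps)
      then show "b < r - \<alpha> * ?t" using that by linarith
    qed
    have "0 \<le> a1"
    proof (rule ccontr)
      assume "\<not> 0 \<le> a1"
      then obtain t where "t > 0" "b < a1 * (c - 1) + a2 * (c - 1) - a1 * t"
        using far[of a1 "a1 * (c - 1) + a2 * (c - 1)"] by auto
      with S[of "c - 1 - t" "c - 1"] show False by (simp add: algebra_simps)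
    qed
    moreover have "0 \<le> a2"
    proof (rule ccontr)
      assume "\<not> 0 \<le> a2"
      then obtain t where "t > 0" "b < a1 * (c - 1) + a2 * (c - 1) - a2 * t"
        using far[of a2 "a1 * (c - 1) + a2 * (c - 1)"] by auto
      with S[of "c - 1" "c - 1 - t"] show False by (simp add: algebra_simps)
    qed
    ultimately have a_nonneg: "0 \<le> a1" "0 \<le> a2" by auto
    then have s: "0 < a1 + a2" using ab(1) by (auto simp: a zero_prod_def)
    have "(a1 + a2) * c \<le> b"
    proof (rule ccontr)
      assume *: "\<not> (a1 + a2) * c \<le> b"
      \<comment> \<open>Half of the deficit, divided by \<open>a1 + a2\<close>: at
        \<open>(c - e, c - e)\<close>, still in the open quadrant, the functional exceeds
        \<open>b\<close> by the other half.\<close>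
      define e where "e = ((a1 + a2) * c - b) / (2 * (a1 + a2))"
      have "0 < e" unfolding e_def using * s by (intro divide_pos_pos) auto
      have "t * (r / (2 * t)) = r / 2" if "0 < t" for t r :: real using that by simp
      from this[OF s] have "(a1 + a2) * e = ((a1 + a2) * c - b) / 2" unfolding e_def .
      with S[of "c - e" "c - e"] \<open>0 < e\<close> * show False by (simp add: algebra_simps)
    qed
    then have cb: "c \<le> b / (a1 + a2)" using s by (simp add: pos_le_divide_eq mult.commute)
    let ?w = "\<lambda>j. if j = i then a1 / (a1 + a2) else a2 / (a1 + a2) * w j"
    have split: "(\<Sum>j\<in>insert i J. ?w j * h j) = a1 / (a1 + a2) * h i + a2 / (a1 + a2) * (\<Sum>j\<in>J. w j * h j)" for h
    proof -
      have "(\<Sum>j\<in>J. ?w j * h j) = (\<Sum>j\<in>J. a2 / (a1 + a2) * (w j * h j))"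
        using insert.hyps by (intro sum.cong) auto
      then show ?thesis using insert.hyps by (simp add: sum_distrib_left)
    qed
    show ?thesis
    proof (intro exI[of _ ?w] conjI ballI)
      show "0 \<le> ?w j" if "j \<in> insert i J" for j using that w a_nonneg by auto
      show "sum ?w (insert i J) = 1"
        using split[of "\<lambda>_. 1"] w s by (simp add: add_divide_distrib[symmetric])
      fix x assume "x \<in> K"
      then have "b \<le> a1 * l i x + a2 * ?g x" using ab(3) by (auto simp: a)
      then have "b / (a1 + a2) \<le> (a1 * l i x + a2 * ?g x) / (a1 + a2)"
        using s by (intro divide_right_mono) auto
      with cb show "c \<le> (\<Sum>j\<in>insert i J. ?w j * l j x)"
        unfolding split by (simp add: add_divide_distrib)
    qed
  qed
qed

section \<open>Bounded measurable functions and the compact dual ball\<close>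

lemma bounded_measurableD:
  assumes "f \<in> bounded_measurable M" and "x \<in> space M"
  shows "\<bar>f x\<bar> \<le> (SUP x\<in>space M. \<bar>f x\<bar>)"
proof -
  have "bdd_above ((\<lambda>x. \<bar>f x\<bar>) ` space M)"
    using assms(1) unfolding bounded_measurable_def bounded_real by (auto simp: bdd_above_def)
  then show ?thesis using assms(2) by (rule cSUP_upper[rotated])
qed

lemma bounded_measurableI:
  assumes "f \<in> borel_measurable M" and "\<And>x. x \<in> space M \<Longrightarrow> \<bar>f x\<bar> \<le> C"
  shows "restrict f (space M) \<in> bounded_measurable M"
proof -
  have "restrict f (space M) \<in> borel_measurable M"
    using assms(1) by (subst measurable_cong[where g=f]) auto
  then show ?thesis using assms(2) unfolding bounded_measurable_def bounded_real by auto
qed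

lemma bounded_measurable_comb:
  assumes "f \<in> bounded_measurable M" "g \<in> bounded_measurable M"
  shows "(\<lambda>x\<in>space M. a * f x + b * g x) \<in> bounded_measurable M"
proof (rule bounded_measurableI)
  show "(\<lambda>x. a * f x + b * g x) \<in> borel_measurable M"
    using assms by (auto simp: bounded_measurable_def)
  fix x assume x: "x \<in> space M"
  have "\<bar>a * f x + b * g x\<bar> \<le> \<bar>a\<bar> * \<bar>f x\<bar> + \<bar>b\<bar> * \<bar>g x\<bar>"
    by (rule order_trans[OF abs_triangle_ineq]) (simp add: abs_mult)
  also have "\<dots> \<le> \<bar>a\<bar> * (SUP x\<in>space M. \<bar>f x\<bar>) + \<bar>b\<bar> * (SUP x\<in>space M. \<bar>g x\<bar>)"
    using bounded_measurableD[OF assms(1) x] bounded_measurableD[OF assms(2) x]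
    by (intro add_mono mult_left_mono) auto
  finally show "\<bar>a * f x + b * g x\<bar> \<le> \<bar>a\<bar> * (SUP x\<in>space M. \<bar>f x\<bar>) + \<bar>b\<bar> * (SUP x\<in>space M. \<bar>g x\<bar>)" .
qed

text \<open>The unit ball of the dual: it contains the closed hulls and is weak-* compact (Banach--Alaoglu).\<close>

definition dual_ball :: "'w measure \<Rightarrow> (('w \<Rightarrow> real) \<Rightarrow> real) set" where
  "dual_ball M = {\<mu> \<in> extensional (bounded_measurable M).
     (\<forall>f\<in>bounded_measurable M. \<forall>g\<in>bounded_measurable M. \<forall>a b.
        \<mu> (\<lambda>x\<in>space M. a * f x + b * g x) = a * \<mu> f + b * \<mu> g) \<and>
     (\<forall>f\<in>bounded_measurable M. \<bar>\<mu> f\<bar> \<le> (SUP x\<in>space M. \<bar>f x\<bar>))}"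

lemma dual_ball_subset_ba: "dual_ball M \<subseteq> ba M"
proof
  fix \<mu> assume "\<mu> \<in> dual_ball M"
  then show "\<mu> \<in> ba M" unfolding dual_ball_def ba_def by (auto intro: exI[of _ 1])
qed

lemma continuous_map_evaluation:
  "f \<in> bounded_measurable M \<Longrightarrow> continuous_map (product_topology (\<lambda>_. euclideanreal) (bounded_measurable M)) euclideanreal (\<lambda>\<mu>. \<mu> f)"
  by (rule continuous_map_product_projection)

lemma continuous_map_weak_star:
  "f \<in> bounded_measurable M \<Longrightarrow> continuous_map (weak_star_topology M) euclideanreal (\<lambda>\<mu>. \<mu> f)"
  unfolding weak_star_topology_def by (intro continuous_map_from_subtopology continuous_map_evaluation)

lemma topspace_weak_star: "topspace (weak_star_topology M) = ba M"
  unfolding weak_star_topology_def by (auto simp: ba_def PiE_def)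

text \<open>The ball is cut out of a product of compact intervals, compact by Tychonoff's theorem,
  by the equations of linearity. Evaluations are continuous, so each equation defines a closed
  set.\<close>

lemma compactin_dual_ball: "compactin (weak_star_topology M) (dual_ball M)"
proof -
  let ?B = "bounded_measurable M"
  let ?T = "product_topology (\<lambda>_. euclideanreal) ?B"
  let ?n = "\<lambda>f. SUP x\<in>space M. \<bar>f x\<bar>"
  let ?box = "PiE ?B (\<lambda>f. {- ?n f..?n f})"
  have "compactin ?T ?box"
    unfolding compactin_PiE by (auto simp: compactin_euclidean_iff)
  moreover define L where "L = (\<lambda>(f, g, a, b). {\<mu> \<in> topspace ?T. \<mu> (\<lambda>x\<in>space M. a * f x + b * g x) - (a * \<mu> f + b * \<mu> g) \<in> {0}})"
  have "closedin ?T (L p)" if "p \<in> ?B \<times> ?B \<times> UNIV" for p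
  proof -
    obtain f g a b where p: "p = (f, g, a, b)" by (cases p) auto
    with that have fg: "f \<in> ?B" "g \<in> ?B" by auto
    have "continuous_map ?T euclideanreal (\<lambda>\<mu>. \<mu> (\<lambda>x\<in>space M. a * f x + b * g x) - (a * \<mu> f + b * \<mu> g))"
      using fg bounded_measurable_comb[OF fg, of a b]
      by (intro continuous_map_diff continuous_map_add continuous_map_real_mult_left continuous_map_evaluation)
    from closedin_continuous_map_preimage[OF this, of "{0}"] show ?thesis by (simp add: L_def p)
  qed
  then have "closedin ?T (topspace ?T \<inter> \<Inter> (L ` (?B \<times> ?B \<times> UNIV)))"
  proof (cases "?B \<times> ?B \<times> (UNIV :: (real \<times> real) set) = {}")
    case True
    then show ?thesis by (simp only: True image_empty Inter_empty Int_UNIV_right closedin_topspace)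
  next
    case False
    then show ?thesis
      using \<open>\<And>p. p \<in> ?B \<times> ?B \<times> UNIV \<Longrightarrow> closedin ?T (L p)\<close>
      by (intro closedin_Int closedin_topspace closedin_Inter) blast+
  qed
  ultimately have "compactin ?T ((topspace ?T \<inter> \<Inter> (L ` (?B \<times> ?B \<times> UNIV))) \<inter> ?box)"
    by (rule closed_Int_compactin[rotated])
  also have "(topspace ?T \<inter> \<Inter> (L ` (?B \<times> ?B \<times> UNIV))) \<inter> ?box = dual_ball M"
  proof -
    have abs_iff: "\<bar>t\<bar> \<le> s \<longleftrightarrow> - s \<le> t \<and> t \<le> s" for t s :: real by auto
    show ?thesis
      unfolding dual_ball_def L_def by (auto simp: PiE_iff abs_iff extensional_def)
  qed
  finally show ?thesis
    unfolding weak_star_topology_def compactin_subtopology using dual_ball_subset_ba by blast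
qed

lemma convex_functionals_dual_ball: "convex_functionals M (dual_ball M)"
  unfolding convex_functionals_def
proof (intro ballI allI impI)
  let ?B = "bounded_measurable M"
  fix \<mu> \<nu> and u v :: real
  assume \<mu>: "\<mu> \<in> dual_ball M" and \<nu>: "\<nu> \<in> dual_ball M" and uv: "0 \<le> u" "0 \<le> v" "u + v = 1"
  have bound: "\<bar>u * \<mu> f + v * \<nu> f\<bar> \<le> (SUP x\<in>space M. \<bar>f x\<bar>)" if f: "f \<in> ?B" for f
  proof -
    have "\<bar>u * \<mu> f + v * \<nu> f\<bar> \<le> u * \<bar>\<mu> f\<bar> + v * \<bar>\<nu> f\<bar>"
      using uv by (intro order_trans[OF abs_triangle_ineq]) (simp add: abs_mult)
    also have "\<dots> \<le> u * (SUP x\<in>space M. \<bar>f x\<bar>) + v * (SUP x\<in>space M. \<bar>f x\<bar>)"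
      using \<mu> \<nu> uv f by (intro add_mono mult_left_mono) (auto simp: dual_ball_def)
    also have "\<dots> = (SUP x\<in>space M. \<bar>f x\<bar>)" using uv by (simp add: distrib_right[symmetric])
    finally show ?thesis .
  qed
  have lin: "\<mu> (\<lambda>x\<in>space M. a * f x + b * g x) = a * \<mu> f + b * \<mu> g"
     "\<nu> (\<lambda>x\<in>space M. a * f x + b * g x) = a * \<nu> f + b * \<nu> g"
    if "f \<in> ?B" "g \<in> ?B" for f g a b using \<mu> \<nu> that by (auto simp: dual_ball_def)
  show "(\<lambda>f\<in>?B. u * \<mu> f + v * \<nu> f) \<in> dual_ball M"
    unfolding dual_ball_def
    using bound by (auto simp: bounded_measurable_comb lin algebra_simps)
qed

lemma convex_functionals_hull: "convex_functionals M (convex_functionals M hull S)"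
  by (rule hull_in) (auto simp: convex_functionals_def)

lemma expectation_functional_dual_ball:
  assumes "prob_space R" and sets_eq: "sets R = sets M"
  shows "expectation_functional M R \<in> dual_ball M"
proof -
  interpret prob_space R by fact
  let ?B = "bounded_measurable M"
  have sp: "space R = space M" using sets_eq by (rule sets_eq_imp_space_eq)
  have int: "integrable R f" if "f \<in> ?B" for f
  proof (rule integrable_const_bound)
    show "AE x in R. norm (f x) \<le> (SUP x\<in>space M. \<bar>f x\<bar>)"
      using bounded_measurableD[OF that] by (intro AE_I2) (simp add: sp)
    show "f \<in> borel_measurable R"
      using that unfolding measurable_cong_sets[OF sets_eq refl] by (simp add: bounded_measurable_def)
  qed
  have lin: "integral\<^sup>L R (\<lambda>x\<in>space M. a * f x + b * g x) = a * (\<integral>x. f x \<partial>R) + b * (\<integral>x. g x \<partial>R)"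
    if "f \<in> ?B" "g \<in> ?B" for f g a b
  proof -
    have "integral\<^sup>L R (\<lambda>x\<in>space M. a * f x + b * g x) = (\<integral>x. a * f x + b * g x \<partial>R)"
      by (rule Bochner_Integration.integral_cong) (auto simp: sp)
    then show ?thesis using int that by simp
  qed
  have bound: "\<bar>\<integral>x. f x \<partial>R\<bar> \<le> (SUP x\<in>space M. \<bar>f x\<bar>)" if f: "f \<in> ?B" for f
  proof -
    have "\<bar>\<integral>x. f x \<partial>R\<bar> \<le> (\<integral>x. \<bar>f x\<bar> \<partial>R)" by (rule integral_abs_bound)
    also have "\<dots> \<le> (SUP x\<in>space M. \<bar>f x\<bar>)"
      using int[OF f] bounded_measurableD[OF f] by (intro integral_le_const AE_I2) (auto simp: sp)
    finally show ?thesis .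
  qed
  show ?thesis
    unfolding dual_ball_def expectation_functional_def
    using bound lin by (auto simp: bounded_measurable_comb)
qed

section \<open>Closed hulls of the product laws\<close>

lemma hull_powers_subset:
  assumes "\<And>R. R \<in> RR \<Longrightarrow> prob_space R \<and> sets R = sets X"
  shows "convex_functionals (power_law X n) hull
      ((\<lambda>R. expectation_functional (power_law X n) (power_law R n)) ` RR) \<subseteq> dual_ball (power_law X n)"
proof (rule hull_minimal, rule image_subsetI)
  show "convex_functionals (power_law X n) (dual_ball (power_law X n))" by (rule convex_functionals_dual_ball)
  fix R assume "R \<in> RR"
  with assms have "prob_space R" "sets R = sets X" by auto
  then show "expectation_functional (power_law X n) (power_law R n) \<in> dual_ball (power_law X n)"
    unfolding power_law_def
    by (intro expectation_functional_dual_ball prob_space_PiM sets_PiM_cong) auto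
qed

lemma expectation_in_hull:
  "R \<in> RR \<Longrightarrow> expectation_functional (power_law X n) (power_law R n) \<in>
    convex_functionals (power_law X n) hull ((\<lambda>R. expectation_functional (power_law X n) (power_law R n)) ` RR)"
  by (intro hull_inc imageI)

text \<open>The weak-* topology is Hausdorff, so the compact dual ball is closed; the closure of the
  hull stays inside it and inherits compactness.\<close>

lemma closed_hull_powers_facts:
  assumes "\<And>R. R \<in> RR \<Longrightarrow> prob_space R \<and> sets R = sets X"
  shows "convex_functionals (power_law X n) hull
      ((\<lambda>R. expectation_functional (power_law X n) (power_law R n)) ` RR) \<subseteq> closed_hull_powers X n RR"
    and "closed_hull_powers X n RR \<subseteq> dual_ball (power_law X n)"
    and "compactin (weak_star_topology (power_law X n)) (closed_hull_powers X n RR)"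
proof -
  let ?W = "weak_star_topology (power_law X n)"
  let ?H = "convex_functionals (power_law X n) hull
      ((\<lambda>R. expectation_functional (power_law X n) (power_law R n)) ` RR)"
  have H: "?H \<subseteq> dual_ball (power_law X n)" by (rule hull_powers_subset[OF assms])
  then show "?H \<subseteq> closed_hull_powers X n RR"
    unfolding closed_hull_powers_def using dual_ball_subset_ba
    by (intro closure_of_subset) (auto simp: topspace_weak_star)
  have "Hausdorff_space ?W"
    unfolding weak_star_topology_def
    by (intro Hausdorff_space_subtopology) (auto simp: Hausdorff_space_product_topology)
  then have "closedin ?W (dual_ball (power_law X n))"
    using compactin_dual_ball by (rule compactin_imp_closedin)
  then show sub: "closed_hull_powers X n RR \<subseteq> dual_ball (power_law X n)"
    unfolding closed_hull_powers_def by (intro closure_of_minimal H)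
  show "compactin ?W (closed_hull_powers X n RR)"
    by (rule closed_compactin[OF compactin_dual_ball sub]) (simp add: closed_hull_powers_def)
qed

text \<open>The sign \<open>s\<close> serves both upper bounds (\<open>s = 1\<close>) and lower bounds (\<open>s = -1\<close>).\<close>

lemma closed_hull_powers_le:
  assumes f: "f \<in> bounded_measurable (power_law X n)"
    and RR: "\<And>R. R \<in> RR \<Longrightarrow> prob_space R \<and> sets R = sets X"
    and le: "\<And>R. R \<in> RR \<Longrightarrow> s * (\<integral>x. f x \<partial>power_law R n) \<le> c" and \<mu>: "\<mu> \<in> closed_hull_powers X n RR"
  shows "s * \<mu> f \<le> c"
proof -
  let ?M = "power_law X n"
  let ?W = "weak_star_topology ?M"
  let ?K = "{\<mu> \<in> topspace ?W. s * \<mu> f \<in> {..c}}"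
  have "closedin ?W ?K"
    using f by (intro closedin_continuous_map_preimage[where Y=euclideanreal] continuous_map_real_mult_left continuous_map_weak_star) auto
  \<comment> \<open>Intersected with the dual ball, the half space given by \<open>f\<close> is
    stable under mixtures and lies in the space of the topology.\<close>
  moreover have "convex_functionals ?M hull
      ((\<lambda>R. expectation_functional ?M (power_law R n)) ` RR) \<subseteq> {\<mu> \<in> dual_ball ?M. s * \<mu> f \<in> {..c}}"
  proof (rule hull_minimal)
    show "convex_functionals ?M {\<mu> \<in> dual_ball ?M. s * \<mu> f \<in> {..c}}"
      unfolding convex_functionals_def
    proof (intro ballI allI impI)
      fix \<mu> \<nu> and u v :: real
      assume \<mu>\<nu>: "\<mu> \<in> {\<mu> \<in> dual_ball ?M. s * \<mu> f \<in> {..c}}" "\<nu> \<in> {\<mu> \<in> dual_ball ?M. s * \<mu> f \<in> {..c}}"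
        and uv: "0 \<le> u" "0 \<le> v" "u + v = 1"
      then have "u * (s * \<mu> f) + v * (s * \<nu> f) \<le> c" by (intro convex_bound_le) auto
      moreover have "(\<lambda>f\<in>bounded_measurable ?M. u * \<mu> f + v * \<nu> f) \<in> dual_ball ?M"
        using convex_functionals_dual_ball[of ?M] \<mu>\<nu> uv unfolding convex_functionals_def by blast
      ultimately show "(\<lambda>f\<in>bounded_measurable ?M. u * \<mu> f + v * \<nu> f) \<in> {\<mu> \<in> dual_ball ?M. s * \<mu> f \<in> {..c}}"
        using f by (simp add: algebra_simps)
    qed
    show "(\<lambda>R. expectation_functional ?M (power_law R n)) ` RR \<subseteq> {\<mu> \<in> dual_ball ?M. s * \<mu> f \<in> {..c}}"
    proof (rule image_subsetI)
      fix R assume R: "R \<in> RR"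
      have "expectation_functional ?M (power_law R n) \<in> dual_ball ?M"
        using hull_powers_subset[OF RR, of RR n] expectation_in_hull[OF R, of X n] by blast
      then show "expectation_functional ?M (power_law R n) \<in> {\<mu> \<in> dual_ball ?M. s * \<mu> f \<in> {..c}}"
        using le[OF R] f by (simp add: expectation_functional_def)
    qed
  qed
  moreover have "{\<mu> \<in> dual_ball ?M. s * \<mu> f \<in> {..c}} \<subseteq> ?K"
    using dual_ball_subset_ba[of ?M] by (auto simp: topspace_weak_star)
  ultimately have "closed_hull_powers X n RR \<subseteq> ?K"
    unfolding closed_hull_powers_def by (intro closure_of_minimal) (rule order_trans)
  with \<mu> show ?thesis by auto
qed

section \<open>Test functions and total variation\<close>

abbreviation tests :: "'w measure \<Rightarrow> ('w \<Rightarrow> real) set" where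
  "tests M \<equiv> {f\<in>bounded_measurable M. \<forall>x\<in>space M. 0 \<le> f x \<and> f x \<le> 1}"

text \<open>This makes the real supremum in \<open>tv_dist\<close> meaningful: on a function with
  values in [0, 1] each member of the dual ball is at most 1 in absolute value.\<close>

lemma bdd_above_tv_dist:
  assumes "\<mu> \<in> dual_ball M" "\<nu> \<in> dual_ball M" and "space M \<noteq> {}"
  shows "bdd_above ((\<lambda>f. \<mu> f - \<nu> f) ` tests M)"
proof (rule bdd_aboveI2)
  fix f assume f: "f \<in> tests M"
  have "(SUP x\<in>space M. \<bar>f x\<bar>) \<le> 1" using f assms(3) by (intro cSUP_least) auto
  moreover have "\<bar>\<mu> f\<bar> \<le> (SUP x\<in>space M. \<bar>f x\<bar>)" "\<bar>\<nu> f\<bar> \<le> (SUP x\<in>space M. \<bar>f x\<bar>)"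
    using assms f by (auto simp: dual_ball_def)
  ultimately show "\<mu> f - \<nu> f \<le> 2" by linarith
qed

text \<open>Bounds on the expectations of one function survive mixtures and weak-* limits, so \<phi>
  separates the closed hulls by the same gap.\<close>

lemma fixed_sample_separation_imp_tv_separation:
  assumes "PP \<noteq> {}" "QQ \<noteq> {}" and R: "\<And>R. R \<in> PP \<union> QQ \<Longrightarrow> prob_space R \<and> sets R = sets X"
    and sep: "fixed_sample_separation X PP QQ"
  shows "tv_separation X PP QQ"
proof -
  obtain n \<phi> where n: "1 \<le> n" and \<phi>: "\<phi> \<in> borel_measurable (power_law X n)"
    and \<phi>01: "\<And>x. x \<in> space (power_law X n) \<Longrightarrow> 0 \<le> \<phi> x \<and> \<phi> x \<le> (1::real)"
    and gap: "(SUP P\<in>PP. \<integral>x. \<phi> x \<partial>power_law P n) < (INF Q\<in>QQ. \<integral>x. \<phi> x \<partial>power_law Q n)"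
    using sep unfolding fixed_sample_separation_def by auto
  let ?M = "power_law X n"
  let ?a = "SUP P\<in>PP. \<integral>x. \<phi> x \<partial>power_law P n" and ?b = "INF Q\<in>QQ. \<integral>x. \<phi> x \<partial>power_law Q n"
  \<comment> \<open>\<open>tv_dist\<close> subtracts the value on the \<open>QQ\<close> side from
    that on the \<open>PP\<close> side, whereas \<phi> is larger under \<open>QQ\<close>; hence the
    complement.\<close>
  define f where "f = (\<lambda>x\<in>space ?M. 1 - \<phi> x)"
  have f: "f \<in> tests ?M"
    unfolding f_def using \<phi> \<phi>01 by (auto intro!: bounded_measurableI[where C=1])
  have Ef: "(\<integral>x. f x \<partial>power_law S n) = 1 - (\<integral>x. \<phi> x \<partial>power_law S n) \<and>
      0 \<le> (\<integral>x. \<phi> x \<partial>power_law S n) \<and> (\<integral>x. \<phi> x \<partial>power_law S n) \<le> 1" if "S \<in> PP \<union> QQ" for S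
  proof -
    have S: "prob_space S" "sets S = sets X" using R[OF that] by auto
    interpret prob_space "power_law S n" unfolding power_law_def using S(1) by (intro prob_space_PiM)
    have sets_S: "sets (power_law S n) = sets ?M" unfolding power_law_def using S(2) by (intro sets_PiM_cong) auto
    have sp: "space (power_law S n) = space ?M" by (rule sets_eq_imp_space_eq[OF sets_S])
    have m: "\<phi> \<in> borel_measurable (power_law S n)"
      using \<phi> unfolding measurable_cong_sets[OF sets_S refl] .
    have "\<bar>\<phi> x\<bar> \<le> 1" if "x \<in> space ?M" for x using \<phi>01[OF that] by simp
    then have int: "integrable (power_law S n) \<phi>"
      using m by (intro integrable_const_bound[where B=1]) (auto simp: sp intro!: AE_I2)
    have "(\<integral>x. f x \<partial>power_law S n) = (\<integral>x. 1 - \<phi> x \<partial>power_law S n)"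
      by (rule Bochner_Integration.integral_cong) (auto simp: f_def sp)
    also have "\<dots> = 1 - (\<integral>x. \<phi> x \<partial>power_law S n)" using int by (simp add: prob_space)
    finally show ?thesis
      using int \<phi>01 by (auto simp: sp intro!: Bochner_Integration.integral_nonneg integral_le_const)
  qed
  have space_ne: "space ?M \<noteq> {}"
  proof -
    obtain S where "S \<in> PP" using assms(1) by auto
    then have S: "prob_space S" "sets S = sets X" using R by auto
    interpret prob_space "power_law S n" unfolding power_law_def using S(1) by (intro prob_space_PiM)
    have "sets (power_law S n) = sets ?M" unfolding power_law_def using S(2) by (intro sets_PiM_cong) auto
    from sets_eq_imp_space_eq[OF this] show ?thesis using not_empty by simp
  qed
  have RP: "\<And>R. R \<in> PP \<Longrightarrow> prob_space R \<and> sets R = sets X" and RQ: "\<And>R. R \<in> QQ \<Longrightarrow> prob_space R \<and> sets R = sets X"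
    using R by auto
  note CP = closed_hull_powers_facts[where RR=PP and n=n, OF RP]
  note CQ = closed_hull_powers_facts[where RR=QQ and n=n, OF RQ]
  have dist: "?b - ?a \<le> tv_dist ?M \<mu> \<nu>" if \<mu>: "\<mu> \<in> closed_hull_powers X n PP" and \<nu>: "\<nu> \<in> closed_hull_powers X n QQ" for \<mu> \<nu>
  proof -
    have "(\<integral>x. \<phi> x \<partial>power_law P n) \<le> ?a" if "P \<in> PP" for P
      using Ef that by (intro cSUP_upper bdd_aboveI2[where M=1]) auto
    then have "-1 * \<mu> f \<le> ?a - 1"
      using Ef f by (intro closed_hull_powers_le[OF _ RP _ \<mu>]) auto
    moreover have "?b \<le> (\<integral>x. \<phi> x \<partial>power_law Q n)" if "Q \<in> QQ" for Q
      using Ef that by (intro cINF_lower bdd_belowI2[where m=0]) auto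
    then have "1 * \<nu> f \<le> 1 - ?b"
      using Ef f by (intro closed_hull_powers_le[OF _ RQ _ \<nu>]) auto
    ultimately have "?b - ?a \<le> \<mu> f - \<nu> f" by linarith
    also have "\<dots> \<le> tv_dist ?M \<mu> \<nu>"
      unfolding tv_dist_def using CP(2) CQ(2) \<mu> \<nu> by (intro cSUP_upper[OF f] bdd_above_tv_dist space_ne) auto
    finally show ?thesis .
  qed
  have "closed_hull_powers X n PP \<noteq> {}" "closed_hull_powers X n QQ \<noteq> {}"
    using assms(1,2) subsetD[OF CP(1) expectation_in_hull] subsetD[OF CQ(1) expectation_in_hull] by fast+
  then have "?b - ?a \<le> tv_set_dist ?M (closed_hull_powers X n PP) (closed_hull_powers X n QQ)"
    unfolding tv_set_dist_def by (intro cINF_greatest) (auto simp: dist)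
  with gap have "0 < tv_set_dist ?M (closed_hull_powers X n PP) (closed_hull_powers X n QQ)" by linarith
  with n show ?thesis unfolding tv_separation_def by blast
qed

lemma tv_separation_imp_fixed_sample_separation:
  assumes "PP \<noteq> {}" "QQ \<noteq> {}" and R: "\<And>R. R \<in> PP \<union> QQ \<Longrightarrow> prob_space R \<and> sets R = sets X"
    and sep: "tv_separation X PP QQ"
  shows "fixed_sample_separation X PP QQ"
proof -
  define Cl where "Cl n = closed_hull_powers X n" for n
  obtain n where n: "1 \<le> n" and pos: "0 < tv_set_dist (power_law X n) (Cl n PP) (Cl n QQ)"
    using sep unfolding tv_separation_def Cl_def by auto
  let ?M = "power_law X n"
  let ?W = "weak_star_topology ?M"
  let ?E = "\<lambda>R. expectation_functional ?M (power_law R n)"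
  let ?H = "\<lambda>RR. convex_functionals ?M hull (?E ` RR)"
  define \<delta> where "\<delta> = tv_set_dist ?M (Cl n PP) (Cl n QQ)"
  have RP: "\<And>R. R \<in> PP \<Longrightarrow> prob_space R \<and> sets R = sets X" and RQ: "\<And>R. R \<in> QQ \<Longrightarrow> prob_space R \<and> sets R = sets X"
    using R by auto
  note CP = closed_hull_powers_facts[where RR=PP and n=n, OF RP, folded Cl_def]
  note CQ = closed_hull_powers_facts[where RR=QQ and n=n, OF RQ, folded Cl_def]
  have law: "prob_space (power_law S n) \<and> sets (power_law S n) = sets ?M" if "S \<in> PP \<union> QQ" for S
    unfolding power_law_def using R[OF that] by (auto intro!: prob_space_PiM sets_PiM_cong)
  obtain P0 Q0 where P0: "P0 \<in> PP" and Q0: "Q0 \<in> QQ" using assms(1,2) by auto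
  have space_ne: "space ?M \<noteq> {}"
    using law[of P0] P0 prob_space.not_empty[of "power_law P0 n"] sets_eq_imp_space_eq[of "power_law P0 n" ?M] by auto
  have inP: "?E P0 \<in> Cl n PP" using CP(1) expectation_in_hull[OF P0] by blast
  have inQ: "?E Q0 \<in> Cl n QQ" using CQ(1) expectation_in_hull[OF Q0] by blast
  have zero: "(\<lambda>x\<in>space ?M. 0) \<in> tests ?M"
    using bounded_measurableI[of "\<lambda>_. 0" ?M 0] by auto
  \<comment> \<open>The supremum in \<open>tv_dist\<close> need not be attained. Aiming at \<delta>
    / 2 yields a function with a strict inequality, which is an open condition on the pair.\<close>
  have dist: "\<exists>f\<in>tests ?M. \<delta> / 2 < \<mu> f - \<nu> f" if \<mu>: "\<mu> \<in> Cl n PP" and \<nu>: "\<nu> \<in> Cl n QQ" for \<mu> \<nu>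
  proof -
    have bdd: "bdd_above ((\<lambda>f. \<mu> f - \<nu> f) ` tests ?M)" if "\<mu> \<in> Cl n PP" "\<nu> \<in> Cl n QQ" for \<mu> \<nu>
      using CP(2) CQ(2) that space_ne by (intro bdd_above_tv_dist) auto
    have zero_val: "\<mu> (\<lambda>x\<in>space ?M. 0) = 0" if "\<mu> \<in> dual_ball ?M" for \<mu>
    proof -
      have "\<bar>\<mu> (\<lambda>x\<in>space ?M. 0)\<bar> \<le> (SUP x\<in>space ?M. \<bar>(\<lambda>x\<in>space ?M. 0) x\<bar>)"
        using that zero unfolding dual_ball_def by blast
      also have "\<dots> = 0" using space_ne by simp
      finally show ?thesis by simp
    qed
    \<comment> \<open>The zero function is a test, so distances are nonnegative; the real infimum in
      \<open>tv_set_dist\<close> needs this lower bound.\<close>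
    have nonneg: "0 \<le> tv_dist ?M \<mu> \<nu>" if "\<mu> \<in> Cl n PP" "\<nu> \<in> Cl n QQ" for \<mu> \<nu>
    proof -
      have "0 = \<mu> (\<lambda>x\<in>space ?M. 0) - \<nu> (\<lambda>x\<in>space ?M. 0)"
        using zero_val[OF subsetD[OF CP(2) that(1)]] zero_val[OF subsetD[OF CQ(2) that(2)]] by simp
      also have "\<dots> \<le> tv_dist ?M \<mu> \<nu>"
        unfolding tv_dist_def using bdd[OF that] by (intro cSUP_upper[OF zero])
      finally show ?thesis .
    qed
    have "\<delta> \<le> (case (\<mu>, \<nu>) of (\<mu>, \<nu>) \<Rightarrow> tv_dist ?M \<mu> \<nu>)"
      unfolding \<delta>_def tv_set_dist_def using \<mu> \<nu> nonneg
      by (intro cINF_lower bdd_belowI2[where m=0]) auto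
    then have "\<delta> / 2 < (SUP f\<in>tests ?M. \<mu> f - \<nu> f)"
      using pos unfolding \<delta>_def[symmetric] tv_dist_def by simp
    then show ?thesis
      using zero bdd[OF \<mu> \<nu>] less_cSUP_iff[of "tests ?M" "\<lambda>f. \<mu> f - \<nu> f" "\<delta> / 2"] by blast
  qed
  let ?WW = "prod_topology ?W ?W"
  define V where "V f = {p \<in> topspace ?WW. fst p f - snd p f \<in> {\<delta> / 2<..}}" for f
  have "openin ?WW (V f)" if "f \<in> tests ?M" for f
    unfolding V_def
  proof (rule openin_continuous_map_preimage[where Y=euclideanreal])
    have f: "f \<in> bounded_measurable ?M" using that by simp
    show "continuous_map ?WW euclideanreal (\<lambda>p. fst p f - snd p f)"
      using continuous_map_compose[OF continuous_map_fst continuous_map_weak_star[OF f]]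
        continuous_map_compose[OF continuous_map_snd continuous_map_weak_star[OF f]]
      by (intro continuous_map_diff) (auto simp: o_def)
  qed simp
  then have opens: "openin ?WW D" if "D \<in> V ` tests ?M" for D using that by blast
  have cover: "Cl n PP \<times> Cl n QQ \<subseteq> \<Union> (V ` tests ?M)"
  proof
    fix p assume p: "p \<in> Cl n PP \<times> Cl n QQ"
    then obtain f where f: "f \<in> tests ?M" "\<delta> / 2 < fst p f - snd p f"
      using dist[of "fst p" "snd p"] by auto
    have "Cl n PP \<times> Cl n QQ \<subseteq> topspace ?WW"
      using order_trans[OF CP(2) dual_ball_subset_ba] order_trans[OF CQ(2) dual_ball_subset_ba]
      by (simp add: topspace_weak_star Sigma_mono)
    with p f(2) have "p \<in> V f" unfolding V_def by blast
    with f(1) show "p \<in> \<Union> (V ` tests ?M)" by blast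
  qed
  have comp: "compactin ?WW (Cl n PP \<times> Cl n QQ)"
    using CP(3) CQ(3) by (simp add: compactin_Times)
  obtain I where I: "finite I" "I \<subseteq> tests ?M" and cover: "Cl n PP \<times> Cl n QQ \<subseteq> \<Union> (V ` I)"
  proof -
    have "\<exists>\<F>. finite \<F> \<and> \<F> \<subseteq> V ` tests ?M \<and> Cl n PP \<times> Cl n QQ \<subseteq> \<Union> \<F>"
      by (rule compactinD[OF comp _ cover]) (rule opens)
    then show thesis
    proof (elim exE conjE)
      fix \<F> assume \<F>: "finite \<F>" "\<F> \<subseteq> V ` tests ?M" "Cl n PP \<times> Cl n QQ \<subseteq> \<Union> \<F>"
      from finite_subset_image[OF \<F>(1,2)] show thesis
      proof (elim exE conjE)
        fix I assume "I \<subseteq> tests ?M" "finite I" "\<F> = V ` I"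
        then show thesis using \<F>(3) by (intro that) simp_all
      qed
    qed
  qed
  have "I \<noteq> {}" using cover inP inQ by auto
  obtain w where w: "\<And>f. f \<in> I \<Longrightarrow> 0 \<le> w f" "sum w I = 1"
    and mm: "\<And>p. p \<in> ?H PP \<times> ?H QQ \<Longrightarrow> \<delta> / 2 \<le> (\<Sum>f\<in>I. w f * (fst p f - snd p f))"
  proof -
    \<comment> \<open>Minimax runs on the hulls before closure: mixtures stay in them by definition,
      and they lie in the covered set.\<close>
    have "\<exists>w. (\<forall>f\<in>I. 0 \<le> w f) \<and> sum w I = 1 \<and> (\<forall>p\<in>?H PP \<times> ?H QQ. \<delta> / 2 \<le> (\<Sum>f\<in>I. w f * (fst p f - snd p f)))"
    proof (rule finite_minimax[OF \<open>finite I\<close> \<open>I \<noteq> {}\<close>])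
      fix p q and u :: real assume pq: "p \<in> ?H PP \<times> ?H QQ" "q \<in> ?H PP \<times> ?H QQ" and u: "0 \<le> u" "u \<le> 1"
      let ?mix = "\<lambda>\<mu> \<nu>. \<lambda>f\<in>bounded_measurable ?M. u * \<mu> f + (1 - u) * \<nu> f"
      have mix: "?mix \<mu> \<nu> \<in> ?H RR" if "\<mu> \<in> ?H RR" "\<nu> \<in> ?H RR" for \<mu> \<nu> RR
        using convex_functionals_hull[of ?M "?E ` RR"] that u unfolding convex_functionals_def by simp
      show "\<exists>z\<in>?H PP \<times> ?H QQ. \<forall>f\<in>I. fst z f - snd z f = u * (fst p f - snd p f) + (1 - u) * (fst q f - snd q f)"
      proof (intro bexI[of _ "(?mix (fst p) (fst q), ?mix (snd p) (snd q))"] ballI)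
        fix f assume "f \<in> I"
        then have "f \<in> bounded_measurable ?M" using I(2) by auto
        then show "fst (?mix (fst p) (fst q), ?mix (snd p) (snd q)) f - snd (?mix (fst p) (fst q), ?mix (snd p) (snd q)) f
            = u * (fst p f - snd p f) + (1 - u) * (fst q f - snd q f)"
          by (simp add: algebra_simps)
      next
        show "(?mix (fst p) (fst q), ?mix (snd p) (snd q)) \<in> ?H PP \<times> ?H QQ"
          using pq by (auto intro!: mix)
      qed
    next
      fix p assume "p \<in> ?H PP \<times> ?H QQ"
      then have "p \<in> Cl n PP \<times> Cl n QQ" using CP(1) CQ(1) by auto
      then obtain f where "f \<in> I" "p \<in> V f" using cover by blast
      then show "\<exists>f\<in>I. \<delta> / 2 \<le> fst p f - snd p f" by (intro bexI[of _ f]) (auto simp: V_def)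
    qed
    then show thesis using that by blast
  qed
  \<comment> \<open>The mixture of the tests is larger under \<open>PP\<close>; its complement is
    larger under \<open>QQ\<close>, as separation demands.\<close>
  define \<phi> where "\<phi> x = 1 - (\<Sum>f\<in>I. w f * f x)" for x
  have "f \<in> borel_measurable ?M" if "f \<in> I" for f using that I(2) by (auto simp: bounded_measurable_def)
  then have \<phi>: "\<phi> \<in> borel_measurable ?M"
    unfolding \<phi>_def [abs_def] by (intro borel_measurable_diff borel_measurable_sum borel_measurable_times borel_measurable_const)
  have \<phi>01: "0 \<le> \<phi> x \<and> \<phi> x \<le> 1" if x: "x \<in> space ?M" for x
  proof -
    have f: "0 \<le> f x" "f x \<le> 1" if "f \<in> I" for f using I(2) that x by auto
    have "0 \<le> (\<Sum>f\<in>I. w f * f x)" using w f by (intro sum_nonneg mult_nonneg_nonneg)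
    moreover have "(\<Sum>f\<in>I. w f * f x) \<le> (\<Sum>f\<in>I. w f * 1)" using w f by (intro sum_mono mult_left_mono)
    ultimately show ?thesis using w(2) by (simp add: \<phi>_def)
  qed
  have E\<phi>: "(\<integral>x. \<phi> x \<partial>power_law S n) = 1 - (\<Sum>f\<in>I. w f * ?E S f)" if S: "S \<in> PP \<union> QQ" for S
  proof -
    interpret prob_space "power_law S n" using law[OF S] by simp
    have sp: "space (power_law S n) = space ?M" using law[OF S] by (auto dest: sets_eq_imp_space_eq)
    have int: "integrable (power_law S n) f" if f: "f \<in> I" for f
    proof (rule integrable_const_bound[where B=1])
      show "AE x in power_law S n. norm (f x) \<le> 1" using I(2) f by (intro AE_I2) (auto simp: sp)
      show "f \<in> borel_measurable (power_law S n)"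
        unfolding measurable_cong_sets[OF conjunct2[OF law[OF S]] refl]
        using I(2) f by (auto simp: bounded_measurable_def)
    qed
    have "(\<integral>x. \<phi> x \<partial>power_law S n) = 1 - (\<Sum>f\<in>I. w f * (\<integral>x. f x \<partial>power_law S n))"
      unfolding \<phi>_def using int by (simp add: prob_space)
    also have "(\<Sum>f\<in>I. w f * (\<integral>x. f x \<partial>power_law S n)) = (\<Sum>f\<in>I. w f * ?E S f)"
      using I(2) by (intro sum.cong) (auto simp: expectation_functional_def)
    finally show ?thesis .
  qed
  \<comment> \<open>The margin is the same for all pairs, so strict inequality survives the supremum
    and the infimum.\<close>
  have gap: "(\<integral>x. \<phi> x \<partial>power_law P n) + \<delta> / 2 \<le> (\<integral>x. \<phi> x \<partial>power_law Q n)" if "P \<in> PP" "Q \<in> QQ" for P Q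
  proof -
    have "(?E P, ?E Q) \<in> ?H PP \<times> ?H QQ" using that by (auto intro: expectation_in_hull)
    from mm[OF this] show ?thesis
      using that by (simp add: E\<phi> right_diff_distrib sum_subtractf)
  qed
  have "(SUP P\<in>PP. \<integral>x. \<phi> x \<partial>power_law P n) + \<delta> / 2 \<le> (INF Q\<in>QQ. \<integral>x. \<phi> x \<partial>power_law Q n)"
  proof (rule cINF_greatest[OF assms(2)])
    fix Q assume "Q \<in> QQ"
    then have "(SUP P\<in>PP. \<integral>x. \<phi> x \<partial>power_law P n) \<le> (\<integral>x. \<phi> x \<partial>power_law Q n) - \<delta> / 2"
      using gap by (intro cSUP_least assms(1)) (simp add: le_diff_eq)
    then show "(SUP P\<in>PP. \<integral>x. \<phi> x \<partial>power_law P n) + \<delta> / 2 \<le> (\<integral>x. \<phi> x \<partial>power_law Q n)" by simp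
  qed
  then have "(SUP P\<in>PP. \<integral>x. \<phi> x \<partial>power_law P n) < (INF Q\<in>QQ. \<integral>x. \<phi> x \<partial>power_law Q n)"
    using pos unfolding \<delta>_def[symmetric] by linarith
  then show ?thesis
    unfolding fixed_sample_separation_def using n \<phi> \<phi>01
    by (intro exI[of _ n] conjI bexI[of _ \<phi>] ballI) auto
qed

section \<open>The equivalences\<close>

text \<open>The auxiliary type is arbitrary, so a point mass realizes the absence of randomization:
  every auxiliary event has probability 0 or 1.\<close>

lemma aux_randomization_trivial:
  "aux_randomization (return (count_space UNIV) undefined) (\<lambda>_. return (count_space UNIV) undefined)"
  unfolding aux_randomization_def subalgebra_def filtration_def
  by (simp add: prob_space_return)

lemma fixed_sample_separation_imp_log_delay_detector:
  assumes "PP \<noteq> {}" and R: "\<And>R. R \<in> PP \<union> QQ \<Longrightarrow> prob_space R \<and> sets R = sets X"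
    and sep: "fixed_sample_separation X PP QQ" and "0 < \<eta>"
  shows "\<exists>(U :: 'u measure) G D. aux_randomization U G \<and> e_detector X U G PP D \<and>
    log_delay_family X U G PP QQ \<eta> (threshold_time D)"
proof -
  obtain A B :: real where AB: "\<And>\<alpha>. \<alpha> \<in> {0<..<1} \<Longrightarrow> \<exists>\<tau>. level_test X PP \<alpha> \<tau> \<and> (\<forall>Q\<in>QQ. power_one Q \<tau>) \<and>
        (SUP Q\<in>QQ. mean_time (iid_law Q) \<tau>) \<le> ennreal (A + B * ln (1 / \<alpha>))"
    using fixed_sample_separation_imp_log_power_one_tests[OF assms(1) R sep]
    unfolding log_power_one_tests_def by blast
  have "(1/4 :: real) ^ Suc m \<in> {0<..<1}" for m
    using power_less_one_iff[of "1/4 :: real" "Suc m"] by auto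
  then have "\<forall>m. \<exists>\<tau>. level_test X PP ((1/4) ^ Suc m) \<tau> \<and>
      (SUP Q\<in>QQ. mean_time (iid_law Q) \<tau>) \<le> ennreal (A + B * ln (1 / (1/4) ^ Suc m))"
    using AB by blast
  then obtain \<tau> where lev: "\<And>m. level_test X PP ((1/4) ^ Suc m) (\<tau> m)"
    and sup: "\<And>m. (SUP Q\<in>QQ. mean_time (iid_law Q) (\<tau> m)) \<le> ennreal (A + B * ln (1 / (1/4) ^ Suc m))"
    by metis
  have mean: "mean_time (iid_law Q) (\<tau> m) \<le> ennreal (A + B * ln (4 ^ Suc m))" if "Q \<in> QQ" for m Q
  proof -
    have "mean_time (iid_law Q) (\<tau> m) \<le> (SUP Q\<in>QQ. mean_time (iid_law Q) (\<tau> m))"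
      using that by (rule SUP_upper)
    also note sup[of m]
    also have "1 / (1/4 :: real) ^ Suc m = 4 ^ Suc m" unfolding power_one_over by simp
    finally show ?thesis .
  qed
  have RP: "\<And>P. P \<in> PP \<Longrightarrow> prob_space P \<and> sets P = sets X" and RQ: "\<And>Q. Q \<in> QQ \<Longrightarrow> prob_space Q \<and> sets Q = sets X"
    using R by auto
  show ?thesis
    using aux_randomization_trivial
      e_detector_restarted[OF aux_randomization_trivial \<open>0 < \<eta>\<close> RP lev]
      log_delay_family_restarted[OF aux_randomization_trivial \<open>0 < \<eta>\<close> RP RQ assms(1) lev mean]
    by blast
qed

section \<open>Consequences of logarithmic delay\<close>

lemma log_delay_family_eventually:
  assumes "log_delay_family X U G PP QQ \<eta> T"
  obtains C where "0 \<le> C"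
    and "\<forall>\<^sub>F \<gamma> in at_top. (SUP Q\<in>QQ. robust_lorden_delay X U G PP Q (T \<gamma>)) \<le> ennreal (C * ln \<gamma>)"
proof -
  obtain C where C: "\<forall>\<^sub>F \<gamma> in at_top. (SUP Q\<in>QQ. robust_lorden_delay X U G PP Q (T \<gamma>)) \<le> ennreal (C * ln \<gamma>)"
    using assms unfolding log_delay_family_def by blast
  \<comment> \<open>The constant may be negative; its absolute value dominates it once ln \<gamma>
    is nonnegative.\<close>
  from C eventually_ge_at_top[of 1]
  have "\<forall>\<^sub>F \<gamma> in at_top. (SUP Q\<in>QQ. robust_lorden_delay X U G PP Q (T \<gamma>)) \<le> ennreal (\<bar>C\<bar> * ln \<gamma>)"
  proof eventually_elim
    case (elim \<gamma>)
    have "C * ln \<gamma> \<le> \<bar>C\<bar> * ln \<gamma>" using elim(2) by (intro mult_right_mono) auto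
    with elim(1) show ?case by (meson ennreal_leI order_trans)
  qed
  then show ?thesis using that[of "\<bar>C\<bar>"] by simp
qed

lemma log_delay_family_sublinear:
  assumes "log_delay_family X U G PP QQ \<eta> T"
  shows "((\<lambda>\<gamma>. (SUP Q\<in>QQ. robust_lorden_delay X U G PP Q (T \<gamma>)) / ennreal \<gamma>) \<longlongrightarrow> 0) at_top"
proof -
  obtain C where C: "0 \<le> C"
    "\<forall>\<^sub>F \<gamma> in at_top. (SUP Q\<in>QQ. robust_lorden_delay X U G PP Q (T \<gamma>)) \<le> ennreal (C * ln \<gamma>)"
    using log_delay_family_eventually[OF assms] by blast
  show ?thesis
  proof (rule tendsto_sandwich[where f="\<lambda>_. 0" and h="\<lambda>\<gamma>. ennreal (C * (ln \<gamma> / \<gamma>))"])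
    show "\<forall>\<^sub>F \<gamma> in at_top. (SUP Q\<in>QQ. robust_lorden_delay X U G PP Q (T \<gamma>)) / ennreal \<gamma> \<le> ennreal (C * (ln \<gamma> / \<gamma>))"
      using C(2) eventually_ge_at_top[of 1]
    proof eventually_elim
      case (elim \<gamma>)
      have "(SUP Q\<in>QQ. robust_lorden_delay X U G PP Q (T \<gamma>)) / ennreal \<gamma> \<le> ennreal (C * ln \<gamma>) / ennreal \<gamma>"
        using elim(1) by (rule divide_right_mono_ennreal)
      also have "\<dots> = ennreal (C * (ln \<gamma> / \<gamma>))"
        using C(1) elim(2) by (subst divide_ennreal) auto
      finally show ?case .
    qed
    show "((\<lambda>\<gamma>. ennreal (C * (ln \<gamma> / \<gamma>))) \<longlongrightarrow> 0) at_top"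
      using tendsto_ennrealI[OF tendsto_mult[OF tendsto_const[of C] ln_x_over_x_tendsto_0]] by simp
  qed auto
qed

text \<open>A multiple of ln \<gamma> eventually falls below \<gamma>, which bounds every mean from
  below. The delay bound is on the supremum over \<open>QQ\<close>, so the threshold from which this
  holds is common to all \<open>Q\<close>.\<close>

lemma log_delay_family_delay_less_ARL:
  assumes T: "log_delay_family X U G PP QQ \<eta> T"
  shows "\<exists>\<gamma>\<^sub>0\<ge>1. \<forall>Q\<in>QQ. \<forall>\<gamma>\<ge>\<gamma>\<^sub>0. robust_lorden_delay X U G PP Q (T \<gamma>)
    < (INF P\<in>PP. mean_time (iid_law P \<Otimes>\<^sub>M U) (T \<gamma>))"
proof -
  obtain C where C: "0 \<le> C"
    "\<forall>\<^sub>F \<gamma> in at_top. (SUP Q\<in>QQ. robust_lorden_delay X U G PP Q (T \<gamma>)) \<le> ennreal (C * ln \<gamma>)"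
    using log_delay_family_eventually[OF T] by blast
  have "((\<lambda>\<gamma>. C * (ln \<gamma> / \<gamma>)) \<longlongrightarrow> C * 0) at_top"
    by (intro tendsto_mult tendsto_const ln_x_over_x_tendsto_0)
  then have "\<forall>\<^sub>F \<gamma> in at_top. C * (ln \<gamma> / \<gamma>) < 1" by (rule order_tendstoD) simp
  with C(2) have "\<forall>\<^sub>F \<gamma> in at_top. \<forall>Q\<in>QQ. robust_lorden_delay X U G PP Q (T \<gamma>)
      < (INF P\<in>PP. mean_time (iid_law P \<Otimes>\<^sub>M U) (T \<gamma>))"
    using eventually_ge_at_top[of 1]
  proof eventually_elim
    case (elim \<gamma>)
    have "C * ln \<gamma> < \<gamma>" using elim(2,3) by (simp add: field_simps)
    then have "ennreal (C * ln \<gamma>) < ennreal \<gamma>" using elim(3) by (intro ennreal_lessI) auto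
    also have "\<dots> \<le> (INF P\<in>PP. mean_time (iid_law P \<Otimes>\<^sub>M U) (T \<gamma>))"
      using T elim(3) unfolding log_delay_family_def by blast
    finally show ?case using elim(1) by (meson SUP_upper order_trans le_less_trans)
  qed
  then obtain N where N: "\<And>\<gamma>. N \<le> \<gamma> \<Longrightarrow> \<forall>Q\<in>QQ. robust_lorden_delay X U G PP Q (T \<gamma>)
      < (INF P\<in>PP. mean_time (iid_law P \<Otimes>\<^sub>M U) (T \<gamma>))"
    unfolding eventually_at_top_linorder by blast
  show ?thesis by (rule exI[of _ "max 1 N"]) (use N in auto)
qed

theorem corollary4p9:
  fixes X :: "'a measure" and PP QQ :: "'a measure set"
  assumes "PP \<noteq> {}" and "QQ \<noteq> {}"
    and "\<And>R. R \<in> PP \<union> QQ \<Longrightarrow> prob_space R \<and> sets R = sets X"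
  shows
    "(fixed_sample_separation X PP QQ \<longleftrightarrow>
        (\<forall>\<eta>>0. \<exists>(U :: 'u measure) G T.
           aux_randomization U G \<and> log_delay_family X U G PP QQ \<eta> T)) \<and>
     (fixed_sample_separation X PP QQ \<longleftrightarrow>
        (\<exists>(U :: 'u measure) G T.
           aux_randomization U G \<and> optionally_ARL_valid_family X U G PP T \<and>
           ((\<lambda>\<gamma>. (SUP Q\<in>QQ. robust_lorden_delay X U G PP Q (T \<gamma>)) / ennreal \<gamma>) \<longlongrightarrow> 0) at_top)) \<and>
     (fixed_sample_separation X PP QQ \<longleftrightarrow> tv_separation X PP QQ) \<and>
     (fixed_sample_separation X PP QQ \<longleftrightarrow> log_power_one_tests X PP QQ) \<and>
     (fixed_sample_separation X PP QQ \<longleftrightarrow> uniformly_stopping_test X PP QQ) \<and>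
     (fixed_sample_separation X PP QQ \<longrightarrow>
        (\<forall>\<eta>>0. \<exists>(U :: 'u measure) G D.
           aux_randomization U G \<and> e_detector X U G PP D \<and>
           log_delay_family X U G PP QQ \<eta> (threshold_time D))) \<and>
     (\<forall>\<eta>>0. \<forall>(U :: 'u measure) G D.
        aux_randomization U G \<and> e_detector X U G PP D \<and>
        log_delay_family X U G PP QQ \<eta> (threshold_time D) \<longrightarrow>
        (\<exists>\<gamma>\<^sub>0\<ge>1. \<forall>Q\<in>QQ. \<forall>\<gamma>\<ge>\<gamma>\<^sub>0.
           robust_lorden_delay X U G PP Q (threshold_time D \<gamma>)
             < (INF P\<in>PP. mean_time (iid_law P \<Otimes>\<^sub>M U) (threshold_time D \<gamma>))))"
proof -
  let ?sep = "fixed_sample_separation X PP QQ"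
  have R: "\<And>R. R \<in> PP \<union> QQ \<Longrightarrow> prob_space R \<and> sets R = sets X" by (fact assms(3))
  then have RQ: "\<And>Q. Q \<in> QQ \<Longrightarrow> prob_space Q \<and> sets Q = sets X" by blast
  have det: "\<exists>(U :: 'u measure) G D. aux_randomization U G \<and> e_detector X U G PP D \<and>
      log_delay_family X U G PP QQ \<eta> (threshold_time D)" if ?sep "0 < \<eta>" for \<eta>
    by (rule fixed_sample_separation_imp_log_delay_detector[OF assms(1) R that])
  have fam: "\<exists>(U :: 'u measure) G T. aux_randomization U G \<and> log_delay_family X U G PP QQ \<eta> T"
    if ?sep "0 < \<eta>" for \<eta>
    using det[OF that] by blast
  \<comment> \<open>The passage from (ii) to (iii) takes one family, the one for \<eta> = 1.\<close>
  have sub: "\<exists>(U :: 'u measure) G T. aux_randomization U G \<and> optionally_ARL_valid_family X U G PP T \<and>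
      ((\<lambda>\<gamma>. (SUP Q\<in>QQ. robust_lorden_delay X U G PP Q (T \<gamma>)) / ennreal \<gamma>) \<longlongrightarrow> 0) at_top"
    if ex: "\<exists>(U :: 'u measure) G T. aux_randomization U G \<and> log_delay_family X U G PP QQ 1 T"
  proof -
    obtain U :: "'u measure" and G T where "aux_randomization U G" and T: "log_delay_family X U G PP QQ 1 T"
      using ex by blast
    moreover have "optionally_ARL_valid_family X U G PP T" using T by (simp add: log_delay_family_def)
    ultimately show ?thesis using log_delay_family_sublinear[OF T] by blast
  qed
  have sep_of_sub: ?sep if "\<exists>(U :: 'u measure) G T. aux_randomization U G \<and> optionally_ARL_valid_family X U G PP T \<and>
      ((\<lambda>\<gamma>. (SUP Q\<in>QQ. robust_lorden_delay X U G PP Q (T \<gamma>)) / ennreal \<gamma>) \<longlongrightarrow> 0) at_top"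
    using that sublinear_delay_imp_fixed_sample_separation[OF assms(1,2) R] by blast
  have 1: "?sep \<longleftrightarrow> (\<forall>\<eta>>0. \<exists>(U :: 'u measure) G T. aux_randomization U G \<and> log_delay_family X U G PP QQ \<eta> T)"
    using fam sep_of_sub[OF sub] zero_less_one by blast
  have 2: "?sep \<longleftrightarrow> (\<exists>(U :: 'u measure) G T. aux_randomization U G \<and> optionally_ARL_valid_family X U G PP T \<and>
      ((\<lambda>\<gamma>. (SUP Q\<in>QQ. robust_lorden_delay X U G PP Q (T \<gamma>)) / ennreal \<gamma>) \<longlongrightarrow> 0) at_top)"
    using sub[OF fam[OF _ zero_less_one]] sep_of_sub by blast
  have 3: "?sep \<longleftrightarrow> tv_separation X PP QQ"
    using fixed_sample_separation_imp_tv_separation[OF assms(1,2) R]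
      tv_separation_imp_fixed_sample_separation[OF assms(1,2) R] by blast
  have b: "?sep \<Longrightarrow> log_power_one_tests X PP QQ"
    by (rule fixed_sample_separation_imp_log_power_one_tests[OF assms(1) R])
  have c: "log_power_one_tests X PP QQ \<Longrightarrow> uniformly_stopping_test X PP QQ"
    by (rule log_power_one_tests_imp_uniformly_stopping_test[OF assms(2) RQ])
  have c_back: "uniformly_stopping_test X PP QQ \<Longrightarrow> ?sep"
    by (rule uniformly_stopping_test_imp_fixed_sample_separation[OF assms(1,2) R])
  have 4: "?sep \<longleftrightarrow> log_power_one_tests X PP QQ" and 5: "?sep \<longleftrightarrow> uniformly_stopping_test X PP QQ"
    using b c c_back by blast+
  have 6: "\<forall>\<eta>>0. \<forall>(U :: 'u measure) G D.
        aux_randomization U G \<and> e_detector X U G PP D \<and>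
        log_delay_family X U G PP QQ \<eta> (threshold_time D) \<longrightarrow>
        (\<exists>\<gamma>\<^sub>0\<ge>1. \<forall>Q\<in>QQ. \<forall>\<gamma>\<ge>\<gamma>\<^sub>0.
           robust_lorden_delay X U G PP Q (threshold_time D \<gamma>)
             < (INF P\<in>PP. mean_time (iid_law P \<Otimes>\<^sub>M U) (threshold_time D \<gamma>)))"
  proof (intro allI impI)
    fix \<eta> :: real and U :: "'u measure" and G D
    assume "aux_randomization U G \<and> e_detector X U G PP D \<and> log_delay_family X U G PP QQ \<eta> (threshold_time D)"
    then have "log_delay_family X U G PP QQ \<eta> (threshold_time D)" by blast
    then show "\<exists>\<gamma>\<^sub>0\<ge>1. \<forall>Q\<in>QQ. \<forall>\<gamma>\<ge>\<gamma>\<^sub>0. robust_lorden_delay X U G PP Q (threshold_time D \<gamma>)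
        < (INF P\<in>PP. mean_time (iid_law P \<Otimes>\<^sub>M U) (threshold_time D \<gamma>))"
      by (rule log_delay_family_delay_less_ARL)
  qed
  show ?thesis
  proof (intro conjI)
    show "?sep \<longrightarrow> (\<forall>\<eta>>0. \<exists>(U :: 'u measure) G D. aux_randomization U G \<and> e_detector X U G PP D \<and>
        log_delay_family X U G PP QQ \<eta> (threshold_time D))"
      using det by blast
  qed (fact 1 2 3 4 5 6)+
qed

end
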